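(* Let $N$ be a positive integer and $i\in\{0,1,\ldots,N-1\}$. Suppose that $K$ is a compact interval with non-empty interior and contained in $$\Lambda=\Big\{x\in\mathbb{R} : \lim_{j\to\infty}\operatorname{discr}X_{jN+i}(x)\text{ exists and is negative}\Big\}.$$ Assume that $$\lim_{j\to\infty}\frac{a_{(j+1)N+i-1}}{a_{jN+i-1}}=1\quad\text{and}\quad (X_{jN+i} : j\in\mathbb{N})\in\mathcal{D}_1\big(K,\mathrm{GL}(2,\mathbb{R})\big).$$ If $\sum_{j=1}^\infty\frac{1}{a_{jN+i-1}}=\infty$, then $$K_{i;n}(x,x)=\frac{|[\mathcal{X}(x)]_{2,1}|}{\pi\mu'(x)\sqrt{-\operatorname{discr}\mathcal{X}(x)}}\,\rho_{i-1;n+1}+E_{i;n}(x), \qquad x\in K,$$ where $\mathcal{X}$ is the limit of $(X_{jN+i} : j\in\mathbb{N})$, and, with a constant $c>0$ independent of $n$, $$\sup_{x\in K}|E_{i;n}(x)|\le c\sum_{k=0}^n\bigg(\Big|\frac{1}{a_{(k+1)N+i-1}}-\frac{1}{a_{kN+i-1}}\Big|+\frac{1}{a_{(k+1)N+i-1}}\sum_{j\ge k}\sup_{x\in K}\big\|X_{(j+1)N+i}(x)-X_{jN+i}(x)\big\|\bigg).$$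
   Context: $(a_n)_{n\ge 0}$ is a sequence of positive numbers and $(b_n)_{n\ge0}$ a sequence of real numbers. When $i=0$ the symbol $a_{-1}$ appears; it denotes an arbitrary fixed positive number (say $a_{-1}=1$). The polynomials $(p_n)_{n\ge 0}$ are defined by $p_0(x)=1$, $p_1(x)=(x-b_0)/a_0$, and $x p_n(x) = a_n p_{n+1}(x)+b_n p_n(x)+a_{n-1}p_{n-1}(x)$ for $n\ge1$. Set $$K_{i;n}(x,y)=\sum_{j=0}^np_{jN+i}(x)p_{jN+i}(y),\qquad \rho_{i-1;n}=\sum_{j=0}^n\frac{1}{a_{jN+i-1}}.$$ The divergence hypothesis implies the Carleman condition $\sum 1/a_n=\infty$, so there is a unique probability measure $\mu$ on $\mathbb{R}$ for which $(p_n)$ is orthonormal in $L^2(\mathbb{R},\mu)$. It is a known fact that, under the hypotheses of the claim, $\mu$ is purely absolutely continuous on $K$ with continuous positive density; $\mu'$ denotes this density. The $N$-step transfer matrix is $X_n(x)=B_{n+N-1}(x)\cdots B_n(x)$, where $B_j(x)=\begin{pmatrix}0&1\\ -\frac{a_{j-1}}{a_j}&\frac{x-b_j}{a_j}\end{pmatrix}$. For a $2\times2$ matrix $Y$: $[Y]_{k,l}$ is its $(k,l)$ entry, $\operatorname{discr}Y=(\operatorname{tr}Y)^2-4\det Y$, and $\|Y\|$ is the spectral norm. $(X_{jN+i}:j\in\mathbb{N})\in\mathcal{D}_1(K,\mathrm{GL}(2,\mathbb{R}))$ means: the maps $X_{jN+i}$ are continuous from $K$ to invertible real $2\times 2$ matrices,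 are bounded in supremum norm over $K$ uniformly in $j$, and $\sum_{j=1}^\infty\sup_{x\in K}\|X_{(j+1)N+i}(x)-X_{jN+i}(x)\|<\infty$.
   Formalization: If X_{jN+i} does not depend on j on K (e.g. N-periodic coefficients), the right-hand side of the error bound is 0 and the printed estimate is false; in that case only sup_K |E_{i;n}| ≤ c, with c independent of n, is claimed. In all other cases the estimate is as printed. *)

theory Defs
  imports "HOL-Probability.Probability"
begin

(* pre am a n stands for a_(n-1); am is the arbitrary positive value of a_(-1). *)
definition pre :: "real \<Rightarrow> (nat \<Rightarrow> real) \<Rightarrow> nat \<Rightarrow> real" where
  "pre am a n = (if n = 0 then am else a (n - 1))"

(* The last equation is the three-term recurrence
   x p_n = a_n p_(n+1) + b_n p_n + a_(n-1) p_(n-1), with n = m + 1, solved for p_(n+1). *)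
fun orth_poly :: "(nat \<Rightarrow> real) \<Rightarrow> (nat \<Rightarrow> real) \<Rightarrow> nat \<Rightarrow> real \<Rightarrow> real" where
  "orth_poly a b 0 x = 1"
| "orth_poly a b (Suc 0) x = (x - b 0) / a 0"
| "orth_poly a b (Suc (Suc m)) x =
     ((x - b (Suc m)) * orth_poly a b (Suc m) x - a m * orth_poly a b m x) / a (Suc m)"

definition orthonormal_in_L2 :: "real measure \<Rightarrow> (nat \<Rightarrow> real \<Rightarrow> real) \<Rightarrow> bool" where
  "orthonormal_in_L2 M p \<longleftrightarrow>
     (\<forall>m n. integrable M (\<lambda>x. p m x * p n x) \<and>
            (LINT x|M. p m x * p n x) = (if m = n then 1 else 0))"

(* On K the measure M is absolutely continuous with continuous positive density w;
   for a non-degenerate interval K this determines w on K, at every point. *)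
definition continuous_positive_density_on ::
  "real measure \<Rightarrow> real set \<Rightarrow> (real \<Rightarrow> real) \<Rightarrow> bool" where
  "continuous_positive_density_on M K w \<longleftrightarrow>
     continuous_on K w \<and> (\<forall>x\<in>K. w x > 0) \<and>
     (\<forall>A\<in>sets borel. A \<subseteq> K \<longrightarrow> emeasure M A = (\<integral>\<^sup>+x\<in>A. ennreal (w x) \<partial>lborel))"

definition cd_kernel ::
  "(nat \<Rightarrow> real) \<Rightarrow> (nat \<Rightarrow> real) \<Rightarrow> nat \<Rightarrow> nat \<Rightarrow> nat \<Rightarrow> real \<Rightarrow> real \<Rightarrow> real" where
  "cd_kernel a b N i n x y =
     (\<Sum>j=0..n. orth_poly a b (j * N + i) x * orth_poly a b (j * N + i) y)"

(* rho_pred am a N i n is rho_(i-1; n). *)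
definition rho_pred :: "real \<Rightarrow> (nat \<Rightarrow> real) \<Rightarrow> nat \<Rightarrow> nat \<Rightarrow> nat \<Rightarrow> real" where
  "rho_pred am a N i n = (\<Sum>j=0..n. 1 / pre am a (j * N + i))"

definition transfer1 ::
  "real \<Rightarrow> (nat \<Rightarrow> real) \<Rightarrow> (nat \<Rightarrow> real) \<Rightarrow> nat \<Rightarrow> real \<Rightarrow> real^2^2" where
  "transfer1 am a b j x =
     vector [vector [0, 1], vector [- (pre am a j / a j), (x - b j) / a j]]"

(* transfer am a b N n x is the product B_(n+N-1)(x) ... B_n(x). *)
primrec transfer ::
  "real \<Rightarrow> (nat \<Rightarrow> real) \<Rightarrow> (nat \<Rightarrow> real) \<Rightarrow> nat \<Rightarrow> nat \<Rightarrow> real \<Rightarrow> real^2^2" where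
  "transfer am a b 0 n x = mat 1"
| "transfer am a b (Suc m) n x = transfer1 am a b (n + m) x ** transfer am a b m n x"

definition discr :: "real^2^2 \<Rightarrow> real" where
  "discr Y = (trace Y)\<^sup>2 - 4 * det Y"

(* The operator norm for the Euclidean norm. *)
definition spec_norm :: "real^2^2 \<Rightarrow> real" where
  "spec_norm Y = onorm ((*v) Y)"

definition sup_dist :: "real set \<Rightarrow> (real \<Rightarrow> real^2^2) \<Rightarrow> (real \<Rightarrow> real^2^2) \<Rightarrow> real" where
  "sup_dist K F G = (SUP x\<in>K. spec_norm (F x - G x))"

definition class_D1 :: "real set \<Rightarrow> (nat \<Rightarrow> real \<Rightarrow> real^2^2) \<Rightarrow> bool" where
  "class_D1 K Y \<longleftrightarrow>
     (\<forall>j. continuous_on K (Y j)) \<and>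
     (\<forall>j. \<forall>x\<in>K. invertible (Y j x)) \<and>
     (\<exists>C. \<forall>j. \<forall>x\<in>K. spec_norm (Y j x) \<le> C) \<and>
     summable (\<lambda>j. sup_dist K (Y (j + 1)) (Y j))"

definition Lambda_set :: "(nat \<Rightarrow> real \<Rightarrow> real^2^2) \<Rightarrow> real set" where
  "Lambda_set Y = {x. \<exists>L<0. (\<lambda>j. discr (Y j x)) \<longlonglongrightarrow> L}"

(* The sum over k = 0..n on the right-hand side of the error estimate; Y j plays the role
   of X_(jN+i). *)
definition error_sum ::
  "real \<Rightarrow> (nat \<Rightarrow> real) \<Rightarrow> nat \<Rightarrow> nat \<Rightarrow> real set \<Rightarrow> (nat \<Rightarrow> real \<Rightarrow> real^2^2) \<Rightarrow> nat \<Rightarrow> real" where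
  "error_sum am a N i K Y n =
     (\<Sum>k=0..n. \<bar>1 / pre am a ((k + 1) * N + i) - 1 / pre am a (k * N + i)\<bar> +
        1 / pre am a ((k + 1) * N + i) * (\<Sum>j. sup_dist K (Y (k + j + 1)) (Y (k + j))))"

end

theory Submission
  imports Defs "HOL-Complex_Analysis.Cauchy_Integral_Formula" "HOL-Real_Asymp.Real_Asymp"
begin

text \<open>
  Put \<open>v\<^sub>j = (p\<^bsub>jN+i-1\<^esub>, p\<^bsub>jN+i\<^esub>)\<close>, so that \<open>v\<^sub>j\<^sub>+\<^sub>1 = X\<^sub>j v\<^sub>j\<close>, and
  \<open>\<alpha>\<^sub>j = a\<^bsub>jN+i-1\<^esub>\<close>. Since \<open>det X\<^sub>j = \<alpha>\<^sub>j / \<alpha>\<^sub>j\<^sub>+\<^sub>1\<close>, the Turan determinants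
  \<open>\<alpha>\<^sub>j\<^sub>+\<^sub>1 (v\<^sub>j \<and> v\<^sub>j\<^sub>+\<^sub>1)\<close> have relative increments bounded by \<open>sup |X\<^sub>j\<^sub>+\<^sub>1 - X\<^sub>j|\<close> and
  converge uniformly on \<open>K\<close> to a continuous nowhere vanishing \<open>g\<close>. For the limit matrix \<open>X\<close>, the
  square of the second coordinate equals \<open>2 [X]\<^bsub>21\<^esub> / (- discr X)\<close> times the invariant form
  \<open>v \<and> X v\<close> plus a coboundary \<open>R (X v) - R v\<close>; summing over \<open>j\<close> the coboundary telescopes, and the
  kernel asymptotics follow with \<open>g\<close> in the leading coefficient.

  It remains to show \<open>\<pi> \<mu>' = sqrt (- discr X) / (2 |g|)\<close>. For a constant \<open>\<zeta>\<close> in the lower half-plane the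
  measure with density \<open>|Im \<zeta>| / (\<pi> a\<^sub>n |p\<^sub>n\<^sub>+\<^sub>1 - \<zeta> p\<^sub>n|\<^sup>2)\<close> has a rational Stieltjes transform lying in
  the \<open>n\<close>-th Weyl disk, as does that of \<open>\<mu>\<close>, and the disks shrink to a point because
  \<open>\<Sum> 1 / \<alpha>\<^sub>j\<close> diverges. Choosing \<open>\<zeta>\<close> such that \<open>|y - \<zeta> s|\<^sup>2\<close> is proportional to the invariant form of
  \<open>X(x\<^sub>0)\<close> makes these densities nearly constant near \<open>x\<^sub>0\<close>, and comparing Poisson integrals identifies
  \<open>\<mu>'(x\<^sub>0)\<close>.
\<close>

section \<open>Quadratic forms of two-by-two matrices\<close>

text \<open>In the elliptic regime the vectors \<open>v j\<close> keep rotating, so their squared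
  second coordinates, scaled by \<alpha>, have no limit in general; only their means do. Splitting
  off an exact coboundary avoids estimating oscillating sums: the error becomes a boundary term plus
  the accumulated distance of \<open>Y j\<close> from its limit, weighted by 1 / \<alpha>.

  The boundary terms leave an additive constant, which \<open>error_sum\<close> can absorb only if
  it stays away from 0. For N = 1, a_n = 1 (including a_(-1)) and b_n = 0 it vanishes, while the
  error, built from sums of squared sines, does not. Hence the case distinction in the conclusion.

  The boundary parameter \<zeta> must not depend on t, since otherwise the density would not be the
  boundary value of one holomorphic quotient. It is therefore frozen at x0 and the density is
  identified one point at a time; the price is that the approximating densities are only nearly
  constant, and only near x0.\<close>

definition wedge :: "real^2 \<Rightarrow> real^2 \<Rightarrow> real" where
  "wedge v w = v$1 * w$2 - v$2 * w$1"

lemma mat2_vec_nth: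
  fixes Y :: "real^2^2"
  shows "(Y *v v)$1 = Y$1$1 * v$1 + Y$1$2 * v$2" "(Y *v v)$2 = Y$2$1 * v$1 + Y$2$2 * v$2"
  by (simp_all add: matrix_vector_mult_def sum_2)

lemma spec_norm_mult_vec_le: "norm (Y *v v) \<le> spec_norm Y * norm v"
  unfolding spec_norm_def by (rule onorm) simp

lemma spec_norm_nonneg: "0 \<le> spec_norm Y"
  unfolding spec_norm_def by (rule onorm_pos_le) simp

lemma spec_norm_entry_le: "\<bar>Y$k$l\<bar> \<le> spec_norm Y"
  unfolding spec_norm_def by (rule matrix_component_le_onorm)

lemma spec_norm_bound:
  assumes "\<And>v. norm (Y *v v) \<le> c * norm v"
  shows "spec_norm Y \<le> c"
  unfolding spec_norm_def using assms by (rule onorm_le)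

lemma spec_norm_triangle: "spec_norm (Y + Z) \<le> spec_norm Y + spec_norm Z"
proof (rule spec_norm_bound)
  fix v
  have "norm ((Y + Z) *v v) \<le> norm (Y *v v) + norm (Z *v v)"
    by (simp add: matrix_vector_mult_add_rdistrib norm_triangle_ineq)
  also have "\<dots> \<le> (spec_norm Y + spec_norm Z) * norm v"
    using spec_norm_mult_vec_le[of Y v] spec_norm_mult_vec_le[of Z v] by (simp add: algebra_simps)
  finally show "norm ((Y + Z) *v v) \<le> (spec_norm Y + spec_norm Z) * norm v" .
qed

lemma spec_norm_minus: "spec_norm (- Y) = spec_norm Y"
proof -
  have "(*v) (- Y) = (\<lambda>v. - (Y *v v))"
    by (simp add: fun_eq_iff vec_eq_iff forall_2 mat2_vec_nth)
  then show ?thesis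
    unfolding spec_norm_def using onorm_neg[of "(*v) Y"] by simp
qed

lemma spec_norm_commute: "spec_norm (Y - Z) = spec_norm (Z - Y)"
  using spec_norm_minus[of "Y - Z"] by simp

lemma spec_norm_zero_iff: "spec_norm Y = 0 \<longleftrightarrow> Y = 0"
proof
  assume "spec_norm Y = 0"
  then show "Y = 0"
    using spec_norm_entry_le[of Y] by (simp add: vec_eq_iff)
next
  assume "Y = 0"
  then show "spec_norm Y = 0"
    using spec_norm_bound[of Y 0] spec_norm_nonneg[of Y] by simp
qed

lemma trace2: "trace (Y :: real^2^2) = Y$1$1 + Y$2$2"
  by (simp add: trace_def sum_2)

lemma discr_alt: "discr Y = (Y$2$2 - Y$1$1)\<^sup>2 + 4 * Y$1$2 * Y$2$1"
  by (simp add: discr_def trace2 det_2 power2_eq_square algebra_simps)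

lemma continuous_on_discr: "continuous_on S F \<Longrightarrow> continuous_on S (\<lambda>x. discr (F x))"
  unfolding discr_alt by (intro continuous_intros) auto

lemma norm_vec2: "(norm (v :: real^2))\<^sup>2 = (v$1)\<^sup>2 + (v$2)\<^sup>2"
  by (simp add: norm_vec_def L2_set_def sum_2)

lemma abs_wedge_le: "\<bar>wedge v w\<bar> \<le> norm v * norm w"
proof (rule power2_le_imp_le)
  have "(wedge v w)\<^sup>2 \<le> ((v$1)\<^sup>2 + (v$2)\<^sup>2) * ((w$1)\<^sup>2 + (w$2)\<^sup>2)"
    unfolding wedge_def using zero_le_power2[of "v$1*w$1 + v$2*w$2"]
    by (simp add: power2_eq_square algebra_simps)
  then show "\<bar>wedge v w\<bar>\<^sup>2 \<le> (norm v * norm w)\<^sup>2"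
    by (simp add: power_mult_distrib norm_vec2)
qed simp

lemma wedge_diff_right: "wedge v (w - w') = wedge v w - wedge v w'"
  by (simp add: wedge_def algebra_simps)

lemma wedge_matrix: "wedge (Y *v v) (Y *v w) = det Y * wedge v w"
  by (simp add: wedge_def mat2_vec_nth det_2 algebra_simps)

text \<open>The discriminant of this binary quadratic form is \<open>discr Y\<close> (compare
  \<open>discr_alt\<close>), so a negative \<open>discr\<close> means that the form is
  definite.\<close>

lemma wedge_form: "wedge v (Y *v v) = Y$2$1 * (v$1)\<^sup>2 + (Y$2$2 - Y$1$1) * (v$1 * v$2) - Y$1$2 * (v$2)\<^sup>2"
  by (simp add: wedge_def mat2_vec_nth power2_eq_square algebra_simps)

lemma abs_wedge_form_le: "\<bar>wedge v (Y *v v)\<bar> \<le> spec_norm Y * (norm v)\<^sup>2"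
proof -
  have "\<bar>wedge v (Y *v v)\<bar> \<le> norm v * norm (Y *v v)" by (rule abs_wedge_le)
  also have "\<dots> \<le> norm v * (spec_norm Y * norm v)"
    by (intro mult_left_mono spec_norm_mult_vec_le) simp
  finally show ?thesis by (simp add: power2_eq_square algebra_simps)
qed

lemma wedge_form_diff_le:
  "\<bar>wedge v (Y *v v) - wedge v (Z *v v)\<bar> \<le> spec_norm (Y - Z) * (norm v)\<^sup>2"
  using abs_wedge_form_le[of v "Y - Z"]
  by (simp add: wedge_diff_right matrix_vector_mult_diff_rdistrib)

text \<open>Completing the square in either variable bounds \<open>(v$2)\<^sup>2\<close> and
  \<open>(v$1)\<^sup>2\<close> each by \<open>4 * M / \<delta>\<close> times the modulus of the
  form; adding the two gives the factor 8.\<close>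

lemma wedge_form_lower:
  assumes "discr Y \<le> - \<delta>" "spec_norm Y \<le> M" "0 \<le> \<delta>"
  shows "\<delta> * (norm v)\<^sup>2 \<le> 8 * M * \<bar>wedge v (Y *v v)\<bar>"
proof -
  define c e f where "c = Y$2$1" and "e = Y$2$2 - Y$1$1" and "f = - Y$1$2"
  define Q where "Q = wedge v (Y *v v)"
  have Q: "Q = c * (v$1)\<^sup>2 + e * (v$1 * v$2) + f * (v$2)\<^sup>2"
    by (simp add: Q_def wedge_form c_def e_def f_def)
  have d: "4 * c * f - e\<^sup>2 \<ge> \<delta>"
    using assms(1) by (simp add: discr_alt c_def e_def f_def algebra_simps)
  have cM: "\<bar>c\<bar> \<le> M" "\<bar>f\<bar> \<le> M"
    using spec_norm_entry_le[of Y 2 1] spec_norm_entry_le[of Y 1 2] assms(2)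
    by (auto simp: c_def f_def)
  have "4 * c * Q = (2 * c * v$1 + e * v$2)\<^sup>2 + (4 * c * f - e\<^sup>2) * (v$2)\<^sup>2"
    unfolding Q by (simp add: power2_eq_square algebra_simps)
  then have "\<delta> * (v$2)\<^sup>2 \<le> 4 * c * Q"
    using mult_right_mono[OF d zero_le_power2, of "v$2"] zero_le_power2[of "2 * c * v$1 + e * v$2"] by linarith
  also have "\<dots> \<le> 4 * (M * \<bar>Q\<bar>)"
    using mult_right_mono[OF cM(1), of "\<bar>Q\<bar>"] abs_ge_self[of "c * Q"] by (simp add: abs_mult)
  finally have 1: "\<delta> * (v$2)\<^sup>2 \<le> 4 * (M * \<bar>Q\<bar>)" .
  have "4 * f * Q = (2 * f * v$2 + e * v$1)\<^sup>2 + (4 * c * f - e\<^sup>2) * (v$1)\<^sup>2"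
    unfolding Q by (simp add: power2_eq_square algebra_simps)
  then have "\<delta> * (v$1)\<^sup>2 \<le> 4 * f * Q"
    using mult_right_mono[OF d zero_le_power2, of "v$1"] zero_le_power2[of "2 * f * v$2 + e * v$1"] by linarith
  also have "\<dots> \<le> 4 * (M * \<bar>Q\<bar>)"
    using mult_right_mono[OF cM(2), of "\<bar>Q\<bar>"] abs_ge_self[of "f * Q"] by (simp add: abs_mult)
  finally have "\<delta> * (v$1)\<^sup>2 \<le> 4 * (M * \<bar>Q\<bar>)" .
  with 1 show ?thesis by (simp add: norm_vec2 Q_def algebra_simps)
qed

lemma wedge_form_sign:
  assumes "discr Y \<le> 0"
  shows "0 \<le> Y$2$1 * wedge v (Y *v v)"
proof -
  have "4 * (Y$2$1 * wedge v (Y *v v)) = (2 * Y$2$1 * v$1 + (Y$2$2 - Y$1$1) * v$2)\<^sup>2 + (- discr Y) * (v$2)\<^sup>2"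
    unfolding wedge_form discr_alt by (simp add: power2_eq_square algebra_simps)
  moreover have "0 \<le> (- discr Y) * (v$2)\<^sup>2" using assms by (intro mult_nonneg_nonneg) auto
  ultimately show ?thesis
    using zero_le_power2[of "2 * Y$2$1 * v$1 + (Y$2$2 - Y$1$1) * v$2"] by linarith
qed

lemma det_diff_le:
  assumes "spec_norm Y \<le> M" "spec_norm Z \<le> M"
  shows "\<bar>det Y - det Z\<bar> \<le> 4 * M * spec_norm (Y - Z)"
proof -
  have prod: "\<bar>Y$k$l * Y$m$n - Z$k$l * Z$m$n\<bar> \<le> 2 * M * spec_norm (Y - Z)" for k l m n
  proof -
    have "Y$k$l * Y$m$n - Z$k$l * Z$m$n = (Y - Z)$k$l * Y$m$n + Z$k$l * (Y - Z)$m$n"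
      by (simp add: algebra_simps)
    also have "\<bar>\<dots>\<bar> \<le> \<bar>(Y - Z)$k$l\<bar> * \<bar>Y$m$n\<bar> + \<bar>Z$k$l\<bar> * \<bar>(Y - Z)$m$n\<bar>"
      unfolding abs_mult[symmetric] by (rule abs_triangle_ineq)
    also have "\<dots> \<le> spec_norm (Y - Z) * M + M * spec_norm (Y - Z)"
    proof (intro add_mono mult_mono spec_norm_entry_le abs_ge_zero spec_norm_nonneg)
      show "\<bar>Y$m$n\<bar> \<le> M" "\<bar>Z$k$l\<bar> \<le> M"
        using spec_norm_entry_le[of Y m n] spec_norm_entry_le[of Z k l] assms by auto
      then show "0 \<le> M" by linarith
    qed
    finally show ?thesis by (simp add: algebra_simps)
  qed
  show ?thesis
    using prod[of 1 1 2 2] prod[of 1 2 2 1] by (simp add: det_2)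
qed

lemma discr_diff_le:
  assumes "spec_norm Y \<le> M" "spec_norm Z \<le> M"
  shows "\<bar>discr Y - discr Z\<bar> \<le> 24 * M * spec_norm (Y - Z)"
proof -
  have "(trace Y)\<^sup>2 - (trace Z)\<^sup>2 = (trace Y - trace Z) * (trace Y + trace Z)"
    by (simp add: power2_eq_square algebra_simps)
  moreover have "\<bar>trace Y - trace Z\<bar> \<le> 2 * spec_norm (Y - Z)"
    using spec_norm_entry_le[of "Y - Z" 1 1] spec_norm_entry_le[of "Y - Z" 2 2] by (simp add: trace2)
  moreover have "\<bar>trace Y + trace Z\<bar> \<le> 4 * M"
    using spec_norm_entry_le[of Y 1 1] spec_norm_entry_le[of Y 2 2]
      spec_norm_entry_le[of Z 1 1] spec_norm_entry_le[of Z 2 2] assms by (simp add: trace2)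
  ultimately have "\<bar>(trace Y)\<^sup>2 - (trace Z)\<^sup>2\<bar> \<le> (2 * spec_norm (Y - Z)) * (4 * M)"
    by (simp only: abs_mult) (intro mult_mono, auto simp: spec_norm_nonneg)
  with det_diff_le[OF assms] show ?thesis by (simp add: discr_def algebra_simps)
qed

text \<open>Estimates are made in \<open>spec_norm\<close>, whereas limits and continuity of matrix
  functions refer to the norm of the type. A crude equivalence with factor 4, the number of entries,
  links the two.\<close>

lemma spec_norm_le_norm_mult: "spec_norm Y \<le> 4 * norm Y"
proof -
  have "spec_norm Y \<le> (\<Sum>k\<in>UNIV. \<Sum>l\<in>UNIV. \<bar>Y$k$l\<bar>)"
    unfolding spec_norm_def by (rule onorm_le_matrix_component_sum)
  also have "\<dots> \<le> (\<Sum>k\<in>(UNIV::2 set). \<Sum>l\<in>(UNIV::2 set). norm Y)"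
    by (intro sum_mono order_trans[OF component_le_norm_cart Finite_Cartesian_Product.norm_nth_le])
  finally show ?thesis by simp
qed

lemma norm_le_spec_norm_mult: "norm (Y::real^2^2) \<le> 4 * spec_norm Y"
proof -
  have "norm Y \<le> (\<Sum>k\<in>UNIV. norm (Y$k))"
    by (subst norm_vec_def) (simp add: L2_set_le_sum)
  also have "\<dots> \<le> (\<Sum>k\<in>(UNIV::2 set). \<Sum>l\<in>UNIV. \<bar>Y$k$l\<bar>)"
    by (intro sum_mono norm_le_l1_cart)
  also have "\<dots> \<le> (\<Sum>k\<in>(UNIV::2 set). \<Sum>l\<in>(UNIV::2 set). spec_norm Y)"
    by (intro sum_mono spec_norm_entry_le)
  finally show ?thesis by simp
qed

section \<open>Products of asymptotically elliptic matrices\<close>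

lemma summable_increments_limit:
  fixes S :: "nat \<Rightarrow> 'a::banach"
  assumes inc: "\<And>j. J \<le> j \<Longrightarrow> norm (S (Suc j) - S j) \<le> e j" and e: "summable e"
  obtains g where "S \<longlonglongrightarrow> g" "\<And>j. J \<le> j \<Longrightarrow> norm (S j - g) \<le> (\<Sum>k. e (k + j))"
proof -
  have e': "summable (\<lambda>k. e (k + j))" for j
    using e by (simp add: summable_iff_shift)
  have sn: "summable (\<lambda>k. norm (S (Suc k + j) - S (k + j)))" if "J \<le> j" for j
    by (rule summable_comparison_test'[OF e'[of j], of 0]) (use inc[of "_ + j"] that in auto)
  have "convergent (\<lambda>n. S (n + J))"
  proof -
    have "convergent (\<lambda>n. \<Sum>k<n. S (Suc k + J) - S (k + J))"
      using summable_norm_cancel[OF sn[of J]] by (simp add: summable_iff_convergent)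
    then have "convergent (\<lambda>n. S (n + J) - S (0 + J))"
      using sum_lessThan_telescope[of "\<lambda>k. S (k + J)"] by simp
    then show ?thesis
      using convergent_add[OF _ convergent_const, of "\<lambda>n. S (n + J) - S (0 + J)" "S J"] by simp
  qed
  then obtain g where "(\<lambda>n. S (n + J)) \<longlonglongrightarrow> g" by (auto simp: convergent_def)
  then have g: "S \<longlonglongrightarrow> g" by (rule LIMSEQ_offset)
  moreover have "norm (S j - g) \<le> (\<Sum>k. e (k + j))" if j: "J \<le> j" for j
  proof -
    have "(\<lambda>k. S (Suc k + j) - S (k + j)) sums (g - S (0 + j))"
      using telescope_sums[of "\<lambda>k. S (k + j)" g] LIMSEQ_ignore_initial_segment[OF g] by simp
    then have "norm (S j - g) = norm (\<Sum>k. S (Suc k + j) - S (k + j))"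
      by (simp add: sums_iff norm_minus_commute)
    also have "\<dots> \<le> (\<Sum>k. norm (S (Suc k + j) - S (k + j)))"
      by (rule summable_norm[OF sn[OF j]])
    also have "\<dots> \<le> (\<Sum>k. e (k + j))"
      by (rule suminf_le[OF _ sn[OF j] e']) (use inc[of "_ + j"] j in auto)
    finally show ?thesis .
  qed
  ultimately show ?thesis by (rule that)
qed

text \<open>The increments are small relative to \<open>S j\<close> itself. The bound 1/4 closes an
  induction in which the sequence never leaves the \<open>\<bar>S J\<bar> / 2\<close> neighbourhood
  of \<open>S J\<close>. Hence \<open>\<bar>S j\<bar> \<le> 2 * \<bar>S J\<bar>\<close>, which turns
  relative into absolute increments, and the limit cannot vanish if \<open>S J\<close> does
  not.\<close>

lemma relative_increments_limit:
  fixes S d :: "nat \<Rightarrow> real"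
  assumes inc: "\<And>j. J \<le> j \<Longrightarrow> \<bar>S (Suc j) - S j\<bar> \<le> C * d j * \<bar>S j\<bar>"
    and C: "0 \<le> C" and d0: "\<And>j. 0 \<le> d j" and d: "summable d"
    and small: "C * (\<Sum>k. d (k + J)) \<le> 1/4"
  obtains g where "S \<longlonglongrightarrow> g" "\<And>j. J \<le> j \<Longrightarrow> \<bar>S j - g\<bar> \<le> 2 * C * \<bar>S J\<bar> * (\<Sum>k. d (k + j))"
    "\<bar>S J\<bar> / 2 \<le> \<bar>g\<bar>"
proof -
  have d': "summable (\<lambda>k. d (k + j))" for j
    using d by (simp add: summable_iff_shift)
  have close: "\<bar>S J\<bar> * (2 * (C * (\<Sum>k<m. d (k + J)))) \<le> \<bar>S J\<bar> * (1/2)" for m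
  proof (rule mult_left_mono)
    have "C * (\<Sum>k<m. d (k + J)) \<le> C * (\<Sum>k. d (k + J))"
      by (intro mult_left_mono sum_le_suminf d' C) (auto simp: d0)
    with small show "2 * (C * (\<Sum>k<m. d (k + J))) \<le> 1/2" by linarith
  qed simp
  have *: "\<bar>S (m + J) - S J\<bar> \<le> \<bar>S J\<bar> * (2 * (C * (\<Sum>k<m. d (k + J))))" for m
  proof (induction m)
    case 0 then show ?case by simp
  next
    case (Suc m)
    have "\<bar>S (m + J)\<bar> \<le> 2 * \<bar>S J\<bar>" using Suc close[of m] by simp
    then have "C * d (m + J) * \<bar>S (m + J)\<bar> \<le> C * d (m + J) * (2 * \<bar>S J\<bar>)"
      by (intro mult_left_mono mult_nonneg_nonneg C d0)
    with inc[of "m + J"] have "\<bar>S (Suc m + J) - S (m + J)\<bar> \<le> \<bar>S J\<bar> * (2 * (C * d (m + J)))"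
      by (simp add: algebra_simps)
    with Suc show ?case by (simp add: algebra_simps)
  qed
  have half: "\<bar>S j - S J\<bar> \<le> \<bar>S J\<bar> / 2" if "J \<le> j" for j
    using *[of "j - J"] close[of "j - J"] that by simp
  define e where "e j = 2 * C * \<bar>S J\<bar> * d j" for j
  have "norm (S (Suc j) - S j) \<le> e j" if "J \<le> j" for j
  proof -
    have "\<bar>S j\<bar> \<le> 2 * \<bar>S J\<bar>" using half[OF that] by linarith
    then have "C * d j * \<bar>S j\<bar> \<le> C * d j * (2 * \<bar>S J\<bar>)"
      by (intro mult_left_mono mult_nonneg_nonneg C d0)
    with inc[OF that] show ?thesis by (simp add: e_def algebra_simps)
  qed
  moreover have "summable e" unfolding e_def by (intro summable_mult d)
  ultimately obtain g where g: "S \<longlonglongrightarrow> g" "\<And>j. J \<le> j \<Longrightarrow> norm (S j - g) \<le> (\<Sum>k. e (k + j))"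
    by (rule summable_increments_limit) auto
  have "(\<lambda>j. \<bar>S j - S J\<bar>) \<longlonglongrightarrow> \<bar>g - S J\<bar>" by (intro tendsto_intros g)
  then have "\<bar>g - S J\<bar> \<le> \<bar>S J\<bar> / 2"
    by (rule LIMSEQ_le_const2) (use half in blast)
  then have "\<bar>S J\<bar> / 2 \<le> \<bar>g\<bar>" by linarith
  moreover have "\<bar>S j - g\<bar> \<le> 2 * C * \<bar>S J\<bar> * (\<Sum>k. d (k + j))" if "J \<le> j" for j
    using g(2)[OF that] suminf_mult[OF d', of "2 * C * \<bar>S J\<bar>" j] by (simp add: e_def)
  ultimately show ?thesis using g(1) that by blast
qed

lemma suminf_tail_tendsto_zero:
  fixes d :: "nat \<Rightarrow> real"
  assumes "summable d"
  shows "(\<lambda>j. \<Sum>k. d (k + j)) \<longlonglongrightarrow> 0"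
proof -
  have "(\<lambda>j. suminf d - (\<Sum>k<j. d k)) \<longlonglongrightarrow> suminf d - suminf d"
    by (intro tendsto_diff tendsto_const summable_LIMSEQ assms)
  then show ?thesis by (simp add: suminf_minus_initial_segment[OF assms])
qed

text \<open>Extends to all indices what is first known only from some index \<open>J\<close> on.
  With \<open>J = Suc 0\<close> and a constant family it bounds a single function.\<close>

lemma finite_family_bounded_on_compact:
  fixes f :: "nat \<Rightarrow> real \<Rightarrow> real"
  assumes "compact K" "\<And>j. continuous_on K (f j)"
  shows "\<exists>C\<ge>0. \<forall>j<J. \<forall>x\<in>K. \<bar>f j x\<bar> \<le> C"
proof (induction J)
  case 0 then show ?case by auto
next
  case (Suc J)
  then obtain C where C: "C \<ge> 0" "\<forall>j<J. \<forall>x\<in>K. \<bar>f j x\<bar> \<le> C" by blast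
  have "bounded (f J ` K)" using assms by (intro compact_imp_bounded compact_continuous_image)
  then obtain B where "\<forall>x\<in>K. \<bar>f J x\<bar> \<le> B" by (auto simp: bounded_iff)
  then have "\<forall>j<Suc J. \<forall>x\<in>K. \<bar>f j x\<bar> \<le> max C B"
    using C(2) by (auto simp: less_Suc_eq intro: order_trans[OF _ max.cobounded1] order_trans[OF _ max.cobounded2])
  with C(1) show ?case by (meson max.coboundedI1)
qed

lemma pos_ratio_bounded:
  fixes \<alpha> :: "nat \<Rightarrow> real"
  assumes pos: "\<And>j. 0 < \<alpha> j" and lim: "(\<lambda>j. \<alpha> j / \<alpha> (Suc j)) \<longlonglongrightarrow> 1"
  shows "\<exists>R\<ge>1. \<forall>j. \<alpha> j \<le> R * \<alpha> (Suc j) \<and> \<alpha> (Suc j) \<le> R * \<alpha> j"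
proof -
  have lim': "(\<lambda>j. \<alpha> (Suc j) / \<alpha> j) \<longlonglongrightarrow> 1"
    using tendsto_inverse[OF lim] by simp
  obtain R1 where R1: "\<And>j. norm (\<alpha> j / \<alpha> (Suc j)) \<le> R1"
    using convergent_imp_Bseq[OF convergentI[OF lim]] by (auto simp: Bseq_def)
  obtain R2 where R2: "\<And>j. norm (\<alpha> (Suc j) / \<alpha> j) \<le> R2"
    using convergent_imp_Bseq[OF convergentI[OF lim']] by (auto simp: Bseq_def)
  have 1: "\<alpha> j \<le> max 1 (max R1 R2) * \<alpha> (Suc j)" for j
  proof -
    have "\<alpha> j / \<alpha> (Suc j) \<le> max 1 (max R1 R2)"
      using R1[of j] unfolding real_norm_def by linarith
    then show ?thesis using pos[of "Suc j"] by (simp add: pos_divide_le_eq)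
  qed
  have 2: "\<alpha> (Suc j) \<le> max 1 (max R1 R2) * \<alpha> j" for j
  proof -
    have "\<alpha> (Suc j) / \<alpha> j \<le> max 1 (max R1 R2)"
      using R2[of j] unfolding real_norm_def by linarith
    then show ?thesis using pos[of j] by (simp add: pos_divide_le_eq)
  qed
  show ?thesis
    using 1 2 by (intro exI[of _ "max 1 (max R1 R2)"]) auto
qed

text \<open>An abstraction of the recurrence along one residue class modulo N. A summable majorant
  \<open>d\<close> keeps suprema out of the estimates, and \<open>det_Y\<close> ties the variation
  of \<alpha> to that of \<open>Y\<close>.\<close>

locale elliptic_products =
  fixes K :: "real set" and Y :: "nat \<Rightarrow> real \<Rightarrow> real^2^2" and v :: "nat \<Rightarrow> real \<Rightarrow> real^2"
    and \<alpha> d :: "nat \<Rightarrow> real" and Z :: "real \<Rightarrow> real^2^2" and M :: real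
  assumes compact_K: "compact K"
    and cont_Y: "\<And>j. continuous_on K (Y j)" and cont_v: "\<And>j. continuous_on K (v j)"
    and \<alpha>_pos: "\<And>j. 0 < \<alpha> j" and \<alpha>_ratio: "(\<lambda>j. \<alpha> j / \<alpha> (Suc j)) \<longlonglongrightarrow> 1"
    and det_Y: "\<And>j x. x \<in> K \<Longrightarrow> det (Y j x) = \<alpha> j / \<alpha> (Suc j)"
    and v_Suc: "\<And>j x. x \<in> K \<Longrightarrow> v (Suc j) x = Y j x *v v j x"
    and v_nonzero: "\<And>j x. x \<in> K \<Longrightarrow> v j x \<noteq> 0"
    and d_nonneg: "\<And>j. 0 \<le> d j" and d_summable: "summable d"
    and Y_diff: "\<And>j x. x \<in> K \<Longrightarrow> spec_norm (Y (Suc j) x - Y j x) \<le> d j"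
    and Y_bound: "\<And>j x. x \<in> K \<Longrightarrow> spec_norm (Y j x) \<le> M"
    and M_pos: "0 < M"
    and Y_lim: "\<And>x. x \<in> K \<Longrightarrow> (\<lambda>j. Y j x) \<longlonglongrightarrow> Z x"
    and Z_elliptic: "\<And>x. x \<in> K \<Longrightarrow> discr (Z x) < 0"
begin

text \<open>Bounds the distance from \<open>Y j\<close> to its limit uniformly on \<open>K\<close>.
  When \<open>d j\<close> is the supremum distance of consecutive matrices, this is the inner series
  of \<open>error_sum\<close>.\<close>

definition tail :: "nat \<Rightarrow> real" where "tail j = (\<Sum>k. d (k + j))"

text \<open>The shifted Turan determinants: with \<open>Y j\<close> replaced by its limit and \<open>\<alpha>\<close> constant they would not depend on \<open>j\<close>.\<close>

definition turan :: "nat \<Rightarrow> real \<Rightarrow> real" where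
  "turan j x = \<alpha> (Suc j) * wedge (v j x) (v (Suc j) x)"

text \<open>The function g of the overview; \<open>turan_limit\<close> shows that the limit exists
  on \<open>K\<close>.\<close>

definition amp :: "real \<Rightarrow> real" where "amp x = lim (\<lambda>j. turan j x)"

lemma tail_nonneg: "0 \<le> tail j"
  unfolding tail_def by (rule suminf_nonneg) (use d_summable d_nonneg in \<open>auto simp: summable_iff_shift\<close>)

lemma tail_tendsto: "tail \<longlonglongrightarrow> 0"
  using suminf_tail_tendsto_zero[OF d_summable] by (simp add: tail_def[abs_def])

section \<open>Uniform convergence to the limit matrix\<close>

lemma Y_lim_vec: "x \<in> K \<Longrightarrow> (\<lambda>j. Y j x *v u) \<longlonglongrightarrow> Z x *v u"
  using Y_lim[of x] by (intro vec_tendstoI) (auto simp: matrix_vector_mult_def sum_2 intro!: tendsto_intros)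

text \<open>The increments are summed for the vectors \<open>Y j x *v u\<close> with
  \<open>u\<close> fixed, because \<open>spec_norm\<close> is not the norm of the matrix type. In
  this way no equivalence constant enters.\<close>

lemma Y_Z_dist:
  assumes x: "x \<in> K"
  shows "spec_norm (Y j x - Z x) \<le> tail j"
proof (rule spec_norm_bound)
  fix u :: "real^2"
  have "norm (Y (Suc k) x *v u - Y k x *v u) \<le> norm u * d k" for k
  proof -
    have "norm (Y (Suc k) x *v u - Y k x *v u) \<le> spec_norm (Y (Suc k) x - Y k x) * norm u"
      unfolding matrix_vector_mult_diff_rdistrib[symmetric] by (rule spec_norm_mult_vec_le)
    also have "\<dots> \<le> d k * norm u" by (intro mult_right_mono Y_diff x) simp
    finally show ?thesis by (simp add: mult.commute)
  qed
  moreover have "summable (\<lambda>k. norm u * d k)" by (intro summable_mult d_summable)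
  ultimately obtain g where g: "(\<lambda>j. Y j x *v u) \<longlonglongrightarrow> g"
    "\<And>j. 0 \<le> j \<Longrightarrow> norm (Y j x *v u - g) \<le> (\<Sum>k. norm u * d (k + j))"
    using summable_increments_limit[of 0 "\<lambda>j. Y j x *v u" "\<lambda>k. norm u * d k"] by blast
  have "g = Z x *v u" using LIMSEQ_unique[OF g(1) Y_lim_vec[OF x]] .
  then show "norm ((Y j x - Z x) *v u) \<le> tail j * norm u"
    using g(2)[of j] suminf_mult[of "\<lambda>k. d (k + j)" "norm u"] d_summable
    by (simp add: matrix_vector_mult_diff_rdistrib tail_def mult.commute summable_iff_shift)
qed

lemma Z_bound:
  assumes x: "x \<in> K"
  shows "spec_norm (Z x) \<le> M"
proof (rule spec_norm_bound)
  fix u :: "real^2"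
  have "(\<lambda>j. norm (Y j x *v u)) \<longlonglongrightarrow> norm (Z x *v u)"
    by (intro tendsto_norm Y_lim_vec x)
  moreover have "norm (Y j x *v u) \<le> M * norm u" for j
    using spec_norm_mult_vec_le[of "Y j x" u] mult_right_mono[OF Y_bound[OF x], of "norm u" j]
    by (meson norm_ge_zero order_trans)
  ultimately show "norm (Z x *v u) \<le> M * norm u"
    by (intro LIMSEQ_le_const2) auto
qed

lemma cont_Z: "continuous_on K Z"
proof -
  have "uniform_limit K Y Z sequentially"
  proof (rule uniform_limitI)
    fix e :: real assume "0 < e"
    then have "eventually (\<lambda>j. tail j < e / 4) sequentially"
      by (intro order_tendstoD(2)[OF tail_tendsto]) simp
    then show "eventually (\<lambda>j. \<forall>x\<in>K. dist (Y j x) (Z x) < e) sequentially"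
    proof eventually_elim
      case (elim j)
      have "dist (Y j x) (Z x) < e" if "x \<in> K" for x
        using norm_le_spec_norm_mult[of "Y j x - Z x"] Y_Z_dist[OF that, of j] elim
        unfolding dist_norm by linarith
      then show ?case by blast
    qed
  qed
  then show ?thesis
    by (rule uniform_limit_theorem[rotated]) (auto simp: cont_Y)
qed

lemma Z_gap: "\<exists>\<delta>>0. \<forall>x\<in>K. discr (Z x) \<le> - \<delta>"
proof (cases "K = {}")
  case False
  then obtain x0 where "x0 \<in> K" "\<forall>x\<in>K. discr (Z x) \<le> discr (Z x0)"
    using continuous_attains_sup[OF compact_K _ continuous_on_discr[OF cont_Z]] by blast
  then show ?thesis using Z_elliptic by (intro exI[of _ "- discr (Z x0)"]) auto
qed (auto intro: exI[of _ 1])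

lemma det_Z:
  assumes x: "x \<in> K"
  shows "det (Z x) = 1"
proof -
  have "(\<lambda>j. det (Y j x)) \<longlonglongrightarrow> det (Z x)"
    using Y_lim[OF x] unfolding det_2 by (intro tendsto_intros)
  moreover have "(\<lambda>j. det (Y j x)) \<longlonglongrightarrow> 1"
    using \<alpha>_ratio det_Y[OF x] by simp
  ultimately show ?thesis by (rule LIMSEQ_unique)
qed

lemma Y_gap: "\<exists>\<delta>>0. \<exists>J. \<forall>j\<ge>J. \<forall>x\<in>K. discr (Y j x) \<le> - \<delta>"
proof -
  obtain \<delta> where \<delta>: "\<delta> > 0" "\<forall>x\<in>K. discr (Z x) \<le> - \<delta>" using Z_gap by blast
  have "(\<lambda>j. 24 * M * tail j) \<longlonglongrightarrow> 24 * M * 0" by (intro tendsto_intros tail_tendsto)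
  then have "eventually (\<lambda>j. 24 * M * tail j < \<delta> / 2) sequentially"
    using \<delta>(1) by (intro order_tendstoD(2)[of _ 0]) auto
  then obtain J where J: "\<forall>j\<ge>J. 24 * M * tail j < \<delta> / 2" by (auto simp: eventually_sequentially)
  have "discr (Y j x) \<le> - (\<delta> / 2)" if "J \<le> j" "x \<in> K" for j x
  proof -
    have "\<bar>discr (Y j x) - discr (Z x)\<bar> \<le> 24 * M * spec_norm (Y j x - Z x)"
      by (intro discr_diff_le Y_bound Z_bound that)
    also have "\<dots> \<le> 24 * M * tail j"
      using M_pos by (intro mult_left_mono Y_Z_dist that) auto
    also have "\<dots> < \<delta> / 2" using J that by simp
    finally have "discr (Y j x) < discr (Z x) + \<delta> / 2" by linarith
    moreover have "discr (Z x) \<le> - \<delta>" using \<delta>(2) that by simp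
    ultimately show ?thesis by linarith
  qed
  then show ?thesis using \<delta>(1) by (intro exI[of _ "\<delta>/2"]) auto
qed

section \<open>Convergence of the Turan determinants\<close>

lemma turan_form: "x \<in> K \<Longrightarrow> turan j x = \<alpha> (Suc j) * wedge (v j x) (Y j x *v v j x)"
  by (simp add: turan_def v_Suc)

lemma v_le_turan:
  "\<exists>c>0. \<exists>J. \<forall>j\<ge>J. \<forall>x\<in>K. \<alpha> (Suc j) * (norm (v j x))\<^sup>2 \<le> c * \<bar>turan j x\<bar>"
proof -
  obtain \<delta> J where \<delta>: "\<delta> > 0" and J: "\<forall>j\<ge>J. \<forall>x\<in>K. discr (Y j x) \<le> - \<delta>" using Y_gap by blast
  have "\<alpha> (Suc j) * (norm (v j x))\<^sup>2 \<le> (8 * M / \<delta>) * \<bar>turan j x\<bar>" if "J \<le> j" "x \<in> K" for j x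
  proof -
    have "\<delta> * (norm (v j x))\<^sup>2 \<le> 8 * M * \<bar>wedge (v j x) (Y j x *v v j x)\<bar>"
      using J that \<delta> by (intro wedge_form_lower Y_bound) auto
    then have "(norm (v j x))\<^sup>2 \<le> (8 * M / \<delta>) * \<bar>wedge (v j x) (Y j x *v v j x)\<bar>"
      using \<delta> by (simp add: field_simps)
    then have "\<alpha> (Suc j) * (norm (v j x))\<^sup>2 \<le> \<alpha> (Suc j) * ((8 * M / \<delta>) * \<bar>wedge (v j x) (Y j x *v v j x)\<bar>)"
      using \<alpha>_pos[of "Suc j"] by (intro mult_left_mono) auto
    then show ?thesis
      using \<alpha>_pos[of "Suc j"] by (simp add: turan_form[OF that(2)] abs_mult algebra_simps)
  qed
  moreover have "8 * M / \<delta> > 0" using M_pos \<delta> by simp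
  ultimately show ?thesis by blast
qed

text \<open>If \<open>Y (Suc j)\<close> were \<open>Y j\<close>, passing to the next vector would
  multiply the wedge exactly by \<open>det (Y j x)\<close>, by \<open>wedge_matrix\<close>. Two
  errors remain: the change of the form, and the factor \<open>\<alpha> j * \<alpha> (Suc (Suc j)) /
  (\<alpha> (Suc j))\<^sup>2 - 1\<close>. The latter is a ratio of \<alpha> times a difference of
  consecutive determinants, hence also of order \<open>d j\<close>.\<close>

lemma turan_increment:
  "\<exists>C\<ge>0. \<exists>J. \<forall>j\<ge>J. \<forall>x\<in>K. \<bar>turan (Suc j) x - turan j x\<bar> \<le> C * d j * \<bar>turan j x\<bar>"
proof -
  obtain c J where c: "c > 0"
    and J: "\<forall>j\<ge>J. \<forall>x\<in>K. \<alpha> (Suc j) * (norm (v j x))\<^sup>2 \<le> c * \<bar>turan j x\<bar>"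
    using v_le_turan by blast
  obtain R where R: "R \<ge> 1" "\<And>j. \<alpha> (Suc j) \<le> R * \<alpha> j"
    using pos_ratio_bounded[of \<alpha>] \<alpha>_pos \<alpha>_ratio by blast
  define C where "C = R * M\<^sup>2 * c + 4 * R * M"
  have "\<bar>turan (Suc j) x - turan j x\<bar> \<le> C * d j * \<bar>turan j x\<bar>" if j: "J \<le> j" and x: "x \<in> K" for j x
  proof -
    let ?u = "v j x" and ?w = "v (Suc j) x"
    have pos: "\<alpha> j > 0" "\<alpha> (Suc j) > 0" "\<alpha> (Suc (Suc j)) > 0" by (rule \<alpha>_pos)+
    have w: "?w = Y j x *v ?u" by (rule v_Suc[OF x])
    have Yw: "wedge ?w (Y j x *v ?w) = \<alpha> j / \<alpha> (Suc j) * wedge ?u ?w"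
      using wedge_matrix[of "Y j x" ?u ?w] by (simp add: det_Y[OF x] w[symmetric])
    have split: "turan (Suc j) x - turan j x =
        \<alpha> (Suc (Suc j)) * (wedge ?w (Y (Suc j) x *v ?w) - wedge ?w (Y j x *v ?w))
        + (\<alpha> (Suc (Suc j)) / \<alpha> (Suc j)) * (det (Y j x) - det (Y (Suc j) x)) * turan j x"
      using pos unfolding turan_form[OF x, of "Suc j"] Yw det_Y[OF x] turan_def[of j]
      by (simp add: field_simps)
    have "\<bar>\<alpha> (Suc (Suc j)) * (wedge ?w (Y (Suc j) x *v ?w) - wedge ?w (Y j x *v ?w))\<bar>
        \<le> (R * \<alpha> (Suc j)) * (d j * (M * norm ?u)\<^sup>2)"
    proof -
      have "\<bar>wedge ?w (Y (Suc j) x *v ?w) - wedge ?w (Y j x *v ?w)\<bar>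
          \<le> spec_norm (Y (Suc j) x - Y j x) * (norm ?w)\<^sup>2" by (rule wedge_form_diff_le)
      also have "\<dots> \<le> d j * (M * norm ?u)\<^sup>2"
      proof (intro mult_mono Y_diff x power_mono d_nonneg)
        show "norm ?w \<le> M * norm ?u"
          unfolding w using spec_norm_mult_vec_le[of "Y j x" ?u] mult_right_mono[OF Y_bound[OF x], of "norm ?u" j]
          by (meson norm_ge_zero order_trans)
      qed auto
      finally show ?thesis
        unfolding abs_mult using R pos by (intro mult_mono) auto
    qed
    also have "\<dots> = R * M\<^sup>2 * d j * (\<alpha> (Suc j) * (norm ?u)\<^sup>2)"
      by (simp add: power2_eq_square algebra_simps)
    also have "\<dots> \<le> R * M\<^sup>2 * d j * (c * \<bar>turan j x\<bar>)"
      using J j x R d_nonneg by (intro mult_left_mono) auto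
    finally have 1: "\<bar>\<alpha> (Suc (Suc j)) * (wedge ?w (Y (Suc j) x *v ?w) - wedge ?w (Y j x *v ?w))\<bar>
      \<le> R * M\<^sup>2 * d j * (c * \<bar>turan j x\<bar>)" .
    have "\<bar>det (Y j x) - det (Y (Suc j) x)\<bar> \<le> 4 * M * spec_norm (Y j x - Y (Suc j) x)"
      by (intro det_diff_le Y_bound x)
    also have "\<dots> \<le> 4 * M * d j"
      using M_pos Y_diff[OF x, of j] by (simp add: spec_norm_commute)
    finally have "\<bar>\<alpha> (Suc (Suc j)) / \<alpha> (Suc j) * (det (Y j x) - det (Y (Suc j) x))\<bar> \<le> R * (4 * M * d j)"
      unfolding abs_mult using R(1) R(2)[of "Suc j"] pos by (intro mult_mono) (auto simp: pos_divide_le_eq)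
    then have 2: "\<bar>\<alpha> (Suc (Suc j)) / \<alpha> (Suc j) * (det (Y j x) - det (Y (Suc j) x)) * turan j x\<bar>
        \<le> R * (4 * M * d j) * \<bar>turan j x\<bar>"
      unfolding abs_mult by (rule mult_right_mono) simp
    show ?thesis
      unfolding split C_def
      using abs_triangle_ineq[of "\<alpha> (Suc (Suc j)) * (wedge ?w (Y (Suc j) x *v ?w) - wedge ?w (Y j x *v ?w))"
         "\<alpha> (Suc (Suc j)) / \<alpha> (Suc j) * (det (Y j x) - det (Y (Suc j) x)) * turan j x"] 1 2
      by (simp add: algebra_simps)
  qed
  moreover have "C \<ge> 0" using R c M_pos by (auto simp: C_def)
  ultimately show ?thesis by blast
qed

lemma cont_turan: "continuous_on K (turan j)"
  unfolding turan_def[abs_def] wedge_def by (intro continuous_intros cont_v)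

lemma turan_limit:
  "\<exists>C\<ge>0. \<exists>J. \<forall>x\<in>K. (\<lambda>j. turan j x) \<longlonglongrightarrow> amp x \<and> amp x \<noteq> 0 \<and> (\<forall>j\<ge>J. \<bar>turan j x - amp x\<bar> \<le> C * tail j)"
proof -
  obtain C J1 where C: "C \<ge> 0"
    and J1: "\<forall>j\<ge>J1. \<forall>x\<in>K. \<bar>turan (Suc j) x - turan j x\<bar> \<le> C * d j * \<bar>turan j x\<bar>"
    using turan_increment by blast
  obtain c J2 where J2: "c > 0" "\<forall>j\<ge>J2. \<forall>x\<in>K. \<alpha> (Suc j) * (norm (v j x))\<^sup>2 \<le> c * \<bar>turan j x\<bar>"
    using v_le_turan by blast
  have "(\<lambda>j. C * tail j) \<longlonglongrightarrow> C * 0" by (intro tendsto_intros tail_tendsto)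
  then have "eventually (\<lambda>j. C * tail j < 1/4) sequentially"
    by (intro order_tendstoD(2)[of _ 0]) auto
  then obtain J3 where J3: "\<forall>j\<ge>J3. C * tail j < 1/4" unfolding eventually_sequentially by blast
  define J where "J = max J1 (max J2 J3)"
  \<comment> \<open>Only the index \<open>J\<close> matters: \<open>\<bar>turan J x\<bar>\<close> is
    the scale in \<open>relative_increments_limit\<close>, and \<open>B\<close> makes the resulting
    rate uniform in x.\<close>
  obtain B where B: "B \<ge> 0" "\<forall>j<Suc J. \<forall>x\<in>K. \<bar>turan j x\<bar> \<le> B"
    using finite_family_bounded_on_compact[of K turan "Suc J"] compact_K cont_turan by auto
  have "(\<lambda>j. turan j x) \<longlonglongrightarrow> amp x \<and> amp x \<noteq> 0 \<and> (\<forall>j\<ge>J. \<bar>turan j x - amp x\<bar> \<le> 2 * C * B * tail j)"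
    if x: "x \<in> K" for x
  proof -
    have "\<bar>turan (Suc j) x - turan j x\<bar> \<le> C * d j * \<bar>turan j x\<bar>" if "J \<le> j" for j
      using J1 that x by (auto simp: J_def)
    moreover have "C * (\<Sum>k. d (k + J)) \<le> 1/4"
      using J3 by (auto simp: J_def tail_def intro: less_imp_le)
    ultimately obtain g where g: "(\<lambda>j. turan j x) \<longlonglongrightarrow> g"
      "\<And>j. J \<le> j \<Longrightarrow> \<bar>turan j x - g\<bar> \<le> 2 * C * \<bar>turan J x\<bar> * (\<Sum>k. d (k + j))" "\<bar>turan J x\<bar> / 2 \<le> \<bar>g\<bar>"
      using relative_increments_limit[of J "\<lambda>j. turan j x" C d] C d_nonneg d_summable by metis
    have g_eq: "amp x = g" unfolding amp_def by (rule limI[OF g(1)])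
    have "0 < \<alpha> (Suc J) * (norm (v J x))\<^sup>2" using \<alpha>_pos v_nonzero[OF x] by simp
    also have "\<dots> \<le> c * \<bar>turan J x\<bar>" using J2(2) x by (auto simp: J_def)
    finally have "turan J x \<noteq> 0" by auto
    with g(3) have "g \<noteq> 0" by auto
    moreover have "\<bar>turan j x - g\<bar> \<le> 2 * C * B * tail j" if "J \<le> j" for j
    proof -
      have "2 * C * \<bar>turan J x\<bar> * tail j \<le> 2 * C * B * tail j"
        using B(2) C x tail_nonneg by (intro mult_right_mono mult_left_mono) auto
      with g(2)[OF that] show ?thesis by (simp add: tail_def)
    qed
    ultimately show ?thesis using g(1) g_eq by simp
  qed
  moreover have "2 * C * B \<ge> 0" using C B by simp
  ultimately show ?thesis by blast
qed

lemma amp_nonzero: "x \<in> K \<Longrightarrow> amp x \<noteq> 0"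
  using turan_limit by blast

lemma turan_tendsto: "x \<in> K \<Longrightarrow> (\<lambda>j. turan j x) \<longlonglongrightarrow> amp x"
  using turan_limit by blast

lemma cont_amp: "continuous_on K amp"
proof -
  obtain C J where C: "C \<ge> 0" and J: "\<forall>x\<in>K. \<forall>j\<ge>J. \<bar>turan j x - amp x\<bar> \<le> C * tail j"
    using turan_limit by blast
  have lim: "(\<lambda>j. C * tail j) \<longlonglongrightarrow> 0" using tendsto_mult_left[OF tail_tendsto, of C] by simp
  have "uniform_limit K turan amp sequentially"
  proof (rule uniform_limitI)
    fix e :: real assume "0 < e"
    then have "eventually (\<lambda>j. C * tail j < e) sequentially"
      using order_tendstoD(2)[OF lim] by simp
    then show "eventually (\<lambda>j. \<forall>x\<in>K. dist (turan j x) (amp x) < e) sequentially"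
      using eventually_ge_at_top[of J]
    proof eventually_elim
      case (elim j)
      have "dist (turan j x) (amp x) < e" if "x \<in> K" for x
        using J elim that unfolding dist_real_def by (meson le_less_trans)
      then show ?case by blast
    qed
  qed
  then show ?thesis
    by (rule uniform_limit_theorem[rotated]) (auto simp: cont_turan)
qed

text \<open>By \<open>wedge_form_sign\<close> a definite form has the sign of its leading
  coefficient, and this survives the limit. It is the source of the absolute value of
  \<open>[X]_21\<close> in the kernel asymptotics.\<close>

lemma amp_sign:
  assumes x: "x \<in> K"
  shows "0 \<le> Z x $ 2 $ 1 * amp x"
proof -
  obtain \<delta> J where \<delta>: "\<delta> > 0" and J: "\<forall>j\<ge>J. \<forall>x\<in>K. discr (Y j x) \<le> - \<delta>" using Y_gap by blast
  have "(\<lambda>j. Y j x $ 2 $ 1 * turan j x) \<longlonglongrightarrow> Z x $ 2 $ 1 * amp x"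
    by (intro tendsto_intros Y_lim x turan_tendsto)
  moreover have "0 \<le> Y j x $ 2 $ 1 * turan j x" if "J \<le> j" for j
  proof -
    have "discr (Y j x) \<le> 0" using J that x \<delta> by (meson less_imp_le neg_le_0_iff_le order_trans)
    then have "0 \<le> \<alpha> (Suc j) * (Y j x $ 2 $ 1 * wedge (v j x) (Y j x *v v j x))"
      using \<alpha>_pos[of "Suc j"] by (intro mult_nonneg_nonneg wedge_form_sign) auto
    then show ?thesis by (simp add: turan_form[OF x] algebra_simps)
  qed
  ultimately show ?thesis by (intro LIMSEQ_le_const) auto
qed

lemma v_bound: "\<exists>C\<ge>0. \<forall>j. \<forall>x\<in>K. \<alpha> j * (norm (v j x))\<^sup>2 \<le> C"
proof -
  obtain c J1 where c: "c > 0"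
    and J1: "\<forall>j\<ge>J1. \<forall>x\<in>K. \<alpha> (Suc j) * (norm (v j x))\<^sup>2 \<le> c * \<bar>turan j x\<bar>"
    using v_le_turan by blast
  obtain C J2 where C: "C \<ge> 0" and J2: "\<forall>x\<in>K. \<forall>j\<ge>J2. \<bar>turan j x - amp x\<bar> \<le> C * tail j"
    using turan_limit by blast
  obtain R where R: "R \<ge> 1" "\<And>j. \<alpha> j \<le> R * \<alpha> (Suc j)"
    using pos_ratio_bounded[of \<alpha>] \<alpha>_pos \<alpha>_ratio by blast
  obtain G where G: "G \<ge> 0" "\<forall>j<Suc 0. \<forall>x\<in>K. \<bar>amp x\<bar> \<le> G"
    using finite_family_bounded_on_compact[OF compact_K cont_amp] by blast
  obtain T where T: "\<And>j. norm (tail j) \<le> T"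
    using convergent_imp_Bseq[OF convergentI[OF tail_tendsto]] by (auto simp: Bseq_def)
  have cont_\<alpha>_v: "continuous_on K (\<lambda>x. \<alpha> j * (norm (v j x))\<^sup>2)" for j
    by (intro continuous_intros cont_v)
  obtain B where B: "B \<ge> 0" "\<forall>j<max J1 J2. \<forall>x\<in>K. \<bar>\<alpha> j * (norm (v j x))\<^sup>2\<bar> \<le> B"
    using finite_family_bounded_on_compact[OF compact_K, of "\<lambda>j x. \<alpha> j * (norm (v j x))\<^sup>2"]
    using cont_\<alpha>_v by blast
  have "\<alpha> j * (norm (v j x))\<^sup>2 \<le> B + R * (c * (G + C * T))" if x: "x \<in> K" for j x
  proof (cases "j < max J1 J2")
    case True
    have "0 \<le> R * (c * (G + C * T))"
      using R c G C T[of 0] order_trans[OF norm_ge_zero T[of 0]] by simp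
    moreover have "\<bar>\<alpha> j * (norm (v j x))\<^sup>2\<bar> \<le> B" using B True x by blast
    ultimately show ?thesis by linarith
  next
    case False
    have j: "J1 \<le> j" "J2 \<le> j" using False by auto
    have "\<bar>turan j x - amp x\<bar> \<le> C * tail j" using J2 x j by blast
    then have "\<bar>turan j x\<bar> \<le> \<bar>amp x\<bar> + C * tail j" by linarith
    also have "\<dots> \<le> G + C * T"
      using G(2) x C T[of j] by (intro add_mono mult_left_mono) auto
    finally have "c * \<bar>turan j x\<bar> \<le> c * (G + C * T)" using c by simp
    then have *: "\<alpha> (Suc j) * (norm (v j x))\<^sup>2 \<le> c * (G + C * T)" using J1 x j by (meson order_trans)
    have "\<alpha> j * (norm (v j x))\<^sup>2 \<le> (R * \<alpha> (Suc j)) * (norm (v j x))\<^sup>2"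
      by (intro mult_right_mono R) simp
    also have "\<dots> \<le> R * (c * (G + C * T))"
      using mult_left_mono[OF *, of R] R by (simp add: algebra_simps)
    finally show ?thesis using B by simp
  qed
  moreover have "0 \<le> B + R * (c * (G + C * T))"
      using R c G C B order_trans[OF norm_ge_zero T[of 0]] by simp
  ultimately show ?thesis by blast
qed

text \<open>The matrix is frozen at x0 while the vector is taken at nearby t, as a constant \<zeta>
  requires. The weight is \<open>\<alpha> j\<close>, not \<open>\<alpha> (Suc j)\<close> as in
  \<open>turan\<close>: it is the a_n that accompanies the pair p_n, p_(n+1) in the approximating
  density, and the ratio tending to 1 pays for the change.\<close>

lemma frozen_form_limit:
  assumes x0: "x0 \<in> K" and \<eta>: "0 < \<eta>"
  shows "\<exists>\<delta>>0. \<exists>J. \<forall>j\<ge>J. \<forall>t\<in>K. \<bar>t - x0\<bar> < \<delta> \<longrightarrow>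
    \<bar>\<alpha> j * wedge (v j t) (Z x0 *v v j t) - amp x0\<bar> \<le> \<eta>"
proof -
  obtain V where V: "V \<ge> 0" "\<And>j x. x \<in> K \<Longrightarrow> \<alpha> j * (norm (v j x))\<^sup>2 \<le> V"
    using v_bound by blast
  obtain C J1 where C: "C \<ge> 0" and J1: "\<forall>x\<in>K. \<forall>j\<ge>J1. \<bar>turan j x - amp x\<bar> \<le> C * tail j"
    using turan_limit by blast
  obtain R where R: "R \<ge> 1" "\<And>j. \<alpha> (Suc j) \<le> R * \<alpha> j"
    using pos_ratio_bounded[of \<alpha>] \<alpha>_pos \<alpha>_ratio by blast
  have turan_le: "\<bar>turan j t\<bar> \<le> R * M * V" if t: "t \<in> K" for j t
  proof -
    have "\<bar>turan j t\<bar> \<le> \<alpha> (Suc j) * (spec_norm (Y j t) * (norm (v j t))\<^sup>2)"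
      unfolding turan_form[OF t] abs_mult using \<alpha>_pos[of "Suc j"] abs_wedge_form_le by simp
    also have "\<dots> \<le> (R * \<alpha> j) * (M * (norm (v j t))\<^sup>2)"
      using R \<alpha>_pos[of j] M_pos by (intro mult_mono Y_bound t mult_nonneg_nonneg spec_norm_nonneg) auto
    also have "\<dots> = R * M * (\<alpha> j * (norm (v j t))\<^sup>2)" by simp
    also have "\<dots> \<le> R * M * V" using R M_pos V(2)[OF t] by (intro mult_left_mono) auto
    finally show ?thesis .
  qed
  \<comment> \<open>\<open>q\<close> collects the errors that vanish as j grows, \<open>h\<close>
    those that vanish as t tends to x0.\<close>
  define q where "q j = V * tail j + \<bar>\<alpha> j / \<alpha> (Suc j) - 1\<bar> * (R * M * V) + C * tail j" for j
  have "q \<longlonglongrightarrow> V * 0 + \<bar>1 - 1\<bar> * (R * M * V) + C * 0"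
    unfolding q_def by (intro tendsto_intros tail_tendsto \<alpha>_ratio)
  then have "eventually (\<lambda>j. q j < \<eta> / 2) sequentially"
    using order_tendstoD(2)[of q 0 sequentially "\<eta>/2"] \<eta> by simp
  then obtain J2 where J2: "\<forall>j\<ge>J2. q j < \<eta> / 2" by (auto simp: eventually_sequentially)
  define h where "h t = 4 * V * norm (Z t - Z x0) + \<bar>amp t - amp x0\<bar>" for t
  have "continuous_on K h"
    unfolding h_def by (intro continuous_intros cont_Z cont_amp)
  moreover have "h x0 = 0" by (simp add: h_def)
  ultimately obtain \<delta> where \<delta>: "\<delta> > 0" "\<forall>t\<in>K. \<bar>t - x0\<bar> < \<delta> \<longrightarrow> \<bar>h t\<bar> < \<eta> / 2"
    using x0 half_gt_zero[OF \<eta>] unfolding continuous_on_iff dist_real_def by (metis diff_zero)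
  have "\<bar>\<alpha> j * wedge (v j t) (Z x0 *v v j t) - amp x0\<bar> \<le> \<eta>"
    if j: "max J1 J2 \<le> j" and t: "t \<in> K" "\<bar>t - x0\<bar> < \<delta>" for j t
  proof -
    let ?u = "v j t"
    have pos: "\<alpha> j > 0" "\<alpha> (Suc j) > 0" by (rule \<alpha>_pos)+
    have "\<alpha> j * wedge ?u (Z x0 *v ?u) - amp x0 =
       \<alpha> j * (wedge ?u (Z x0 *v ?u) - wedge ?u (Y j t *v ?u))
       + (\<alpha> j / \<alpha> (Suc j) - 1) * turan j t + (turan j t - amp t) + (amp t - amp x0)"
      unfolding turan_form[OF t(1)] using pos by (simp add: field_simps)
    also have "\<bar>\<dots>\<bar> \<le> (V * tail j + 4 * V * norm (Z t - Z x0))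
        + \<bar>\<alpha> j / \<alpha> (Suc j) - 1\<bar> * (R * M * V) + C * tail j + \<bar>amp t - amp x0\<bar>"
    proof (intro order_trans[OF abs_triangle_ineq] add_mono)
      have "\<bar>\<alpha> j * (wedge ?u (Z x0 *v ?u) - wedge ?u (Y j t *v ?u))\<bar>
          \<le> \<alpha> j * (spec_norm (Z x0 - Y j t) * (norm ?u)\<^sup>2)"
        unfolding abs_mult using pos wedge_form_diff_le by simp
      also have "\<dots> = spec_norm (Z x0 - Y j t) * (\<alpha> j * (norm ?u)\<^sup>2)" by simp
      also have "\<dots> \<le> (tail j + 4 * norm (Z t - Z x0)) * V"
      proof (intro mult_mono V t)
        have "spec_norm (Z x0 - Y j t) \<le> spec_norm (Z x0 - Z t) + spec_norm (Z t - Y j t)"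
          using spec_norm_triangle[of "Z x0 - Z t" "Z t - Y j t"] by simp
        then show "spec_norm (Z x0 - Y j t) \<le> tail j + 4 * norm (Z t - Z x0)"
          using spec_norm_le_norm_mult[of "Z x0 - Z t"] Y_Z_dist[OF t(1), of j]
          by (simp add: spec_norm_commute norm_minus_commute)
      qed (use tail_nonneg pos in auto)
      finally show "\<bar>\<alpha> j * (wedge ?u (Z x0 *v ?u) - wedge ?u (Y j t *v ?u))\<bar>
        \<le> V * tail j + 4 * V * norm (Z t - Z x0)" by (simp add: algebra_simps)
      show "\<bar>(\<alpha> j / \<alpha> (Suc j) - 1) * turan j t\<bar> \<le> \<bar>\<alpha> j / \<alpha> (Suc j) - 1\<bar> * (R * M * V)"
        unfolding abs_mult using turan_le[OF t(1)] by (intro mult_left_mono) auto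
      show "\<bar>turan j t - amp t\<bar> \<le> C * tail j" using J1 t j by auto
    qed simp
    also have "\<dots> = q j + h t" by (simp add: q_def h_def)
    also have "\<dots> \<le> \<eta>"
    proof -
      have "q j < \<eta> / 2" using J2 j by simp
      moreover have "\<bar>h t\<bar> < \<eta> / 2" using \<delta>(2) t by blast
      ultimately show ?thesis by linarith
    qed
    finally show ?thesis .
  qed
  then show ?thesis using \<delta>(1) by blast
qed

end

section \<open>Asymptotics of the kernel\<close>

text \<open>The coefficients of the corrector solve the cohomological equation of \<open>corrector_identity\<close>:
  the quadratic form \<open>(u$2)\<^sup>2\<close> is a multiple of the \<open>Z\<close>-invariant form \<open>wedge u (Z *v u)\<close> plus a
  coboundary, which telescopes along orbits.\<close>

definition corrector :: "real^2^2 \<Rightarrow> real^2 \<Rightarrow> real" where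
  "corrector Z u = (((trace Z)\<^sup>2 - 2) * (u$2)\<^sup>2 - trace Z * (u$2 * (Z *v u)$2)) / (- discr Z)"

text \<open>By Cayley-Hamilton with determinant 1 the second coordinates y, y', y'' of
  \<open>u\<close>, \<open>Z *v u\<close> and its image satisfy y'' = T y' - y with T the trace.
  Also \<open>Z$2$1 * wedge u (Z *v u)\<close> is y^2 - T y y' + y'^2. Everything becomes a
  polynomial identity in y and y'.\<close>

lemma corrector_identity:
  assumes det: "det Z = 1" and neg: "discr Z < 0"
  shows "(u$2)\<^sup>2 = 2 * Z$2$1 / (- discr Z) * wedge u (Z *v u) + (corrector Z (Z *v u) - corrector Z u)"
proof -
  define T y y' where "T = trace Z" and "y = u$2" and "y' = (Z *v u)$2"
  have d: "Z$1$1 * Z$2$2 = 1 + Z$1$2 * Z$2$1" using det by (simp add: det_2)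
  have y'': "(Z *v (Z *v u))$2 = T * y' - y"
    using d unfolding T_def y_def y'_def trace2 mat2_vec_nth by algebra
  have Q: "Z$2$1 * wedge u (Z *v u) = y\<^sup>2 - T * (y * y') + y'\<^sup>2"
    using d unfolding T_def y_def y'_def trace2 mat2_vec_nth wedge_def by algebra
  have dis: "discr Z = T\<^sup>2 - 4" by (simp add: discr_def det T_def)
  have "(4 - T\<^sup>2) * y\<^sup>2 = 2 * (y\<^sup>2 - T * (y * y') + y'\<^sup>2)
      + (((T\<^sup>2 - 2) * y'\<^sup>2 - T * (y' * (T * y' - y))) - ((T\<^sup>2 - 2) * y\<^sup>2 - T * (y * y')))"
    by (simp add: power2_eq_square algebra_simps)
  moreover have "4 - T\<^sup>2 \<noteq> 0" using neg dis by simp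
  ultimately have "y\<^sup>2 = (2 * (y\<^sup>2 - T * (y * y') + y'\<^sup>2)
      + (((T\<^sup>2 - 2) * y'\<^sup>2 - T * (y' * (T * y' - y))) - ((T\<^sup>2 - 2) * y\<^sup>2 - T * (y * y')))) / (4 - T\<^sup>2)"
    by (simp add: nonzero_eq_divide_eq mult.commute)
  also have "\<dots> = 2 * Z$2$1 / (- discr Z) * wedge u (Z *v u) + (corrector Z (Z *v u) - corrector Z u)"
    unfolding corrector_def y'' y_def[symmetric] y'_def[symmetric] T_def[symmetric] dis Q[symmetric]
    by (simp add: add_divide_distrib diff_divide_distrib)
  finally show ?thesis by (simp add: y_def)
qed

lemma corrector_coeffs:
  assumes "spec_norm Z \<le> M" "discr Z \<le> - \<delta>" "0 < \<delta>" "1 \<le> M"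
  obtains p q where "\<And>u. corrector Z u = p * (u$2)\<^sup>2 + q * (u$1 * u$2)"
    "\<bar>p\<bar> \<le> 8 * M\<^sup>2 / \<delta>" "\<bar>q\<bar> \<le> 8 * M\<^sup>2 / \<delta>"
proof -
  have e: "\<bar>Z$k$l\<bar> \<le> M" for k l using spec_norm_entry_le[of Z k l] assms by linarith
  have t: "\<bar>trace Z\<bar> \<le> 2 * M" using e[of 1 1] e[of 2 2] by (simp add: trace2)
  define p where "p = ((trace Z)\<^sup>2 - 2 - trace Z * Z$2$2) / (- discr Z)"
  define q where "q = - (trace Z * Z$2$1) / (- discr Z)"
  have "corrector Z u = p * (u$2)\<^sup>2 + q * (u$1 * u$2)" for u
    using assms unfolding corrector_def p_def q_def mat2_vec_nth
    by (simp add: field_simps power2_eq_square)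
  moreover have M2: "1 \<le> M\<^sup>2" using assms by simp
  have t2: "(trace Z)\<^sup>2 \<le> 4 * M\<^sup>2" using abs_le_square_iff[of "trace Z" "2*M"] t assms by (simp add: power_mult_distrib)
  have tz: "\<bar>trace Z * Z$2$l\<bar> \<le> 2 * M\<^sup>2" for l
    using mult_mono[OF t e[of 2 l]] assms by (simp add: abs_mult power2_eq_square)
  have "\<bar>p\<bar> \<le> 8 * M\<^sup>2 / \<delta>"
  proof -
    have "\<bar>(trace Z)\<^sup>2 - 2 - trace Z * Z$2$2\<bar> \<le> 8 * M\<^sup>2"
      using tz[of 2] t2 M2 zero_le_power2[of "trace Z"] by linarith
    moreover have "\<bar>- discr Z\<bar> \<ge> \<delta>" using assms by simp
    ultimately show ?thesis
      unfolding p_def abs_divide using assms by (intro frac_le) auto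
  qed
  moreover have "\<bar>q\<bar> \<le> 8 * M\<^sup>2 / \<delta>"
  proof -
    have "\<bar>- (trace Z * Z$2$1)\<bar> \<le> 8 * M\<^sup>2"
      using tz[of 1] M2 by linarith
    moreover have "\<bar>- discr Z\<bar> \<ge> \<delta>" using assms by simp
    ultimately show ?thesis
      unfolding q_def abs_divide using assms by (intro frac_le) auto
  qed
  ultimately show ?thesis using that by blast
qed

lemma corrector_bounds:
  assumes "spec_norm Z \<le> M" "discr Z \<le> - \<delta>" "0 < \<delta>" "1 \<le> M"
  shows "\<bar>corrector Z u\<bar> \<le> 16 * M\<^sup>2 / \<delta> * (norm u)\<^sup>2"
    and "\<bar>corrector Z u - corrector Z w\<bar> \<le> 32 * M\<^sup>2 / \<delta> * (norm (u - w) * (norm u + norm w))"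
proof -
  define P where "P = 8 * M\<^sup>2 / \<delta>"
  obtain p q where c: "\<And>u. corrector Z u = p * (u$2)\<^sup>2 + q * (u$1 * u$2)"
    and pq: "\<bar>p\<bar> \<le> P" "\<bar>q\<bar> \<le> P"
    using corrector_coeffs[OF assms] unfolding P_def by metis
  have P0: "0 \<le> P" using pq by linarith
  have comp: "\<bar>z$k\<bar> \<le> norm z" for z :: "real^2" and k by (rule component_le_norm_cart)
  have diff: "\<bar>corrector Z u - corrector Z w\<bar> \<le> 4 * P * (norm (u - w) * (norm u + norm w))" for u w
  proof -
    let ?s = "norm u + norm w" and ?n = "norm (u - w)"
    have "corrector Z u - corrector Z w = p * ((u - w)$2 * (u$2 + w$2)) + (q * ((u - w)$2 * u$1) + q * (w$2 * (u - w)$1))"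
      unfolding c by (simp add: power2_eq_square algebra_simps)
    also have "\<bar>\<dots>\<bar> \<le> P * (?n * ?s) + (P * (?n * ?s) + P * (?s * ?n))"
    proof (intro order_trans[OF abs_triangle_ineq] add_mono)
      show "\<bar>p * ((u - w)$2 * (u$2 + w$2))\<bar> \<le> P * (?n * ?s)"
        unfolding abs_mult using comp[of u 2] comp[of w 2]
        by (intro mult_mono pq comp P0) (auto intro!: order_trans[OF abs_triangle_ineq])
      show "\<bar>q * ((u - w)$2 * u$1)\<bar> \<le> P * (?n * ?s)"
        unfolding abs_mult using comp[of u 1]
        by (intro mult_mono pq comp P0) (auto intro: add_increasing2)
      show "\<bar>q * (w$2 * (u - w)$1)\<bar> \<le> P * (?s * ?n)"
        unfolding abs_mult using comp[of w 2]
        by (intro mult_mono pq comp P0) (auto intro: add_increasing)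
    qed
    also have "\<dots> \<le> 4 * P * (?n * ?s)"
    proof -
      have "0 \<le> P * (?n * ?s)" using P0 by simp
      then show ?thesis by (simp add: algebra_simps)
    qed
    finally show ?thesis .
  qed
  show "\<bar>corrector Z u - corrector Z w\<bar> \<le> 32 * M\<^sup>2 / \<delta> * (norm (u - w) * (norm u + norm w))"
    using diff[of u w] by (simp add: P_def)
  have "\<bar>corrector Z u\<bar> \<le> P * (norm u * norm u) + P * (norm u * norm u)"
    unfolding c power2_eq_square
    by (intro order_trans[OF abs_triangle_ineq] add_mono)
       (unfold abs_mult, (intro mult_mono pq comp P0; simp)+)
  then show "\<bar>corrector Z u\<bar> \<le> 16 * M\<^sup>2 / \<delta> * (norm u)\<^sup>2"
    by (simp add: P_def power2_eq_square)
qed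

context elliptic_products
begin

text \<open>After telescoping, \<open>1 / \<alpha> (Suc n)\<close> bounds the corrector at the upper
  end. The summand 1 collects the corrector at 0, the finitely many indices at which the rate of
  \<open>turan_limit\<close> is not yet valid, and the \<open>1 / \<alpha> 0\<close> from shifting
  the sum.\<close>

theorem kernel_asymptotics:
  "\<exists>C\<ge>0. \<forall>n. \<forall>x\<in>K.
    \<bar>(\<Sum>j=0..n. (v j x $ 2)\<^sup>2) - 2 * Z x $ 2 $ 1 * amp x / (- discr (Z x)) * (\<Sum>j=0..Suc n. 1 / \<alpha> j)\<bar>
    \<le> C * (1 + 1 / \<alpha> (Suc n) + (\<Sum>k=0..n. tail k / \<alpha> (Suc k)))"
proof -
  obtain \<delta> where \<delta>: "\<delta> > 0" "\<And>x. x \<in> K \<Longrightarrow> discr (Z x) \<le> - \<delta>" using Z_gap by blast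
  define M' where "M' = max 1 M"
  have M': "1 \<le> M'" "0 \<le> M'" "M \<le> M'" by (auto simp: M'_def)
  obtain V where V: "V \<ge> 0" "\<And>j x. x \<in> K \<Longrightarrow> \<alpha> j * (norm (v j x))\<^sup>2 \<le> V"
    using v_bound by blast
  obtain R where R: "R \<ge> 1" "\<And>j. \<alpha> (Suc j) \<le> R * \<alpha> j"
    using pos_ratio_bounded[of \<alpha>] \<alpha>_pos \<alpha>_ratio by blast
  obtain C0 J where C0: "C0 \<ge> 0" and J: "\<forall>x\<in>K. \<forall>j\<ge>J. \<bar>turan j x - amp x\<bar> \<le> C0 * tail j"
    using turan_limit by blast
  obtain G where G: "G \<ge> 0" "\<forall>j<Suc 0. \<forall>x\<in>K. \<bar>amp x\<bar> \<le> G"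
    using finite_family_bounded_on_compact[OF compact_K cont_amp] by blast
  obtain B where B: "B \<ge> 0" "\<forall>j<J. \<forall>x\<in>K. \<bar>turan j x - amp x\<bar> \<le> B"
    using finite_family_bounded_on_compact[of K "\<lambda>j x. turan j x - amp x" J] compact_K
      continuous_on_diff[OF cont_turan cont_amp] by blast
  define \<kappa> where "\<kappa> x = 2 * Z x $ 2 $ 1 / (- discr (Z x))" for x
  define L where "L = 2 * M' / \<delta>"
  have L0: "0 \<le> L" using M' \<delta> by (simp add: L_def)
  have \<kappa>: "\<bar>\<kappa> x\<bar> \<le> L" if x: "x \<in> K" for x
  proof -
    have "\<bar>2 * Z x $ 2 $ 1\<bar> \<le> 2 * M'" using spec_norm_entry_le[of "Z x" 2 1] Z_bound[OF x] M' by simp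
    then show ?thesis
      unfolding \<kappa>_def L_def abs_divide using \<delta>(2)[OF x] \<delta>(1) M' by (intro frac_le) auto
  qed
  define P where "P = 32 * M'\<^sup>2 / \<delta>"
  have P0: "0 \<le> P" using \<delta> by (simp add: P_def)
  have Zb: "spec_norm (Z x) \<le> M'" if "x \<in> K" for x using Z_bound[OF that] M' by linarith
  have v2: "(norm (v j x))\<^sup>2 \<le> V / \<alpha> j" if "x \<in> K" for j x
    using V(2)[OF that, of j] \<alpha>_pos[of j] by (simp add: pos_le_divide_eq mult.commute)
  have v2': "(norm (v j x))\<^sup>2 \<le> R * V / \<alpha> (Suc j)" if x: "x \<in> K" for j x
  proof -
    have "V / \<alpha> j \<le> R * V / \<alpha> (Suc j)"
      using R(2)[of j] V(1) \<alpha>_pos[of j] \<alpha>_pos[of "Suc j"] mult_left_mono[of "\<alpha> (Suc j)" "R * \<alpha> j" V]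
      by (simp add: frac_le_eq divide_le_0_iff field_simps)
    with v2[OF x, of j] show ?thesis by linarith
  qed
  define cor where "cor j x = corrector (Z x) (v j x)" for j x
  \<comment> \<open>The coboundary is taken along the true orbit,
    \<open>v (Suc j) x = Y j x *v v j x\<close>, and not along \<open>Z x\<close>. So
    \<open>res\<close> consists of three errors: \<open>Z\<close> against \<open>Y j\<close> in the
    form, \<open>turan\<close> against \<open>amp\<close>, and \<open>Z\<close> against
    \<open>Y j\<close> inside the corrector.\<close>
  define res where "res j x = (v j x $ 2)\<^sup>2 - \<kappa> x * amp x / \<alpha> (Suc j) - (cor (Suc j) x - cor j x)" for j x
  \<comment> \<open>Indices below \<open>J\<close> are covered by the crude bound \<open>B\<close>;
    together they contribute at most \<open>L * H\<close>, whatever n is.\<close>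
  define b where "b j = (if j < J then B else 0)" for j
  define D where "D = L * (R * V) + L * C0 + P * (2 * M' * (R * V))"
  have res_le: "\<bar>res j x\<bar> \<le> D * (tail j / \<alpha> (Suc j)) + L * (b j / \<alpha> (Suc j))" if x: "x \<in> K" for j x
  proof -
    let ?u = "v j x"
    have pos: "\<alpha> (Suc j) > 0" by (rule \<alpha>_pos)
    have tw: "(turan j x - amp x) / \<alpha> (Suc j) = wedge ?u (Y j x *v ?u) - amp x / \<alpha> (Suc j)"
      using pos by (simp add: turan_form[OF x] diff_divide_distrib)
    have "?u$2 ^ 2 = \<kappa> x * wedge ?u (Z x *v ?u) + (corrector (Z x) (Z x *v ?u) - corrector (Z x) ?u)"
      unfolding \<kappa>_def by (rule corrector_identity[OF det_Z[OF x] Z_elliptic[OF x]])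
    then have split: "res j x = \<kappa> x * (wedge ?u (Z x *v ?u) - wedge ?u (Y j x *v ?u))
        + (\<kappa> x * ((turan j x - amp x) / \<alpha> (Suc j))
        + (corrector (Z x) (Z x *v ?u) - corrector (Z x) (Y j x *v ?u)))"
      unfolding res_def cor_def v_Suc[OF x] tw by (simp add: algebra_simps)
    have "\<bar>\<kappa> x * (wedge ?u (Z x *v ?u) - wedge ?u (Y j x *v ?u))\<bar> \<le> L * (tail j * (R * V / \<alpha> (Suc j)))"
      unfolding abs_mult
    proof (intro mult_mono \<kappa> x L0)
      have "\<bar>wedge ?u (Z x *v ?u) - wedge ?u (Y j x *v ?u)\<bar> \<le> spec_norm (Z x - Y j x) * (norm ?u)\<^sup>2"
        by (rule wedge_form_diff_le)
      also have "\<dots> \<le> tail j * (R * V / \<alpha> (Suc j))"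
        using Y_Z_dist[OF x, of j] tail_nonneg
        by (intro mult_mono v2' x) (auto simp: spec_norm_commute)
      finally show "\<bar>wedge ?u (Z x *v ?u) - wedge ?u (Y j x *v ?u)\<bar> \<le> tail j * (R * V / \<alpha> (Suc j))" .
    qed simp
    moreover have "\<bar>\<kappa> x * ((turan j x - amp x) / \<alpha> (Suc j))\<bar> \<le> L * ((C0 * tail j + b j) / \<alpha> (Suc j))"
      unfolding abs_mult
    proof (intro mult_mono \<kappa> x L0)
      have "\<bar>turan j x - amp x\<bar> \<le> C0 * tail j + b j"
      proof (cases "j < J")
        case True
        then have "\<bar>turan j x - amp x\<bar> \<le> B" using B x by blast
        with True C0 tail_nonneg[of j] show ?thesis by (simp add: b_def add_increasing)
      next
        case False with J x show ?thesis by (simp add: b_def)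
      qed
      then show "\<bar>(turan j x - amp x) / \<alpha> (Suc j)\<bar> \<le> (C0 * tail j + b j) / \<alpha> (Suc j)"
        using pos by (simp add: divide_right_mono)
    qed simp
    moreover have "\<bar>corrector (Z x) (Z x *v ?u) - corrector (Z x) (Y j x *v ?u)\<bar>
        \<le> P * (tail j * (2 * M' * (R * V / \<alpha> (Suc j))))"
    proof -
      have "\<bar>corrector (Z x) (Z x *v ?u) - corrector (Z x) (Y j x *v ?u)\<bar>
          \<le> P * (norm (Z x *v ?u - Y j x *v ?u) * (norm (Z x *v ?u) + norm (Y j x *v ?u)))"
        unfolding P_def by (rule corrector_bounds[OF Zb[OF x] \<delta>(2)[OF x] \<delta>(1) M'(1)])
      also have "\<dots> \<le> P * ((tail j * norm ?u) * (M' * norm ?u + M' * norm ?u))"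
      proof (intro mult_left_mono mult_mono add_mono P0)
        show "norm (Z x *v ?u - Y j x *v ?u) \<le> tail j * norm ?u"
          using spec_norm_mult_vec_le[of "Z x - Y j x" ?u] mult_right_mono[OF Y_Z_dist[OF x, of j], of "norm ?u"]
          by (simp add: spec_norm_commute matrix_vector_mult_diff_rdistrib)
        show "norm (Z x *v ?u) \<le> M' * norm ?u"
          using spec_norm_mult_vec_le[of "Z x" ?u] mult_right_mono[OF Zb[OF x], of "norm ?u"] by simp
        show "norm (Y j x *v ?u) \<le> M' * norm ?u"
          using spec_norm_mult_vec_le[of "Y j x" ?u] mult_right_mono[OF order_trans[OF Y_bound[OF x, of j] M'(3)], of "norm ?u"] by simp
      qed (use tail_nonneg in auto)
      also have "\<dots> = P * (tail j * (2 * M' * (norm ?u)\<^sup>2))" by (simp add: power2_eq_square algebra_simps)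
      also have "\<dots> \<le> P * (tail j * (2 * M' * (R * V / \<alpha> (Suc j))))"
        using M' tail_nonneg by (intro mult_left_mono v2' x P0) auto
      finally show ?thesis .
    qed
    ultimately have "\<bar>res j x\<bar> \<le> L * (tail j * (R * V / \<alpha> (Suc j)))
       + (L * ((C0 * tail j + b j) / \<alpha> (Suc j)) + P * (tail j * (2 * M' * (R * V / \<alpha> (Suc j)))))"
      unfolding split by (intro order_trans[OF abs_triangle_ineq] add_mono)
    also have "\<dots> = D * (tail j / \<alpha> (Suc j)) + L * (b j / \<alpha> (Suc j))"
      using pos by (simp add: D_def field_simps)
    finally show ?thesis .
  qed
  define H where "H = (\<Sum>j<J. B / \<alpha> (Suc j))"
  have H0: "0 \<le> H" unfolding H_def using B \<alpha>_pos by (intro sum_nonneg) (simp add: less_imp_le)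
  have sum_b: "(\<Sum>j=0..n. b j / \<alpha> (Suc j)) \<le> H" for n
  proof -
    have "(\<Sum>j=0..n. b j / \<alpha> (Suc j)) = (\<Sum>j\<in>{0..n}. if j < J then B / \<alpha> (Suc j) else 0)"
      by (intro sum.cong) (auto simp: b_def)
    also have "\<dots> = (\<Sum>j\<in>{0..n} \<inter> {..<J}. B / \<alpha> (Suc j))"
      by (subst sum.inter_restrict) (auto intro: sum.cong)
    also have "\<dots> \<le> H"
      unfolding H_def using B \<alpha>_pos by (intro sum_mono2) (auto simp: less_imp_le)
    finally show ?thesis .
  qed
  define Q where "Q = 16 * M'\<^sup>2 / \<delta> * V"
  have Q0: "0 \<le> Q" using \<delta> V by (simp add: Q_def)
  have cor_le: "\<bar>cor j x\<bar> \<le> Q / \<alpha> j" if x: "x \<in> K" for j x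
  proof -
    have "\<bar>cor j x\<bar> \<le> 16 * M'\<^sup>2 / \<delta> * (norm (v j x))\<^sup>2"
      unfolding cor_def by (rule corrector_bounds[OF Zb[OF x] \<delta>(2)[OF x] \<delta>(1) M'(1)])
    also have "\<dots> \<le> 16 * M'\<^sup>2 / \<delta> * (V / \<alpha> j)" using \<delta> by (intro mult_left_mono v2 x) auto
    finally show ?thesis by (simp add: Q_def)
  qed
  have D0: "0 \<le> D" unfolding D_def using L0 R V C0 P0 M' by (intro add_nonneg_nonneg mult_nonneg_nonneg) auto
  define C where "C = D + L * H + Q + Q / \<alpha> 0 + L * G / \<alpha> 0"
  have parts: "0 \<le> L * H" "0 \<le> Q / \<alpha> 0" "0 \<le> L * G / \<alpha> 0"
    using L0 H0 Q0 G \<alpha>_pos[of 0] by auto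
  have main: "\<bar>(\<Sum>j=0..n. (v j x $ 2)\<^sup>2) - \<kappa> x * amp x * (\<Sum>j=0..Suc n. 1 / \<alpha> j)\<bar>
    \<le> C * (1 + 1 / \<alpha> (Suc n) + (\<Sum>k=0..n. tail k / \<alpha> (Suc k)))" if x: "x \<in> K" for n x
  proof -
    let ?s = "\<Sum>k=0..n. tail k / \<alpha> (Suc k)"
    have s0: "0 \<le> ?s" using tail_nonneg \<alpha>_pos by (intro sum_nonneg) (simp add: less_imp_le)
    have a0: "0 \<le> 1 / \<alpha> (Suc n)" using \<alpha>_pos[of "Suc n"] by simp
    have "(\<Sum>j=0..n. (v j x $ 2)\<^sup>2) = (\<Sum>j=0..n. res j x + \<kappa> x * amp x * (1 / \<alpha> (Suc j)) + (cor (Suc j) x - cor j x))"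
      by (simp add: res_def)
    also have "\<dots> = (\<Sum>j=0..n. res j x) + \<kappa> x * amp x * (\<Sum>j=0..n. 1 / \<alpha> (Suc j)) + (cor (Suc n) x - cor 0 x)"
      using sum_Suc_diff[of 0 n "\<lambda>j. cor j x"]
      by (simp add: sum.distrib sum_distrib_left del: sum.atLeast0_atMost_Suc)
    \<comment> \<open>The Turan determinant carries \<open>\<alpha> (Suc j)\<close>, so the sum is
      shifted by one; this is why \<rho> appears with index n + 1.\<close>
    also have "(\<Sum>j=0..n. 1 / \<alpha> (Suc j)) = (\<Sum>j=0..Suc n. 1 / \<alpha> j) - 1 / \<alpha> 0"
      by (subst sum.atLeast0_atMost_Suc_shift) simp
    finally have eq: "(\<Sum>j=0..n. (v j x $ 2)\<^sup>2) - \<kappa> x * amp x * (\<Sum>j=0..Suc n. 1 / \<alpha> j)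
      = (\<Sum>j=0..n. res j x) + cor (Suc n) x - cor 0 x - \<kappa> x * amp x / \<alpha> 0"
      by (simp add: algebra_simps)
    have "\<bar>\<Sum>j=0..n. res j x\<bar> \<le> (\<Sum>j=0..n. D * (tail j / \<alpha> (Suc j)) + L * (b j / \<alpha> (Suc j)))"
      by (intro order_trans[OF sum_abs] sum_mono res_le x)
    also have "\<dots> = D * ?s + L * (\<Sum>j=0..n. b j / \<alpha> (Suc j))"
      by (simp add: sum.distrib sum_distrib_left)
    also have "\<dots> \<le> D * ?s + L * H" using L0 sum_b by (simp add: mult_left_mono)
    finally have 1: "\<bar>\<Sum>j=0..n. res j x\<bar> \<le> D * ?s + L * H" .
    have 2: "\<bar>cor (Suc n) x\<bar> \<le> Q * (1 / \<alpha> (Suc n))" using cor_le[OF x, of "Suc n"] by simp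
    have 3: "\<bar>cor 0 x\<bar> \<le> Q / \<alpha> 0" by (rule cor_le[OF x])
    have "\<bar>\<kappa> x * amp x\<bar> \<le> L * G" unfolding abs_mult using G x by (intro mult_mono \<kappa> L0) auto
    then have 4: "\<bar>\<kappa> x * amp x / \<alpha> 0\<bar> \<le> L * G / \<alpha> 0"
      using \<alpha>_pos[of 0] by (simp add: divide_right_mono)
    have "\<bar>(\<Sum>j=0..n. (v j x $ 2)\<^sup>2) - \<kappa> x * amp x * (\<Sum>j=0..Suc n. 1 / \<alpha> j)\<bar>
       \<le> D * ?s + Q * (1 / \<alpha> (Suc n)) + (L * H + Q / \<alpha> 0 + L * G / \<alpha> 0) * 1"
    proof -
      have "\<bar>s + c - c0 - k\<bar> \<le> p1 + p2 + (p3 + p4 + p5) * 1"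
        if "\<bar>s\<bar> \<le> p1 + p3" "\<bar>c\<bar> \<le> p2" "\<bar>c0\<bar> \<le> p4" "\<bar>k\<bar> \<le> p5" for s c c0 k p1 p2 p3 p4 p5 :: real
        using that by (auto simp: abs_le_iff)
      from this[OF 1 2 3 4] show ?thesis unfolding eq .
    qed
    also have "\<dots> \<le> C * ?s + C * (1 / \<alpha> (Suc n)) + C * 1"
      using D0 Q0 parts by (intro add_mono mult_right_mono s0 a0) (auto simp: C_def)
    finally show ?thesis by (simp add: algebra_simps)
  qed
  have "0 \<le> C" using D0 Q0 parts by (simp add: C_def)
  with main show ?thesis unfolding \<kappa>_def by (intro exI[of _ C]) (simp add: mult.assoc)
qed

end

section \<open>The Poisson formula for the upper half-plane\<close>

definition half_circle :: "real \<Rightarrow> real \<Rightarrow> complex" where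
  "half_circle R = linepath (of_real (- R)) (of_real R) +++ part_circlepath 0 R 0 pi"

text \<open>Taken without the customary factor 1 / pi, so that the total mass is pi and the kernel
  is the imaginary part of the resolvent.\<close>

definition poisson :: "complex \<Rightarrow> real \<Rightarrow> real" where
  "poisson z t = Im z / ((t - Re z)\<^sup>2 + (Im z)\<^sup>2)"

lemma poisson_pos: "0 < Im z \<Longrightarrow> 0 < poisson z t"
  unfolding poisson_def by (simp add: add_nonneg_pos)

lemma continuous_on_poisson: "0 < Im z \<Longrightarrow> continuous_on S (poisson z)"
  unfolding poisson_def
  by (intro continuous_intros) (metis less_irrefl add_nonneg_pos zero_le_power2 zero_less_power)

lemma poisson_eq_kernel:
  assumes "0 < Im z"
  shows "of_real (poisson z t) = of_real (Im z) / ((of_real t - cnj z) * (of_real t - z))"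
proof -
  have "(of_real t - cnj z) * (of_real t - z) = of_real ((t - Re z)\<^sup>2 + (Im z)\<^sup>2)"
    by (simp add: complex_eq_iff power2_eq_square algebra_simps)
  then show ?thesis by (simp add: poisson_def)
qed

text \<open>Dividing by w - cnj z, whose zero lies below the real axis, turns the Cauchy kernel into
  a multiple of the Poisson kernel on the line. On the arc the integrand is of order R^(-2) and the
  length is pi R.\<close>

lemma poisson_truncated:
  fixes F :: "complex \<Rightarrow> complex"
  assumes hol: "F holomorphic_on {w. 0 \<le> Im w}"
    and bound: "\<And>w. 0 \<le> Im w \<Longrightarrow> norm (F w) \<le> B" and z: "0 < Im z" and R: "norm z < R"
  shows "(\<lambda>t. of_real (poisson z t) * F (of_real t)) integrable_on {- R..R}"
    and "norm (integral {- R..R} (\<lambda>t. of_real (poisson z t) * F (of_real t))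
         - of_real pi * winding_number (half_circle R) z * F z) \<le> Im z * (B / (R - norm z)\<^sup>2 * R * pi)"
proof -
  let ?H = "{w. 0 \<le> Im w}"
  define G where "G = (\<lambda>w. F w / (w - cnj z) / (w - z))"
  have R0: "0 < R" using R norm_ge_zero[of z] by linarith
  have cnj_ne: "w - cnj z \<noteq> 0" if "0 \<le> Im w" for w
    using that z by (auto simp: complex_eq_iff)
  have holf: "(\<lambda>w. F w / (w - cnj z)) holomorphic_on ?H"
    using cnj_ne by (intro holomorphic_intros hol) auto
  have conv: "convex ?H" by (rule convex_halfspace_Im_ge)
  have int: "z \<in> interior ?H" 
    by (rule interiorI[OF open_halfspace_Im_gt[of 0]]) (use z in auto)
  have arc: "path_image (part_circlepath 0 R 0 pi) \<subseteq> {w. 0 \<le> Im w \<and> norm w = R}"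
  proof
    fix w assume "w \<in> path_image (part_circlepath 0 R 0 pi)"
    then obtain t where t: "0 \<le> t" "t \<le> pi" "w = of_real R * cis t"
      by (auto simp: path_image_part_circlepath' closed_segment_eq_real_ivl)
    then show "w \<in> {w. 0 \<le> Im w \<and> norm w = R}"
      using R0 sin_ge_zero[of t] by (simp add: norm_mult)
  qed
  have line: "path_image (linepath (of_real (- R)) (of_real R)) \<subseteq> {w. Im w = 0}"
    by (auto simp: closed_segment_def)
  have img: "path_image (half_circle R) \<subseteq> ?H - {z}"
  proof
    fix w assume "w \<in> path_image (half_circle R)"
    then have "w \<in> path_image (linepath (of_real (- R)) (of_real R)) \<or> w \<in> path_image (part_circlepath 0 R 0 pi)"
      using path_image_join_subset unfolding half_circle_def by blast
    then have "Im w = 0 \<or> 0 \<le> Im w \<and> norm w = R" using arc line by blast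
    then show "w \<in> ?H - {z}" using R z by auto
  qed
  have cauchy: "(G has_contour_integral 2 * of_real pi * \<i> * winding_number (half_circle R) z * (F z / (z - cnj z)))
      (half_circle R)"
  proof -
    have "valid_path (half_circle R)" "pathfinish (half_circle R) = pathstart (half_circle R)"
      by (auto simp: half_circle_def cis_conv_exp[symmetric] intro!: valid_path_join)
    from Cauchy_integral_formula_convex_simple[OF conv holf int this(1) img this(2)]
    show ?thesis by (simp add: G_def)
  qed
  have G_int: "G contour_integrable_on (linepath (of_real (- R)) (of_real R))"
    "G contour_integrable_on (part_circlepath 0 R 0 pi)"
    using has_contour_integral_integrable[OF cauchy] unfolding half_circle_def
    by (simp_all add: cis_conv_exp[symmetric])
  have sum: "contour_integral (linepath (of_real (- R)) (of_real R)) G + contour_integral (part_circlepath 0 R 0 pi) G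
      = 2 * of_real pi * \<i> * winding_number (half_circle R) z * (F z / (z - cnj z))"
    using contour_integral_unique[OF cauchy] G_int unfolding half_circle_def
    by (simp add: cis_conv_exp[symmetric])
  have G_poisson: "of_real (Im z) * G (of_real t) = of_real (poisson z t) * F (of_real t)" for t
    unfolding poisson_eq_kernel[OF z] G_def by simp
  have "(G has_contour_integral contour_integral (linepath (of_real (- R)) (of_real R)) G) (linepath (of_real (- R)) (of_real R))"
    by (rule has_contour_integral_integral[OF G_int(1)])
  then have "((\<lambda>t. G (of_real t)) has_integral contour_integral (linepath (of_real (- R)) (of_real R)) G) {- R..R}"
    using R0 by (subst (asm) has_contour_integral_linepath_Reals_iff) auto
  from has_integral_mult_right[OF this, of "of_real (Im z)"]
  have hI: "((\<lambda>t. of_real (poisson z t) * F (of_real t)) has_integral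
      of_real (Im z) * contour_integral (linepath (of_real (- R)) (of_real R)) G) {- R..R}"
    by (simp add: G_poisson)
  then show "(\<lambda>t. of_real (poisson z t) * F (of_real t)) integrable_on {- R..R}" by blast
  have zz: "z - cnj z = 2 * \<i> * of_real (Im z)" by (simp add: complex_eq_iff)
  have "of_real (Im z) * (2 * of_real pi * \<i> * winding_number (half_circle R) z * (F z / (z - cnj z)))
     = of_real pi * winding_number (half_circle R) z * F z"
    unfolding zz using z by (simp add: field_simps)
  then have "integral {- R..R} (\<lambda>t. of_real (poisson z t) * F (of_real t))
      - of_real pi * winding_number (half_circle R) z * F z
      = - (of_real (Im z) * contour_integral (part_circlepath 0 R 0 pi) G)"
    unfolding integral_unique[OF hI] sum[symmetric] by (simp add: algebra_simps)
  then have "norm (integral {- R..R} (\<lambda>t. of_real (poisson z t) * F (of_real t))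
      - of_real pi * winding_number (half_circle R) z * F z)
      = Im z * norm (contour_integral (part_circlepath 0 R 0 pi) G)"
    using z by (simp add: norm_mult)
  also have "\<dots> \<le> Im z * (B / (R - norm z)\<^sup>2 * R * (pi - 0))"
  proof (intro mult_left_mono has_contour_integral_bound_part_circlepath[OF has_contour_integral_integral[OF G_int(2)]])
    fix w assume "w \<in> path_image (part_circlepath 0 R 0 pi)"
    then have w: "0 \<le> Im w" "norm w = R" using arc by auto
    have "R - norm z \<le> norm (w - z)" "R - norm z \<le> norm (w - cnj z)"
      using norm_triangle_ineq2[of w z] norm_triangle_ineq2[of w "cnj z"] w by auto
    then have "(R - norm z)\<^sup>2 \<le> norm (w - cnj z) * norm (w - z)"
      unfolding power2_eq_square using R by (intro mult_mono) auto
    moreover have "0 < (R - norm z)\<^sup>2" using R by simp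
    ultimately show "norm (G w) \<le> B / (R - norm z)\<^sup>2"
      unfolding G_def norm_divide divide_divide_eq_left using bound[OF w(1)] norm_ge_zero[of "F w"]
      by (intro frac_le) (auto simp: norm_mult simp del: norm_ge_zero)
  next
    have "0 \<le> B" using bound[of 0] norm_ge_zero[of "F 0"] by (simp del: norm_ge_zero)
    then show "0 \<le> B / (R - norm z)\<^sup>2" by simp
  qed (use R0 z in auto)
  finally show "norm (integral {- R..R} (\<lambda>t. of_real (poisson z t) * F (of_real t))
         - of_real pi * winding_number (half_circle R) z * F z) \<le> Im z * (B / (R - norm z)\<^sup>2 * R * pi)"
    by simp
qed

lemma poisson_total:
  assumes z: "0 < Im z"
  shows "((\<lambda>R. integral {- R..R} (poisson z)) \<longlongrightarrow> pi) at_top"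
proof -
  have *: "integral {- R..R} (poisson z) = arctan ((R - Re z) / Im z) - arctan ((- R - Re z) / Im z)"
    if "0 < R" for R
  proof (rule integral_unique, rule fundamental_theorem_of_calculus)
    fix t
    have "1 + ((t - Re z) / Im z)\<^sup>2 = ((t - Re z)\<^sup>2 + (Im z)\<^sup>2) / (Im z)\<^sup>2"
      using z by (simp add: field_simps power_divide)
    then have "inverse (1 + ((t - Re z) / Im z)\<^sup>2) * (1 / Im z) = poisson z t"
      using z by (simp add: poisson_def power2_eq_square)
    moreover have "((\<lambda>t. arctan ((t - Re z) / Im z)) has_real_derivative
        inverse (1 + ((t - Re z) / Im z)\<^sup>2) * (1 / Im z)) (at t within {- R..R})"
      by (rule derivative_eq_intros refl | (use z in simp))+
    ultimately show "((\<lambda>t. arctan ((t - Re z) / Im z)) has_vector_derivative poisson z t) (at t within {- R..R})"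
      by (simp add: has_real_derivative_iff_has_vector_derivative)
  qed (use that in simp)
  have "eventually (\<lambda>R. arctan ((R - Re z) / Im z) - arctan ((- R - Re z) / Im z) = integral {- R..R} (poisson z)) at_top"
    using eventually_gt_at_top[of "0::real"] by (rule eventually_mono) (simp add: *)
  moreover have "((\<lambda>R. arctan ((R - Re z) / Im z) - arctan ((- R - Re z) / Im z)) \<longlongrightarrow> pi) at_top"
    using z by real_asymp
  ultimately show ?thesis by (rule Lim_transform_eventually[rotated])
qed

lemma poisson_representation:
  fixes F :: "complex \<Rightarrow> complex"
  assumes hol: "F holomorphic_on {w. 0 \<le> Im w}"
    and bound: "\<And>w. 0 \<le> Im w \<Longrightarrow> norm (F w) \<le> B" and z: "0 < Im z"
  shows "((\<lambda>R. integral {- R..R} (\<lambda>t. of_real (poisson z t) * F (of_real t))) \<longlongrightarrow> of_real pi * F z) at_top"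
proof -
  \<comment> \<open>The winding number is never computed: applying the estimate to the constant function 1 shows
    that it tends to 1.\<close>
  define W where "W R = of_real pi * winding_number (half_circle R) z" for R
  have remainder: "((\<lambda>R. Im z * (b / (R - norm z)\<^sup>2 * R * pi)) \<longlongrightarrow> 0) at_top" for b :: real
    by real_asymp
  have main: "((\<lambda>R. integral {- R..R} (\<lambda>t. of_real (poisson z t) * f (of_real t)) - W R * f z) \<longlongrightarrow> 0) at_top"
    if "f holomorphic_on {w. 0 \<le> Im w}" "\<And>w. 0 \<le> Im w \<Longrightarrow> norm (f w) \<le> b" for f :: "complex \<Rightarrow> complex" and b
  proof (rule Lim_null_comparison[OF _ remainder[of b]])
    show "eventually (\<lambda>R. norm (integral {- R..R} (\<lambda>t. of_real (poisson z t) * f (of_real t)) - W R * f z)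
       \<le> Im z * (b / (R - norm z)\<^sup>2 * R * pi)) at_top"
      using eventually_gt_at_top[of "norm z"]
      by eventually_elim (simp only: W_def poisson_truncated(2)[OF that z])
  qed
  have "((\<lambda>R. integral {- R..R} (\<lambda>t. of_real (poisson z t) * (1::complex)) - W R * 1) \<longlongrightarrow> 0) at_top"
    using main[of "\<lambda>_. 1" 1] by simp
  moreover have "((\<lambda>R. integral {- R..R} (\<lambda>t. of_real (poisson z t) * (1::complex))) \<longlongrightarrow> of_real pi) at_top"
  proof -
    have "integral {- R..R} (\<lambda>t. of_real (poisson z t) * (1::complex)) = of_real (integral {- R..R} (poisson z))" for R
      using integral_linear[OF integrable_continuous_real[OF continuous_on_poisson[OF z, of "{- R..R}"]]
          bounded_linear_of_real[where ?'a = complex]]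
      by (simp add: o_def)
    then show ?thesis using tendsto_of_real[OF poisson_total[OF z], where ?'a = complex] by simp
  qed
  ultimately have "(W \<longlongrightarrow> of_real pi - 0) at_top"
    using tendsto_diff[of "\<lambda>R. integral {- R..R} (\<lambda>t. of_real (poisson z t) * (1::complex))" "of_real pi" at_top
        "\<lambda>R. integral {- R..R} (\<lambda>t. of_real (poisson z t) * (1::complex)) - W R * 1" 0] by simp
  then have "((\<lambda>R. W R * F z) \<longlongrightarrow> of_real pi * F z) at_top" by (intro tendsto_intros) simp
  from tendsto_add[OF main[OF hol bound] this] show ?thesis by simp
qed

text \<open>Nonnegativity on the line turns the improper integral into a Lebesgue integral by
  monotone convergence. Boundedness of \<open>F\<close> excludes the linear term that a general
  Herglotz function may carry.\<close>

lemma nn_integral_poisson: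
  fixes F :: "complex \<Rightarrow> complex"
  assumes hol: "F holomorphic_on {w. 0 \<le> Im w}"
    and bound: "\<And>w. 0 \<le> Im w \<Longrightarrow> norm (F w) \<le> B" and z: "0 < Im z"
    and nonneg: "\<And>t. 0 \<le> Im (F (of_real t))"
  shows "(\<integral>\<^sup>+t. ennreal (poisson z t * Im (F (of_real t))) \<partial>lborel) = ennreal (pi * Im (F z))"
proof -
  define f where "f t = poisson z t * Im (F (of_real t))" for t
  have cF: "continuous_on UNIV (\<lambda>t. F (of_real t))"
    using continuous_on_compose2[OF holomorphic_on_imp_continuous_on[OF hol], of UNIV of_real]
    by (auto simp: image_subset_iff intro: continuous_intros)
  have cf: "continuous_on UNIV f"
    unfolding f_def by (intro continuous_intros continuous_on_poisson z cF)
  have f0: "0 \<le> f t" for t unfolding f_def using nonneg poisson_pos[OF z] by (simp add: less_imp_le)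
  define I where "I n = integral {- real n..real n} f" for n
  have hI: "(f has_integral I n) {- real n..real n}" for n
    unfolding I_def using cf by (intro integrable_integral integrable_continuous_real) (auto intro: continuous_on_subset)
  have nn: "(\<integral>\<^sup>+t. ennreal (f t) * indicator {- real n..real n} t \<partial>lborel) = ennreal (I n)" for n
    by (rule nn_integral_has_integral_lebesgue'[OF f0 hI])
  have "(\<lambda>n. ennreal (I n)) \<longlonglongrightarrow> (\<integral>\<^sup>+t. ennreal (f t) \<partial>lborel)"
  proof -
    have "(\<integral>\<^sup>+t. ennreal (f t) \<partial>lborel) = (\<integral>\<^sup>+t. (SUP n. ennreal (f t) * indicator {- real n..real n} t) \<partial>lborel)"
    proof (rule nn_integral_cong)
      fix t
      obtain n where n: "\<bar>t\<bar> \<le> real n" using real_arch_simple by blast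
      show "ennreal (f t) = (SUP n. ennreal (f t) * indicator {- real n..real n} t)"
      proof (rule antisym)
        show "ennreal (f t) \<le> (SUP n. ennreal (f t) * indicator {- real n..real n} t)"
          using n by (intro SUP_upper2[of n]) (auto simp: indicator_def)
        show "(SUP n. ennreal (f t) * indicator {- real n..real n} t) \<le> ennreal (f t)"
          by (intro SUP_least) (auto simp: indicator_def)
      qed
    qed
    also have "\<dots> = (SUP n. \<integral>\<^sup>+t. ennreal (f t) * indicator {- real n..real n} t \<partial>lborel)"
      using borel_measurable_continuous_onI[OF cf]
      by (intro nn_integral_monotone_convergence_SUP)
         (auto simp: incseq_def le_fun_def indicator_def)
    also have "\<dots> = (SUP n. ennreal (I n))" by (simp only: nn)
    finally have eq: "(\<integral>\<^sup>+t. ennreal (f t) \<partial>lborel) = (SUP n. ennreal (I n))" .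
    have "incseq (\<lambda>n. ennreal (I n))"
      unfolding nn[symmetric] incseq_def
      by (auto intro!: nn_integral_mono simp: indicator_def)
    then show ?thesis unfolding eq by (rule LIMSEQ_SUP)
  qed
  moreover have "(\<lambda>n. ennreal (I n)) \<longlonglongrightarrow> ennreal (pi * Im (F z))"
  proof -
    have "((\<lambda>R. Im (integral {- R..R} (\<lambda>t. of_real (poisson z t) * F (of_real t)))) \<longlongrightarrow> Im (of_real pi * F z)) at_top"
      by (intro tendsto_Im poisson_representation[OF hol bound z])
    moreover have "Im (integral {- R..R} (\<lambda>t. of_real (poisson z t) * F (of_real t))) = integral {- R..R} f" for R
    proof -
      have "(\<lambda>t. of_real (poisson z t) * F (of_real t)) integrable_on {- R..R}"
        by (intro integrable_continuous_real continuous_intros continuous_on_poisson z)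
           (use cF in \<open>auto intro: continuous_on_subset\<close>)
      from integral_component_eq[OF this, of \<i>] integral_linear[OF this bounded_linear_Im] show ?thesis
        by (simp add: o_def f_def[abs_def])
    qed
    ultimately have "((\<lambda>R. integral {- R..R} f) \<longlongrightarrow> pi * Im (F z)) at_top" by simp
    then have "I \<longlonglongrightarrow> pi * Im (F z)"
      unfolding I_def by (rule filterlim_compose[OF _ filterlim_real_sequentially])
    then show ?thesis by (rule tendsto_ennrealI)
  qed
  ultimately show ?thesis unfolding f_def using LIMSEQ_unique by blast
qed

section \<open>Weyl disks of a Jacobi matrix\<close>

text \<open>The inhomogeneity \<open>w\<close> enters only at index 0: \<open>w = 0\<close> gives the orthonormal polynomials,
  \<open>w = 1\<close> the Stieltjes transforms of \<open>p\<^sub>n d\<mu>\<close>.\<close>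

definition jacobi_solution ::
  "(nat \<Rightarrow> real) \<Rightarrow> (nat \<Rightarrow> real) \<Rightarrow> complex \<Rightarrow> complex \<Rightarrow> (nat \<Rightarrow> complex) \<Rightarrow> bool" where
  "jacobi_solution a b z w u \<longleftrightarrow>
     of_real (a 0) * u 1 + of_real (b 0) * u 0 = z * u 0 + w \<and>
     (\<forall>m. of_real (a (Suc m)) * u (Suc (Suc m)) + of_real (b (Suc m)) * u (Suc m) + of_real (a m) * u m
        = z * u (Suc m))"

fun orth_polyc :: "(nat \<Rightarrow> real) \<Rightarrow> (nat \<Rightarrow> real) \<Rightarrow> nat \<Rightarrow> complex \<Rightarrow> complex" where
  "orth_polyc a b 0 z = 1"
| "orth_polyc a b (Suc 0) z = (z - of_real (b 0)) / of_real (a 0)"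
| "orth_polyc a b (Suc (Suc m)) z =
     ((z - of_real (b (Suc m))) * orth_polyc a b (Suc m) z - of_real (a m) * orth_polyc a b m z) / of_real (a (Suc m))"

text \<open>The polynomials of the second kind, that is, the solution with inhomogeneity 1 that
  starts at 0. They equal the integral of (p_n(x) - p_n(z)) / (x - z) with respect to \<mu>.\<close>

fun second_polyc :: "(nat \<Rightarrow> real) \<Rightarrow> (nat \<Rightarrow> real) \<Rightarrow> nat \<Rightarrow> complex \<Rightarrow> complex" where
  "second_polyc a b 0 z = 0"
| "second_polyc a b (Suc 0) z = 1 / of_real (a 0)"
| "second_polyc a b (Suc (Suc m)) z =
     ((z - of_real (b (Suc m))) * second_polyc a b (Suc m) z - of_real (a m) * second_polyc a b m z) / of_real (a (Suc m))"

lemma orth_polyc_of_real: "orth_polyc a b n (of_real x) = of_real (orth_poly a b n x)"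
  by (induction a b n x rule: orth_poly.induct) auto

lemma second_polyc_of_real: "Im (second_polyc a b n (of_real x)) = 0"
proof -
  have "second_polyc a b n (of_real x) \<in> \<real>"
    by (induction n rule: induct_nat_012) (auto intro!: Reals_divide Reals_mult Reals_diff)
  then show ?thesis by (simp add: complex_is_Real_iff)
qed

lemma Im_mult_cnj_self: "Im (z * w * cnj w) = Im z * (norm w)\<^sup>2"
  unfolding cmod_power2 by (simp add: power2_eq_square algebra_simps)

lemma holomorphic_orth_polyc: "orth_polyc a b n holomorphic_on S"
proof (induction n rule: induct_nat_012)
  case 0 then show ?case by (simp add: orth_polyc.simps(1)[abs_def])
next
  case 1
  then show ?case using holomorphic_on_diff[OF holomorphic_on_ident holomorphic_on_const]
    by (auto simp: divide_inverse intro!: holomorphic_on_mult holomorphic_on_const)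
next
  case (ge2 n)
  then show ?case
    by (auto simp: divide_inverse intro!: holomorphic_on_mult holomorphic_on_diff holomorphic_on_const holomorphic_on_ident)
qed

lemma holomorphic_second_polyc: "second_polyc a b n holomorphic_on S"
proof (induction n rule: induct_nat_012)
  case (ge2 n)
  then show ?case
    by (auto simp: divide_inverse intro!: holomorphic_on_mult holomorphic_on_diff holomorphic_on_const holomorphic_on_ident)
qed auto

text \<open>By \<open>lagrange_identity\<close> membership means
  \<open>Im (u (Suc n) * cnj (u n)) \<le> 0\<close> for u = m P + Q. Written with the sum of
  squares, the condition follows for the Stieltjes transform of \<mu> directly from Bessel's
  inequality.\<close>

definition weyl_disk :: "(nat \<Rightarrow> real) \<Rightarrow> (nat \<Rightarrow> real) \<Rightarrow> nat \<Rightarrow> complex \<Rightarrow> complex set" where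
  "weyl_disk a b n z =
     {m. Im z * (\<Sum>k\<le>n. (norm (m * orth_polyc a b k z + second_polyc a b k z))\<^sup>2) \<le> Im m}"

text \<open>The value \<open>m\<close> for which \<open>u = m P + Q\<close> satisfies the boundary condition \<open>u (n + 1) = \<zeta> u n\<close>.
  For \<open>Im \<zeta> < 0\<close> this is the Stieltjes transform of Carmona's approximation of \<open>\<mu>\<close>.\<close>

definition weyl_quot :: "(nat \<Rightarrow> real) \<Rightarrow> (nat \<Rightarrow> real) \<Rightarrow> nat \<Rightarrow> complex \<Rightarrow> complex \<Rightarrow> complex" where
  "weyl_quot a b n \<zeta> z = - (second_polyc a b (Suc n) z - \<zeta> * second_polyc a b n z)
     / (orth_polyc a b (Suc n) z - \<zeta> * orth_polyc a b n z)"

locale jacobi =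
  fixes a b :: "nat \<Rightarrow> real"
  assumes a_pos: "\<And>n. 0 < a n"
begin

abbreviation "P \<equiv> orth_polyc a b"
abbreviation "Q \<equiv> second_polyc a b"

lemma a_ne: "complex_of_real (a n) \<noteq> 0" using a_pos[of n] by simp

lemma P_rec:
  "of_real (a 0) * P (Suc 0) z = z - of_real (b 0)"
  "of_real (a (Suc m)) * P (Suc (Suc m)) z = (z - of_real (b (Suc m))) * P (Suc m) z - of_real (a m) * P m z"
  using a_ne[of 0] a_ne[of "Suc m"] by simp_all

lemma Q_rec:
  "of_real (a 0) * Q (Suc 0) z = 1"
  "of_real (a (Suc m)) * Q (Suc (Suc m)) z = (z - of_real (b (Suc m))) * Q (Suc m) z - of_real (a m) * Q m z"
  using a_ne[of 0] a_ne[of "Suc m"] by simp_all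

lemma solution_P: "jacobi_solution a b z 0 (\<lambda>k. P k z)"
  unfolding jacobi_solution_def One_nat_def P_rec by (simp add: algebra_simps)

lemma solution_affine: "jacobi_solution a b z 1 (\<lambda>k. m * P k z + Q k z)"
  unfolding jacobi_solution_def One_nat_def distrib_left mult.left_commute[of _ m] P_rec Q_rec
  by (simp add: algebra_simps)

section \<open>Lagrange identity, Wronskian and the rational Stieltjes transforms\<close>

lemma solution_unique:
  assumes "jacobi_solution a b z w u" "jacobi_solution a b z w u'" "u 0 = u' 0"
  shows "u n = u' n"
proof (induction n rule: induct_nat_012)
  case 0 then show ?case by (rule assms)
next
  case 1
  have "of_real (a 0) * u 1 = of_real (a 0) * u' 1"
    using assms unfolding jacobi_solution_def by (metis add_right_cancel)
  then show ?case using a_ne by simp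
next
  case (ge2 n)
  have "of_real (a (Suc n)) * u (Suc (Suc n)) = z * u (Suc n) - of_real (b (Suc n)) * u (Suc n) - of_real (a n) * u n"
    "of_real (a (Suc n)) * u' (Suc (Suc n)) = z * u' (Suc n) - of_real (b (Suc n)) * u' (Suc n) - of_real (a n) * u' n"
    using assms(1,2) unfolding jacobi_solution_def by (simp_all add: eq_diff_eq add_ac) 
  then show ?case using ge2 a_ne[of "Suc n"] by (metis mult_left_cancel)
qed

text \<open>Multiply the recurrence at n by \<open>cnj (u n)\<close> and take imaginary parts: the
  real diagonal entries drop out and the off-diagonal terms telescope.\<close>

lemma lagrange_identity:
  assumes u: "jacobi_solution a b z w u"
  shows "Im z * (\<Sum>k\<le>n. (norm (u k))\<^sup>2) + Im (w * cnj (u 0)) = a n * Im (u (Suc n) * cnj (u n))"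
proof (induction n)
  case 0
  have "of_real (a 0) * u 1 = z * u 0 + w - of_real (b 0) * u 0"
    using u by (simp add: jacobi_solution_def eq_diff_eq)
  then have "Im (of_real (a 0) * u 1 * cnj (u 0)) = Im (z * u 0 * cnj (u 0)) + Im (w * cnj (u 0)) - Im (of_real (b 0) * u 0 * cnj (u 0))"
    by (metis (no_types, lifting) distrib_right left_diff_distrib minus_complex.sel(2) plus_complex.sel(2))
  then show ?case unfolding Im_mult_cnj_self by (simp add: algebra_simps)
next
  case (Suc n)
  have "of_real (a (Suc n)) * u (Suc (Suc n)) = z * u (Suc n) - of_real (b (Suc n)) * u (Suc n) - of_real (a n) * u n"
    using u by (simp add: jacobi_solution_def eq_diff_eq add_ac)
  then have "Im (of_real (a (Suc n)) * u (Suc (Suc n)) * cnj (u (Suc n)))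
      = Im (z * u (Suc n) * cnj (u (Suc n))) - Im (of_real (b (Suc n)) * u (Suc n) * cnj (u (Suc n))) - Im (of_real (a n) * u n * cnj (u (Suc n)))"
    by (metis (no_types, lifting) left_diff_distrib minus_complex.sel(2))
  then have "a (Suc n) * Im (u (Suc (Suc n)) * cnj (u (Suc n))) = Im z * (norm (u (Suc n)))\<^sup>2 + a n * Im (u (Suc n) * cnj (u n))"
    unfolding Im_mult_cnj_self by (simp add: algebra_simps)
  with Suc show ?case by (simp add: algebra_simps)
qed

lemma wronskian: "Q (Suc n) z * P n z - Q n z * P (Suc n) z = 1 / of_real (a n)"
proof (induction n)
  case 0 then show ?case by simp
next
  case (Suc n)
  have "of_real (a (Suc n)) * (Q (Suc (Suc n)) z * P (Suc n) z - Q (Suc n) z * P (Suc (Suc n)) z)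
     = of_real (a n) * (Q (Suc n) z * P n z - Q n z * P (Suc n) z)"
    using P_rec(2)[of n z] Q_rec(2)[of n z] by algebra
  also have "\<dots> = 1" using Suc a_ne[of n] by simp
  finally show ?case using a_ne[of "Suc n"] by (simp add: field_simps)
qed

text \<open>At a zero the Lagrange identity for \<open>P\<close> has a nonnegative left side and a
  nonpositive right side. So \<open>P n z\<close> vanishes, hence also \<open>P (Suc n) z\<close>,
  against \<open>wronskian\<close>. The real axis is included, which makes the quotient holomorphic
  up to the boundary.\<close>

lemma denominator_nonzero:
  assumes z: "0 \<le> Im z" and \<zeta>: "Im \<zeta> < 0"
  shows "P (Suc n) z - \<zeta> * P n z \<noteq> 0"
proof
  assume "P (Suc n) z - \<zeta> * P n z = 0"
  then have eq: "P (Suc n) z = \<zeta> * P n z" by simp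
  have "Im z * (\<Sum>k\<le>n. (norm (P k z))\<^sup>2) = a n * Im (P (Suc n) z * cnj (P n z))"
    using lagrange_identity[OF solution_P, of z n] by simp
  also have "\<dots> = a n * (Im \<zeta> * (norm (P n z))\<^sup>2)"
    unfolding eq Im_mult_cnj_self ..
  finally have "0 \<le> a n * (Im \<zeta> * (norm (P n z))\<^sup>2)"
    using z by (metis mult_nonneg_nonneg sum_nonneg zero_le_power2)
  then have "(norm (P n z))\<^sup>2 \<le> 0"
    using \<zeta> a_pos[of n] by (simp add: zero_le_mult_iff mult_le_0_iff)
  then have "P n z = 0" by simp
  with eq wronskian[of n z] a_ne[of n] show False by simp
qed

lemma holomorphic_weyl_quot:
  assumes "Im \<zeta> < 0"
  shows "weyl_quot a b n \<zeta> holomorphic_on {w. 0 \<le> Im w}"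
  unfolding weyl_quot_def[abs_def]
  by (intro holomorphic_intros holomorphic_second_polyc holomorphic_orth_polyc)
     (use denominator_nonzero[OF _ assms] in auto)

lemma weyl_quot_in_disk:
  assumes z: "0 \<le> Im z" and \<zeta>: "Im \<zeta> < 0"
  shows "weyl_quot a b n \<zeta> z \<in> weyl_disk a b n z"
proof -
  let ?m = "weyl_quot a b n \<zeta> z"
  define u where "u k = ?m * P k z + Q k z" for k
  have u: "jacobi_solution a b z 1 u" unfolding u_def by (rule solution_affine)
  have "u (Suc n) - \<zeta> * u n = ?m * (P (Suc n) z - \<zeta> * P n z) + (Q (Suc n) z - \<zeta> * Q n z)"
    by (simp add: u_def algebra_simps)
  also have "\<dots> = 0" unfolding weyl_quot_def using denominator_nonzero[OF z \<zeta>, of n] by simp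
  finally have un: "u (Suc n) = \<zeta> * u n" by simp
  have "Im z * (\<Sum>k\<le>n. (norm (u k))\<^sup>2) - Im ?m = a n * Im (u (Suc n) * cnj (u n))"
    using lagrange_identity[OF u, of n] by (simp add: u_def)
  also have "\<dots> = a n * (Im \<zeta> * (norm (u n))\<^sup>2)"
    unfolding un Im_mult_cnj_self ..
  also have "\<dots> \<le> 0"
    using \<zeta> a_pos[of n] by (intro mult_nonneg_nonpos mult_nonpos_nonneg) auto
  finally show ?thesis by (simp add: weyl_disk_def u_def)
qed

text \<open>Multiplying numerator and denominator by the conjugate denominator leaves the Wronskian
  \<open>1 / a n\<close> in the imaginary part. The value is pi times the density named in the
  overview.\<close>

lemma Im_weyl_quot_real:
  assumes \<zeta>: "Im \<zeta> < 0"
  shows "Im (weyl_quot a b n \<zeta> (of_real t)) =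
    - Im \<zeta> / (a n * (norm (of_real (orth_poly a b (Suc n) t) - \<zeta> * of_real (orth_poly a b n t)))\<^sup>2)"
proof -
  define p p' q q' where "p = orth_poly a b n t" and "p' = orth_poly a b (Suc n) t"
    and "q = Re (Q n (of_real t))" and "q' = Re (Q (Suc n) (of_real t))"
  have q: "Q n (of_real t) = of_real q" "Q (Suc n) (of_real t) = of_real q'"
    using second_polyc_of_real by (auto simp: q_def q'_def complex_eq_iff)
  have p: "P n (of_real t) = of_real p" "P (Suc n) (of_real t) = of_real p'"
    by (simp_all only: orth_polyc_of_real p_def p'_def)
  let ?D = "of_real p' - \<zeta> * of_real p"
  have D: "?D \<noteq> 0" using denominator_nonzero[OF _ \<zeta>, of "of_real t" n] unfolding p by simp
  have "complex_of_real (q' * p - q * p') = of_real (1 / a n)"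
    using wronskian[of n "of_real t"] unfolding p q by simp
  then have w: "q' * p - q * p' = 1 / a n" unfolding of_real_eq_iff .
  have "Im (weyl_quot a b n \<zeta> (of_real t)) = Im (- (of_real q' - \<zeta> * of_real q) * cnj ?D) / (norm ?D)\<^sup>2"
    unfolding weyl_quot_def p q by (subst complex_div_cnj) (simp add: Im_divide_of_real)
  also have "Im (- (of_real q' - \<zeta> * of_real q) * cnj ?D) = - Im \<zeta> * (q' * p - q * p')"
    by (simp add: algebra_simps)
  finally show ?thesis using D a_pos[of n] unfolding w p_def[symmetric] p'_def[symmetric] by simp
qed

section \<open>Polynomials and quotients near infinity\<close>

lemma P_growth: "\<exists>R. \<forall>z. R \<le> norm z \<longrightarrow> 1 \<le> norm (P n z) \<and> M * norm (P n z) \<le> norm (P (Suc n) z)"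
proof (induction n arbitrary: M)
  case 0
  have "M \<le> norm (P (Suc 0) z)" if "\<bar>b 0\<bar> + a 0 * M \<le> norm z" for z
  proof -
    have "a 0 * M \<le> norm (z - of_real (b 0))"
      using norm_triangle_ineq2[of z "of_real (b 0)"] that by simp
    then show ?thesis using a_pos[of 0] by (simp add: norm_divide pos_le_divide_eq mult.commute)
  qed
  then show ?case by (intro exI[of _ "\<bar>b 0\<bar> + a 0 * M"]) auto
next
  case (Suc n)
  obtain R where R: "\<And>z. R \<le> norm z \<Longrightarrow> 1 \<le> norm (P n z) \<and> 1 * norm (P n z) \<le> norm (P (Suc n) z)"
    \<comment> \<open>Factor 1 is enough in the induction hypothesis, because the new factor
      \<open>M\<close> comes from the size of z alone.\<close>
    using Suc[of 1] by blast
  have "1 \<le> norm (P (Suc n) z) \<and> M * norm (P (Suc n) z) \<le> norm (P (Suc (Suc n)) z)"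
    if z: "max R (\<bar>b (Suc n)\<bar> + a n + a (Suc n) * M) \<le> norm z" for z
  proof -
    have r: "1 \<le> norm (P n z)" "norm (P n z) \<le> norm (P (Suc n) z)" using R[of z] z by auto
    have "\<bar>b (Suc n)\<bar> + a n + a (Suc n) * M \<le> norm z" using z by simp
    then have "a (Suc n) * M + a n \<le> norm (z - of_real (b (Suc n)))"
      using norm_triangle_ineq2[of z "of_real (b (Suc n))"] by simp
    then have "(a (Suc n) * M + a n) * norm (P (Suc n) z) \<le> norm (z - of_real (b (Suc n))) * norm (P (Suc n) z)"
      by (rule mult_right_mono) simp
    moreover have "a n * norm (P n z) \<le> a n * norm (P (Suc n) z)"
      using r a_pos[of n] by simp
    moreover have "norm (z - of_real (b (Suc n))) * norm (P (Suc n) z) - a n * norm (P n z)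
      \<le> norm ((z - of_real (b (Suc n))) * P (Suc n) z - of_real (a n) * P n z)"
      using norm_triangle_ineq2[of "(z - of_real (b (Suc n))) * P (Suc n) z" "of_real (a n) * P n z"] a_pos[of n]
      by (simp add: norm_mult)
    ultimately have "a (Suc n) * (M * norm (P (Suc n) z)) \<le> norm ((z - of_real (b (Suc n))) * P (Suc n) z - of_real (a n) * P n z)"
      by (simp add: algebra_simps)
    then have "M * norm (P (Suc n) z) \<le> norm (P (Suc (Suc n)) z)"
      using a_pos[of "Suc n"] by (simp add: norm_divide pos_le_divide_eq mult.commute)
    then show ?thesis using r by auto
  qed
  then show ?case by blast
qed

text \<open>By the Wronskian Q / P changes from n to n + 1 by
  \<open>1 / (a n * P n z * P (Suc n) z)\<close>, which is at most \<open>1 / a n\<close> in modulus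
  once both polynomials have modulus at least 1.\<close>

lemma Q_le_P: "\<exists>C\<ge>0. \<exists>R. \<forall>z. R \<le> norm z \<longrightarrow> norm (Q n z) \<le> C * norm (P n z)"
proof (induction n)
  case 0 then show ?case by auto
next
  case (Suc n)
  then obtain C R where C: "C \<ge> 0" and R: "\<And>z. R \<le> norm z \<Longrightarrow> norm (Q n z) \<le> C * norm (P n z)" by blast
  obtain R' where R': "\<And>z. R' \<le> norm z \<Longrightarrow> 1 \<le> norm (P n z) \<and> 1 * norm (P n z) \<le> norm (P (Suc n) z)"
    using P_growth[of n 1] by blast
  have "norm (Q (Suc n) z) \<le> (C + 1 / a n) * norm (P (Suc n) z)" if z: "max R R' \<le> norm z" for z
  proof -
    have r: "1 \<le> norm (P n z)" "1 \<le> norm (P (Suc n) z)" "norm (Q n z) \<le> C * norm (P n z)"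
      using R[of z] R'[of z] z by auto
    have "Q (Suc n) z * P n z = Q n z * P (Suc n) z + of_real (1 / a n)"
      using wronskian[of n z] by (simp add: algebra_simps)
    then have "norm (Q (Suc n) z) * norm (P n z) = norm (Q n z * P (Suc n) z + of_real (1 / a n))"
      by (metis norm_mult)
    also have "\<dots> \<le> norm (Q n z) * norm (P (Suc n) z) + 1 / a n"
      using norm_triangle_ineq[of "Q n z * P (Suc n) z" "of_real (1 / a n)"] a_pos[of n]
      by (simp add: norm_mult norm_divide)
    also have "\<dots> \<le> (C * norm (P n z)) * norm (P (Suc n) z) + 1 / a n * (norm (P n z) * norm (P (Suc n) z))"
    proof (intro add_mono mult_right_mono r)
      have "1 \<le> norm (P n z) * norm (P (Suc n) z)" using mult_mono[OF r(1,2)] by simp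
      then show "1 / a n \<le> 1 / a n * (norm (P n z) * norm (P (Suc n) z))"
        using a_pos[of n] by (simp add: divide_right_mono)
    qed simp
    also have "\<dots> = ((C + 1 / a n) * norm (P (Suc n) z)) * norm (P n z)" by (simp add: algebra_simps)
    finally show ?thesis using r(1) by (auto simp: mult_le_cancel_right)
  qed
  moreover have "0 \<le> C + 1 / a n" using C a_pos[of n] by simp
  ultimately show ?case by blast
qed

lemma weyl_quot_bounded:
  assumes \<zeta>: "Im \<zeta> < 0"
  obtains B where "\<And>w. 0 \<le> Im w \<Longrightarrow> norm (weyl_quot a b n \<zeta> w) \<le> B"
proof -
  obtain C0 R0 where C0: "C0 \<ge> 0" "\<And>z. R0 \<le> norm z \<Longrightarrow> norm (Q n z) \<le> C0 * norm (P n z)"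
    using Q_le_P[of n] by blast
  obtain C1 R1 where C1: "C1 \<ge> 0" "\<And>z. R1 \<le> norm z \<Longrightarrow> norm (Q (Suc n) z) \<le> C1 * norm (P (Suc n) z)"
    using Q_le_P[of "Suc n"] by blast
  \<comment> \<open>With this factor \<open>norm (\<zeta> * P n z)\<close> is at most half of
    \<open>norm (P (Suc n) z)\<close>; the summand 1 keeps \<open>P (Suc n) z\<close> away from
    0.\<close>
  obtain R2 where R2: "\<And>z. R2 \<le> norm z \<Longrightarrow> 1 \<le> norm (P n z) \<and> (2 * norm \<zeta> + 1) * norm (P n z) \<le> norm (P (Suc n) z)"
    using P_growth[of n "2 * norm \<zeta> + 1"] by blast
  define R where "R = max R0 (max R1 R2)"
  have far: "norm (weyl_quot a b n \<zeta> z) \<le> 2 * (C1 + C0)" if z: "R \<le> norm z" for z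
  proof -
    have r0: "R0 \<le> norm z" "R1 \<le> norm z" "R2 \<le> norm z" using z by (auto simp: R_def)
    have "norm (P n z) + 2 * (norm \<zeta> * norm (P n z)) \<le> norm (P (Suc n) z)" "1 \<le> norm (P n z)"
      using R2[OF r0(3)] by (auto simp: algebra_simps)
    then have half: "2 * (norm \<zeta> * norm (P n z)) \<le> norm (P (Suc n) z)" and pos: "0 < norm (P (Suc n) z)"
      using mult_nonneg_nonneg[OF norm_ge_zero[of \<zeta>] norm_ge_zero[of "P n z"]] by linarith+
    have "norm (Q (Suc n) z - \<zeta> * Q n z) \<le> norm (Q (Suc n) z) + norm \<zeta> * norm (Q n z)"
      using norm_triangle_ineq4[of "Q (Suc n) z" "\<zeta> * Q n z"] by (simp add: norm_mult)
    also have "\<dots> \<le> C1 * norm (P (Suc n) z) + norm \<zeta> * (C0 * norm (P n z))"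
      by (intro add_mono mult_left_mono C0 C1 r0) simp
    also have "\<dots> = C1 * norm (P (Suc n) z) + C0 * (norm \<zeta> * norm (P n z))" by simp
    also have "\<dots> \<le> C1 * norm (P (Suc n) z) + C0 * norm (P (Suc n) z)"
    proof -
      have "norm \<zeta> * norm (P n z) \<le> norm (P (Suc n) z)"
        using half mult_nonneg_nonneg[OF norm_ge_zero[of \<zeta>] norm_ge_zero[of "P n z"]] by linarith
      from mult_left_mono[OF this C0(1)] show ?thesis by simp
    qed
    finally have num: "norm (Q (Suc n) z - \<zeta> * Q n z) \<le> (C1 + C0) * norm (P (Suc n) z)"
      by (simp add: algebra_simps)
    have "norm (P (Suc n) z) - norm \<zeta> * norm (P n z) \<le> norm (P (Suc n) z - \<zeta> * P n z)"
      using norm_triangle_ineq2[of "P (Suc n) z" "\<zeta> * P n z"] by (simp add: norm_mult)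
    then have den: "norm (P (Suc n) z) / 2 \<le> norm (P (Suc n) z - \<zeta> * P n z)" using half by linarith
    have "norm (weyl_quot a b n \<zeta> z) = norm (Q (Suc n) z - \<zeta> * Q n z) / norm (P (Suc n) z - \<zeta> * P n z)"
      unfolding weyl_quot_def by (simp add: norm_divide norm_minus_commute)
    also have "\<dots> \<le> ((C1 + C0) * norm (P (Suc n) z)) / (norm (P (Suc n) z) / 2)"
      using num den pos C0 C1 by (intro frac_le) auto
    also have "\<dots> = 2 * (C1 + C0)" using pos by simp
    finally show ?thesis .
  qed
  have "compact (cball 0 R \<inter> {w. 0 \<le> Im w})"
    by (intro compact_Int_closed compact_cball closed_halfspace_Im_ge)
  then have "compact (weyl_quot a b n \<zeta> ` (cball 0 R \<inter> {w. 0 \<le> Im w}))"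
    using holomorphic_on_imp_continuous_on[OF holomorphic_weyl_quot[OF \<zeta>]]
    by (intro compact_continuous_image) (auto intro: continuous_on_subset)
  from compact_imp_bounded[OF this]
  obtain B where "\<forall>w\<in>cball 0 R \<inter> {w. 0 \<le> Im w}. norm (weyl_quot a b n \<zeta> w) \<le> B"
    unfolding bounded_iff by blast
  then have "norm (weyl_quot a b n \<zeta> w) \<le> max B (2 * (C1 + C0))" if "0 \<le> Im w" for w
    using far[of w] that by (cases "norm w \<le> R") (auto simp: le_max_iff_disj)
  then show ?thesis by (rule that)
qed

section \<open>Size and shrinking of the Weyl disks\<close>

lemma weyl_disk_norm_le:
  assumes z: "0 < Im z" and m: "m \<in> weyl_disk a b n z"
  shows "norm m \<le> 1 / Im z"
proof -
  let ?f = "\<lambda>k. (norm (m * P k z + Q k z))\<^sup>2"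
  \<comment> \<open>\<open>P 0 z = 1\<close> and \<open>Q 0 z = 0\<close>, so the term k = 0 alone
    already bounds m.\<close>
  have "(norm m)\<^sup>2 = ?f 0" by simp
  also have "\<dots> \<le> (\<Sum>k\<le>n. ?f k)" by (rule member_le_sum) auto
  finally have "Im z * (norm m)\<^sup>2 \<le> Im z * (\<Sum>k\<le>n. ?f k)" using z by simp
  also have "\<dots> \<le> norm m" using m abs_Im_le_cmod[of m] by (simp add: weyl_disk_def)
  finally have "(Im z * norm m) * norm m \<le> 1 * norm m" by (simp add: power2_eq_square algebra_simps)
  then have "Im z * norm m \<le> 1" by (cases "m = 0") (auto simp: mult_le_cancel_right)
  then show ?thesis using z by (simp add: field_simps)
qed

text \<open>The difference of the two solutions is the multiple m - m' of \<open>P\<close>, and each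
  solution has sum of squares at most \<open>1 / (Im z)\<^sup>2\<close>.\<close>

lemma weyl_disk_diameter:
  assumes z: "0 < Im z" and m: "m \<in> weyl_disk a b n z" "m' \<in> weyl_disk a b n z"
  shows "(norm (m - m'))\<^sup>2 * (\<Sum>k\<le>n. (norm (P k z))\<^sup>2) \<le> 4 / (Im z)\<^sup>2"
proof -
  define u u' where "u k = m * P k z + Q k z" and "u' k = m' * P k z + Q k z" for k
  have bound: "(\<Sum>k\<le>n. (norm (m * P k z + Q k z))\<^sup>2) \<le> 1 / (Im z)\<^sup>2"
    if "m \<in> weyl_disk a b n z" for m
  proof -
    have "Im z * (\<Sum>k\<le>n. (norm (m * P k z + Q k z))\<^sup>2) \<le> Im m" using that by (simp add: weyl_disk_def)
    also have "\<dots> \<le> 1 / Im z" using weyl_disk_norm_le[OF z that] abs_Im_le_cmod[of m] by linarith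
    finally show ?thesis using z by (simp add: field_simps power2_eq_square)
  qed
  have "(norm (m - m'))\<^sup>2 * (\<Sum>k\<le>n. (norm (P k z))\<^sup>2) = (\<Sum>k\<le>n. (norm (u k - u' k))\<^sup>2)"
    by (simp add: u_def u'_def sum_distrib_left power_mult_distrib[symmetric] norm_mult[symmetric] left_diff_distrib)
  also have "\<dots> \<le> (\<Sum>k\<le>n. 2 * (norm (u k))\<^sup>2 + 2 * (norm (u' k))\<^sup>2)"
  proof (rule sum_mono)
    fix k
    have "(norm (u k - u' k))\<^sup>2 \<le> (norm (u k) + norm (u' k))\<^sup>2"
      by (intro power_mono norm_triangle_ineq4) simp
    also have "\<dots> \<le> 2 * (norm (u k))\<^sup>2 + 2 * (norm (u' k))\<^sup>2"
      using zero_le_power2[of "norm (u k) - norm (u' k)"] by (simp add: power2_eq_square algebra_simps)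
    finally show "(norm (u k - u' k))\<^sup>2 \<le> 2 * (norm (u k))\<^sup>2 + 2 * (norm (u' k))\<^sup>2" .
  qed
  also have "\<dots> = 2 * (\<Sum>k\<le>n. (norm (u k))\<^sup>2) + 2 * (\<Sum>k\<le>n. (norm (u' k))\<^sup>2)"
    by (simp add: sum.distrib sum_distrib_left)
  also have "\<dots> \<le> 4 / (Im z)\<^sup>2" using bound[OF m(1)] bound[OF m(2)] by (simp add: u_def u'_def)
  finally show ?thesis .
qed

text \<open>Carleman's argument: since \<open>P 0 z = 1\<close>, the Lagrange identity for
  \<open>P\<close> bounds \<open>Im z / a n\<close> by
  \<open>norm (P (Suc n) z) * norm (P n z)\<close>. Square summability would therefore make
  \<open>1 / a n\<close> summable along \<open>g\<close>.\<close>

lemma P_not_square_summable: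
  assumes z: "0 < Im z" and g: "inj g" and div: "\<not> summable (\<lambda>j. 1 / a (g j))"
  shows "\<not> summable (\<lambda>k. (norm (P k z))\<^sup>2)"
proof
  assume s: "summable (\<lambda>k. (norm (P k z))\<^sup>2)"
  have s1: "summable (\<lambda>j. (norm (P (g j) z))\<^sup>2)"
    using summable_reindex[OF s g] by (simp add: o_def)
  have s2: "summable (\<lambda>j. (norm (P (Suc (g j)) z))\<^sup>2)"
    using summable_reindex[OF s, of "Suc \<circ> g"] g by (simp add: o_def inj_def)
  have lower: "2 * Im z / a n \<le> (norm (P n z))\<^sup>2 + (norm (P (Suc n) z))\<^sup>2" for n
  proof -
    have "1 = (norm (P 0 z))\<^sup>2" by simp
    also have "\<dots> \<le> (\<Sum>k\<le>n. (norm (P k z))\<^sup>2)" by (rule member_le_sum) auto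
    finally have "Im z \<le> Im z * (\<Sum>k\<le>n. (norm (P k z))\<^sup>2)" using z by simp
    also have "\<dots> = a n * Im (P (Suc n) z * cnj (P n z))"
      using lagrange_identity[OF solution_P, of z n] by simp
    also have "\<dots> \<le> a n * (norm (P (Suc n) z) * norm (P n z))"
      using a_pos[of n] abs_Im_le_cmod[of "P (Suc n) z * cnj (P n z)"]
      by (intro mult_left_mono) (auto simp: norm_mult)
    finally have "Im z / a n \<le> norm (P (Suc n) z) * norm (P n z)"
      using a_pos[of n] by (simp add: pos_divide_le_eq mult.commute)
    moreover have "2 * (norm (P (Suc n) z) * norm (P n z)) \<le> (norm (P n z))\<^sup>2 + (norm (P (Suc n) z))\<^sup>2"
      using zero_le_power2[of "norm (P (Suc n) z) - norm (P n z)"]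
      by (simp add: power2_eq_square algebra_simps)
    ultimately have "2 * (Im z / a n) \<le> (norm (P n z))\<^sup>2 + (norm (P (Suc n) z))\<^sup>2" by linarith
    then show ?thesis by simp
  qed
  have "summable (\<lambda>j. 2 * Im z / a (g j))"
    by (rule summable_comparison_test'[OF summable_add[OF s1 s2], of 0])
       (use lower z a_pos in \<open>auto simp: less_imp_le\<close>)
  from summable_mult[OF this, of "1 / (2 * Im z)"] have "summable (\<lambda>j. 1 / a (g j))"
    using z by simp
  with div show False by simp
qed

lemma weyl_disks_shrink:
  assumes z: "0 < Im z" and div: "\<not> summable (\<lambda>k. (norm (P k z))\<^sup>2)"
    and m: "\<And>n. m n \<in> weyl_disk a b n z" and m': "\<And>n. m' \<in> weyl_disk a b n z"
  shows "m \<longlonglongrightarrow> m'"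
proof (rule LIMSEQ_I)
  fix e :: real assume e: "0 < e"
  let ?s = "\<lambda>n. \<Sum>k\<le>n. (norm (P k z))\<^sup>2"
  define B where "B = 4 / (Im z)\<^sup>2 / e\<^sup>2"
  obtain n0 where n0: "B < (\<Sum>k<n0. (norm (P k z))\<^sup>2)"
  proof (rule ccontr)
    assume "\<not> thesis"
    then have "(\<Sum>k<n. (norm (P k z))\<^sup>2) \<le> B" for n using that not_less by blast
    then have "(\<Sum>k\<le>n. (norm (P k z))\<^sup>2) \<le> B" for n by (metis lessThan_Suc_atMost)
    then have "summable (\<lambda>k. (norm (P k z))\<^sup>2)"
      by (intro bounded_imp_summable[of _ B]) auto
    with div show False by simp
  qed
  have "norm (m n - m') < e" if "n0 \<le> n" for n
  proof (rule ccontr)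
    assume "\<not> norm (m n - m') < e"
    then have "e\<^sup>2 \<le> (norm (m n - m'))\<^sup>2" using e by (intro power_mono) auto
    moreover have "B < ?s n"
      using n0 that by (intro less_le_trans[OF n0] sum_mono2) auto
    moreover have "0 \<le> B" using e by (simp add: B_def)
    ultimately have "e\<^sup>2 * B < (norm (m n - m'))\<^sup>2 * ?s n"
      using e by (intro mult_le_less_imp_less) auto
    also have "\<dots> \<le> 4 / (Im z)\<^sup>2" by (rule weyl_disk_diameter[OF z m m'])
    also have "\<dots> = e\<^sup>2 * B" using e by (simp add: B_def)
    finally show False by simp
  qed
  then show "\<exists>n0. \<forall>n\<ge>n0. norm (m n - m') < e" by blast
qed

end

section \<open>Stieltjes transforms and local densities\<close>

definition stieltjes :: "real measure \<Rightarrow> complex \<Rightarrow> complex" where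
  "stieltjes M z = (LINT x|M. 1 / (of_real x - z))"

lemma norm_resolvent_le:
  assumes "0 < Im z"
  shows "norm (1 / (of_real x - z)) \<le> 1 / Im z"
proof -
  have "Im z \<le> norm (of_real x - z)"
    using abs_Im_le_cmod[of "of_real x - z"] assms by simp
  then show ?thesis using assms by (simp add: norm_divide frac_le)
qed

lemma Im_resolvent: "Im (1 / (of_real x - z)) = poisson z x"
  by (simp add: Im_divide poisson_def)

lemma resolvent_square:
  "Im z * ((Re (1 / (of_real x - z)))\<^sup>2 + (Im (1 / (of_real x - z)))\<^sup>2) = poisson z x"
proof -
  have "(Re (1 / (of_real x - z)))\<^sup>2 + (Im (1 / (of_real x - z)))\<^sup>2 = (norm (1 / (of_real x - z)))\<^sup>2"
    by (simp add: cmod_power2)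
  also have "\<dots> = 1 / (norm (of_real x - z))\<^sup>2" by (simp add: norm_divide power_divide)
  finally show ?thesis by (simp add: cmod_power2 poisson_def)
qed

lemma bessel_inequality:
  fixes p :: "nat \<Rightarrow> 'a \<Rightarrow> real"
  assumes ortho: "\<And>m n. integrable M (\<lambda>x. p m x * p n x)"
      "\<And>m n. (LINT x|M. p m x * p n x) = (if m = n then 1 else 0)"
    and g: "\<And>k. integrable M (\<lambda>x. g x * p k x)" "integrable M (\<lambda>x. (g x)\<^sup>2)"
  shows "(\<Sum>k\<le>n. (LINT x|M. g x * p k x)\<^sup>2) \<le> (LINT x|M. (g x)\<^sup>2)"
proof -
  define c where "c k = (LINT x|M. g x * p k x)" for k
  have expand: "(g x - (\<Sum>k\<le>n. c k * p k x))\<^sup>2 = (g x)\<^sup>2 - 2 * (\<Sum>k\<le>n. c k * (g x * p k x))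
      + (\<Sum>k\<le>n. \<Sum>l\<le>n. c k * c l * (p k x * p l x))" for x
    unfolding power2_diff power2_eq_square[of "sum _ _"] sum_product
    by (simp add: sum_distrib_left algebra_simps)
  have "0 \<le> (LINT x|M. (g x - (\<Sum>k\<le>n. c k * p k x))\<^sup>2)" by simp
  also have "\<dots> = (LINT x|M. (g x)\<^sup>2) - 2 * (\<Sum>k\<le>n. c k * c k) + (\<Sum>k\<le>n. \<Sum>l\<le>n. c k * c l * (if k = l then 1 else 0))"
    unfolding expand using ortho(1) g
    by (subst Bochner_Integration.integral_add Bochner_Integration.integral_diff Bochner_Integration.integral_sum
        | simp add: c_def[symmetric] ortho(2) del: mult_eq_0_iff mult_cancel_left mult_cancel_right)+
  also have "\<dots> = (LINT x|M. (g x)\<^sup>2) - (\<Sum>k\<le>n. c k * c k)"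
    by (simp add: sum.delta if_distrib cong: if_cong)
  finally show ?thesis by (simp add: c_def power2_eq_square)
qed

context jacobi
begin

text \<open>The integrals of p_k(x) / (x - z) solve the recurrence with inhomogeneity 1, because x /
  (x - z) = 1 + z / (x - z) and p_k has integral 0 for k > 0. They are the Fourier coefficients of
  the resolvent, and Im z times the squared modulus of the resolvent is its imaginary part; so
  Bessel's inequality is the condition defining the disk.\<close>

lemma stieltjes_in_weyl_disk:
  assumes M: "prob_space M" "sets M = sets borel" and ortho: "orthonormal_in_L2 M (orth_poly a b)"
    and z: "0 < Im z"
  shows "stieltjes M z \<in> weyl_disk a b n z"
    and "Im (stieltjes M z) = (LINT x|M. poisson z x)" and "integrable M (poisson z)"
proof -
  interpret prob_space M by (rule M)
  define p where "p = orth_poly a b"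
  define r where "r x = 1 / (complex_of_real x - z)" for x
  have [measurable_cong]: "sets M = sets borel" by (rule M)
  have r_meas [measurable]: "r \<in> borel_measurable M"
    unfolding r_def by measurable
  have p2: "integrable M (\<lambda>x. p m x * p n x)" "(LINT x|M. p m x * p n x) = (if m = n then 1 else 0)" for m n
    using ortho by (auto simp: orthonormal_in_L2_def p_def)
  have p_int: "integrable M (p n)" and p_LINT: "(LINT x|M. p n x) = (if n = 0 then 1 else 0)" for n
    using p2(1)[of 0 n] p2(2)[of 0 n] by (auto simp: p_def)
  have r_bound: "norm (r x) \<le> 1 / Im z" for x unfolding r_def by (rule norm_resolvent_le[OF z])
  have r_int: "integrable M r"
    by (rule integrable_const_bound[of _ "1 / Im z"]) (use r_bound in auto)
  have rp_int: "integrable M (\<lambda>x. r x * of_real (p k x))" for k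
  proof (rule Bochner_Integration.integrable_bound)
    show "integrable M (\<lambda>x. 1 / Im z * p k x)" by (intro integrable_mult_right p_int)
    show "AE x in M. norm (r x * of_real (p k x)) \<le> norm (1 / Im z * p k x)"
    proof (rule AE_I2)
      fix x
      show "norm (r x * of_real (p k x)) \<le> norm (1 / Im z * p k x)"
        using mult_right_mono[OF r_bound[of x], of "\<bar>p k x\<bar>"] z by (simp add: norm_mult abs_mult)
    qed
    have [measurable]: "p k \<in> borel_measurable M" using p_int[of k] by (rule borel_measurable_integrable)
    show "(\<lambda>x. r x * of_real (p k x)) \<in> borel_measurable M" by measurable
  qed
  define u where "u k = (LINT x|M. r x * of_real (p k x))" for k
  have xz: "complex_of_real x - z \<noteq> 0" for x using z by (auto simp: complex_eq_iff)
  have pint_c: "integrable M (\<lambda>x. complex_of_real (p k x))" for k using p_int by simp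
  have u: "jacobi_solution a b z 1 u"
    unfolding jacobi_solution_def
  proof (intro conjI allI)
    have "of_real (a 0) * u 1 + of_real (b 0) * u 0 = (LINT x|M. of_real (a 0) * (r x * of_real (p 1 x)) + of_real (b 0) * (r x * of_real (p 0 x)))"
      unfolding u_def using rp_int by simp
    also have "\<dots> = (LINT x|M. z * (r x * of_real (p 0 x)) + of_real (p 0 x))"
    proof (rule Bochner_Integration.integral_cong[OF refl])
      fix x
      have "of_real (a 0) * complex_of_real (p 1 x) + of_real (b 0) * of_real (p 0 x) = of_real x"
        using a_pos[of 0] by (simp add: p_def flip: of_real_mult of_real_add)
      then have "r x * (of_real (a 0) * of_real (p 1 x) + of_real (b 0) * of_real (p 0 x)) = r x * ((of_real x - z) + z)" by simp
      also have "\<dots> = 1 + r x * z" unfolding distrib_left using xz[of x] by (simp add: r_def)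
      finally show "of_real (a 0) * (r x * of_real (p 1 x)) + of_real (b 0) * (r x * of_real (p 0 x)) = z * (r x * of_real (p 0 x)) + of_real (p 0 x)"
        by (simp add: p_def algebra_simps)
    qed
    also have "\<dots> = z * u 0 + 1"
      unfolding u_def using rp_int pint_c p_LINT[of 0] by simp
    finally show "of_real (a 0) * u 1 + of_real (b 0) * u 0 = z * u 0 + 1" .
  next
    fix m
    have "of_real (a (Suc m)) * u (Suc (Suc m)) + of_real (b (Suc m)) * u (Suc m) + of_real (a m) * u m
      = (LINT x|M. of_real (a (Suc m)) * (r x * of_real (p (Suc (Suc m)) x)) + of_real (b (Suc m)) * (r x * of_real (p (Suc m) x)) + of_real (a m) * (r x * of_real (p m x)))"
      unfolding u_def using rp_int by simp
    also have "\<dots> = (LINT x|M. z * (r x * of_real (p (Suc m) x)) + of_real (p (Suc m) x))"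
    proof (rule Bochner_Integration.integral_cong[OF refl])
      fix x
      have "a (Suc m) * p (Suc (Suc m)) x + b (Suc m) * p (Suc m) x + a m * p m x = x * p (Suc m) x"
      proof -
        have "a (Suc m) * p (Suc (Suc m)) x = (x - b (Suc m)) * p (Suc m) x - a m * p m x"
          using a_pos[of "Suc m"] by (simp add: p_def)
        then show ?thesis by (simp add: algebra_simps)
      qed
      then have "of_real (a (Suc m)) * complex_of_real (p (Suc (Suc m)) x) + of_real (b (Suc m)) * of_real (p (Suc m) x) + of_real (a m) * of_real (p m x)
        = of_real x * of_real (p (Suc m) x)"
        by (metis of_real_add of_real_mult)
      then have "r x * (of_real (a (Suc m)) * complex_of_real (p (Suc (Suc m)) x) + of_real (b (Suc m)) * of_real (p (Suc m) x) + of_real (a m) * of_real (p m x))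
        = (r x * (of_real x - z)) * of_real (p (Suc m) x) + r x * z * of_real (p (Suc m) x)"
        by (simp add: algebra_simps)
      also have "r x * (of_real x - z) = 1" using xz[of x] by (simp add: r_def)
      finally show "of_real (a (Suc m)) * (r x * of_real (p (Suc (Suc m)) x)) + of_real (b (Suc m)) * (r x * of_real (p (Suc m) x)) + of_real (a m) * (r x * of_real (p m x))
        = z * (r x * of_real (p (Suc m) x)) + of_real (p (Suc m) x)"
        by (simp add: algebra_simps)
    qed
    also have "\<dots> = z * u (Suc m)"
      unfolding u_def using rp_int pint_c p_LINT[of "Suc m"] by simp
    finally show "of_real (a (Suc m)) * u (Suc (Suc m)) + of_real (b (Suc m)) * u (Suc m) + of_real (a m) * u m = z * u (Suc m)" .
  qed
  have u0: "u 0 = stieltjes M z" by (simp add: u_def stieltjes_def p_def r_def)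
  have u_eq: "u k = stieltjes M z * P k z + Q k z" for k
    by (rule solution_unique[OF u solution_affine]) (simp add: u0)
  show "integrable M (poisson z)"
    using integrable_Im[OF r_int] unfolding r_def Im_resolvent .
  show Im_st: "Im (stieltjes M z) = (LINT x|M. poisson z x)"
    using integral_Im[OF r_int] unfolding stieltjes_def r_def Im_resolvent ..
  have bound2: "\<bar>Re (r x)\<bar> \<le> 1 / Im z" "\<bar>Im (r x)\<bar> \<le> 1 / Im z" for x
    using r_bound[of x] abs_Re_le_cmod[of "r x"] abs_Im_le_cmod[of "r x"] by linarith+
  have sq: "integrable M (\<lambda>x. (Re (r x))\<^sup>2)" "integrable M (\<lambda>x. (Im (r x))\<^sup>2)"
    by (rule integrable_const_bound[of _ "(1 / Im z)\<^sup>2"];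
        use bound2 z in \<open>auto intro!: AE_I2 simp: abs_le_square_iff[symmetric] simp del: power_divide power_one_over\<close>)+
  have "(\<Sum>k\<le>n. (norm (u k))\<^sup>2) = (\<Sum>k\<le>n. (LINT x|M. Re (r x) * p k x)\<^sup>2) + (\<Sum>k\<le>n. (LINT x|M. Im (r x) * p k x)\<^sup>2)"
    unfolding cmod_power2 u_def integral_Re[OF rp_int, symmetric] integral_Im[OF rp_int, symmetric]
    by (simp add: sum.distrib)
  also have "\<dots> \<le> (LINT x|M. (Re (r x))\<^sup>2) + (LINT x|M. (Im (r x))\<^sup>2)"
    using integrable_Re[OF rp_int] integrable_Im[OF rp_int]
    by (intro add_mono bessel_inequality p2 sq) auto
  also have "\<dots> = (LINT x|M. (Re (r x))\<^sup>2 + (Im (r x))\<^sup>2)" using sq by simp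
  finally have "Im z * (\<Sum>k\<le>n. (norm (u k))\<^sup>2) \<le> Im z * (LINT x|M. (Re (r x))\<^sup>2 + (Im (r x))\<^sup>2)"
    using z by simp
  also have "\<dots> = (LINT x|M. Im z * ((Re (r x))\<^sup>2 + (Im (r x))\<^sup>2))" by simp
  also have "\<dots> = Im (stieltjes M z)"
    unfolding Im_st r_def resolvent_square ..
  finally show "stieltjes M z \<in> weyl_disk a b n z" by (simp add: weyl_disk_def u_eq)
qed

end

section \<open>Comparison of Poisson integrals\<close>

lemma nn_integral_poisson_lborel:
  assumes z: "0 < Im z"
  shows "(\<integral>\<^sup>+t. ennreal (poisson z t) \<partial>lborel) = ennreal pi"
  using nn_integral_poisson[of "\<lambda>_. \<i>" 1 z] z by simp

text \<open>Outside \<open>S\<close> the kernel at height \<epsilon> is at most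
  \<open>\<epsilon> * (1 + 1 / \<delta>\<^sup>2)\<close> times the kernel at height 1, so distant
  mass enters only through \<open>T\<close>. On \<open>S\<close> the density is compared with
  \<open>G\<close>, and \<open>pi * G\<close> in the error accounts for the part of the Lebesgue
  integral lost outside \<open>S\<close>. The estimate serves \<mu> and its approximations
  alike.\<close>

lemma poisson_local_estimate:
  fixes M :: "real measure" and f :: "real \<Rightarrow> real"
  assumes M: "sets M = sets borel" and \<delta>: "0 < \<delta>" and \<epsilon>: "0 < \<epsilon>" and G: "0 \<le> G" and \<eta>: "0 \<le> \<eta>"
    and S: "S = {x0 - \<delta><..<x0 + \<delta>}"
    and f_meas: "(\<lambda>t. ennreal (f t) * indicator S t) \<in> borel_measurable borel"
    and dens: "\<And>A. A \<in> sets borel \<Longrightarrow> A \<subseteq> S \<Longrightarrow> emeasure M A = (\<integral>\<^sup>+t\<in>A. ennreal (f t) \<partial>lborel)"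
    and near: "\<And>t. t \<in> S \<Longrightarrow> \<bar>f t - G\<bar> \<le> \<eta>"
    and T: "(\<integral>\<^sup>+t. ennreal (poisson (Complex x0 1) t) \<partial>M) \<le> ennreal T" "0 \<le> T"
    and I: "(\<integral>\<^sup>+t. ennreal (poisson (Complex x0 \<epsilon>) t) \<partial>M) = ennreal I" "0 \<le> I"
  shows "\<bar>I - pi * G\<bar> \<le> pi * \<eta> + \<epsilon> * (1 + 1 / \<delta>\<^sup>2) * (T + pi * G)"
proof -
  define p where "p t = poisson (Complex x0 \<epsilon>) t" for t
  define p1 where "p1 t = poisson (Complex x0 1) t" for t
  define c where "c = \<epsilon> * (1 + 1 / \<delta>\<^sup>2)"
  have c0: "0 \<le> c" using \<epsilon> by (simp add: c_def)
  have p_pos: "0 < p t" "0 < p1 t" for t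
    unfolding p_def p1_def using poisson_pos \<epsilon> by auto
  have [measurable]: "p \<in> borel_measurable borel" "p1 \<in> borel_measurable borel"
    unfolding p_def[abs_def] p1_def[abs_def] poisson_def[abs_def] by measurable
  have [measurable]: "S \<in> sets borel" by (simp add: S)
  have [measurable_cong]: "sets M = sets borel" by (rule M)
  have out: "p t \<le> c * p1 t" if "t \<notin> S" for t
  proof -
    have s: "\<delta>\<^sup>2 \<le> (t - x0)\<^sup>2"
      using that \<delta> by (intro abs_le_square_iff[THEN iffD1]) (auto simp: S)
    have pos: "0 < (t - x0)\<^sup>2" using s \<delta> by (meson less_le_trans zero_less_power)
    have "1 + (t - x0)\<^sup>2 \<le> (1 + 1 / \<delta>\<^sup>2) * (t - x0)\<^sup>2"
      using s \<delta> by (simp add: field_simps)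
    moreover have "1 / X \<le> B / (X + 1)" if "1 + X \<le> B * X" "0 < X" for X B :: real
      using that by (simp add: field_simps)
    ultimately have "1 / (t - x0)\<^sup>2 \<le> (1 + 1 / \<delta>\<^sup>2) / ((t - x0)\<^sup>2 + 1)"
      using pos by blast
    moreover have "\<epsilon> / ((t - x0)\<^sup>2 + \<epsilon>\<^sup>2) \<le> \<epsilon> * (1 / (t - x0)\<^sup>2)"
      using pos \<epsilon> by (simp add: frac_le)
    ultimately have "\<epsilon> / ((t - x0)\<^sup>2 + \<epsilon>\<^sup>2) \<le> \<epsilon> * ((1 + 1 / \<delta>\<^sup>2) / ((t - x0)\<^sup>2 + 1))"
      using \<epsilon> by (meson less_imp_le mult_left_mono order_trans)
    then show ?thesis by (simp add: p_def p1_def c_def poisson_def)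
  qed
  have out_int: "(\<integral>\<^sup>+t. ennreal (p t) * indicator (- S) t \<partial>L) \<le> ennreal c * (\<integral>\<^sup>+t. ennreal (p1 t) \<partial>L)"
    if L [measurable_cong]: "sets L = sets borel" for L
  proof -
    have "(\<integral>\<^sup>+t. ennreal (p t) * indicator (- S) t \<partial>L) \<le> (\<integral>\<^sup>+t. ennreal c * ennreal (p1 t) \<partial>L)"
    proof (rule nn_integral_mono)
      fix t
      show "ennreal (p t) * indicator (- S) t \<le> ennreal c * ennreal (p1 t)"
        using out[of t] c0 p_pos(2)[of t]
        by (cases "t \<in> S") (auto simp: ennreal_mult[symmetric] intro!: ennreal_leI)
    qed
    also have "\<dots> = ennreal c * (\<integral>\<^sup>+t. ennreal (p1 t) \<partial>L)"
      by (rule nn_integral_cmult) measurable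
    finally show ?thesis .
  qed
  have split: "(\<integral>\<^sup>+t. ennreal (p t) \<partial>L) = (\<integral>\<^sup>+t. ennreal (p t) * indicator S t \<partial>L) + (\<integral>\<^sup>+t. ennreal (p t) * indicator (- S) t \<partial>L)"
    if L [measurable_cong]: "sets L = sets borel" for L
    by (subst nn_integral_add[symmetric]) (auto intro!: nn_integral_cong simp: indicator_def)
  have inner: "(\<integral>\<^sup>+t. ennreal (p t) * indicator S t \<partial>M) = (\<integral>\<^sup>+t. ennreal (f t) * indicator S t * ennreal (p t) \<partial>lborel)"
  proof -
    \<comment> \<open>The hypothesis \<open>dens\<close> speaks of sets; equality of the restricted
      measures extends it to the kernel as integrand.\<close>
    have "density M (indicator S) = density lborel (\<lambda>t. ennreal (f t) * indicator S t)"
    proof (rule measure_eqI)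
      fix A assume "A \<in> sets (density M (indicator S))"
      then have A [measurable]: "A \<in> sets borel" by (simp add: M)
      have "emeasure (density M (indicator S)) A = (\<integral>\<^sup>+t. indicator (S \<inter> A) t \<partial>M)"
        unfolding indicator_inter_arith by (rule emeasure_density) measurable
      also have "\<dots> = emeasure M (S \<inter> A)" by (rule nn_integral_indicator) measurable
      also have "\<dots> = (\<integral>\<^sup>+t\<in>(S \<inter> A). ennreal (f t) \<partial>lborel)" by (rule dens) auto
      also have "\<dots> = emeasure (density lborel (\<lambda>t. ennreal (f t) * indicator S t)) A"
        using f_meas by (subst emeasure_density) (auto intro!: nn_integral_cong simp: indicator_def)
      finally show "emeasure (density M (indicator S)) A = emeasure (density lborel (\<lambda>t. ennreal (f t) * indicator S t)) A" .
    qed (simp add: M)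
    then have "(\<integral>\<^sup>+t. ennreal (p t) \<partial>density M (indicator S)) = (\<integral>\<^sup>+t. ennreal (p t) \<partial>density lborel (\<lambda>t. ennreal (f t) * indicator S t))"
      by simp
    then show ?thesis
      using f_meas by (simp add: nn_integral_density mult.commute)
  qed
  have "(\<integral>\<^sup>+t. ennreal (p t) * indicator S t \<partial>lborel) \<le> ennreal pi"
  proof -
    have "(\<integral>\<^sup>+t. ennreal (p t) * indicator S t \<partial>lborel) \<le> (\<integral>\<^sup>+t. ennreal (p t) \<partial>lborel)"
      by (intro nn_integral_mono) (auto simp: indicator_def)
    then show ?thesis using nn_integral_poisson_lborel[of "Complex x0 \<epsilon>"] \<epsilon> by (simp add: p_def)
  qed
  then obtain s where s: "0 \<le> s" "s \<le> pi" "(\<integral>\<^sup>+t. ennreal (p t) * indicator S t \<partial>lborel) = ennreal s"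
    by (cases "\<integral>\<^sup>+t. ennreal (p t) * indicator S t \<partial>lborel") (auto simp: ennreal_le_iff top_unique)
  have s_lower: "pi \<le> s + c * pi"
  proof -
    have "ennreal pi = ennreal s + (\<integral>\<^sup>+t. ennreal (p t) * indicator (- S) t \<partial>lborel)"
      using split[of lborel] nn_integral_poisson_lborel[of "Complex x0 \<epsilon>"] \<epsilon> s(3) by (simp add: p_def)
    also have "\<dots> \<le> ennreal s + ennreal c * ennreal pi"
      using out_int[of lborel] nn_integral_poisson_lborel[of "Complex x0 1"]
      by (intro add_left_mono) (simp add: p1_def)
    also have "\<dots> = ennreal (s + c * pi)" using s c0 by (simp add: ennreal_mult)
    finally show ?thesis
      using s c0 by (subst (asm) ennreal_le_iff) auto
  qed
  have upper: "I \<le> (G + \<eta>) * s + c * T"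
  proof -
    have "ennreal I = (\<integral>\<^sup>+t. ennreal (p t) * indicator S t \<partial>M) + (\<integral>\<^sup>+t. ennreal (p t) * indicator (- S) t \<partial>M)"
      using split[OF M] I by (simp add: p_def)
    also have "\<dots> \<le> (\<integral>\<^sup>+t. ennreal (G + \<eta>) * (ennreal (p t) * indicator S t) \<partial>lborel) + ennreal c * ennreal T"
    proof (rule add_mono)
      show "(\<integral>\<^sup>+t. ennreal (p t) * indicator S t \<partial>M) \<le> (\<integral>\<^sup>+t. ennreal (G + \<eta>) * (ennreal (p t) * indicator S t) \<partial>lborel)"
        unfolding inner
      proof (rule nn_integral_mono)
        fix t
        show "ennreal (f t) * indicator S t * ennreal (p t) \<le> ennreal (G + \<eta>) * (ennreal (p t) * indicator S t)"
          using near[of t] by (cases "t \<in> S") (auto intro!: mult_right_mono ennreal_leI)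
      qed
      show "(\<integral>\<^sup>+t. ennreal (p t) * indicator (- S) t \<partial>M) \<le> ennreal c * ennreal T"
        using order_trans[OF out_int[OF M] mult_left_mono[OF T(1)[folded p1_def], of "ennreal c"]] by simp
    qed
    also have "(\<integral>\<^sup>+t. ennreal (G + \<eta>) * (ennreal (p t) * indicator S t) \<partial>lborel) = ennreal (G + \<eta>) * ennreal s"
      using s(3) by (subst nn_integral_cmult) auto
    also have "ennreal (G + \<eta>) * ennreal s + ennreal c * ennreal T = ennreal ((G + \<eta>) * s + c * T)"
      using G \<eta> s(1) c0 T(2) by (simp add: ennreal_mult[symmetric] ennreal_plus[symmetric] del: ennreal_plus)
    finally show ?thesis
      using G \<eta> s(1) c0 T(2) by (subst (asm) ennreal_le_iff) auto
  qed
  \<comment> \<open>\<open>ennreal\<close> cuts off negative numbers, so G - \<eta> has to be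
    nonnegative here. If it is not, the bound \<open>lo\<close> below is trivial.\<close>
  have lower: "(G - \<eta>) * s \<le> I" if "\<eta> \<le> G"
  proof -
    have "ennreal ((G - \<eta>) * s) = (\<integral>\<^sup>+t. ennreal (G - \<eta>) * (ennreal (p t) * indicator S t) \<partial>lborel)"
      using s that by (subst nn_integral_cmult) (auto simp: ennreal_mult)
    also have "\<dots> \<le> (\<integral>\<^sup>+t. ennreal (p t) * indicator S t \<partial>M)"
      unfolding inner
    proof (rule nn_integral_mono)
      fix t
      show "ennreal (G - \<eta>) * (ennreal (p t) * indicator S t) \<le> ennreal (f t) * indicator S t * ennreal (p t)"
        using near[of t] by (cases "t \<in> S") (auto intro!: mult_right_mono ennreal_leI)
    qed
    also have "\<dots> \<le> ennreal I"
      unfolding I(1)[symmetric] by (intro nn_integral_mono) (auto simp: p_def indicator_def)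
    finally show ?thesis using I by (simp add: ennreal_le_iff)
  qed
  have up: "I - pi * G \<le> pi * \<eta> + c * T"
  proof -
    have "(G + \<eta>) * s \<le> (G + \<eta>) * pi" using G \<eta> s by (intro mult_left_mono) auto
    with upper show ?thesis by (simp add: algebra_simps)
  qed
  have lo: "pi * G - I \<le> pi * \<eta> + c * (pi * G)"
  proof (cases "\<eta> \<le> G")
    case True
    have "(G - \<eta>) * (pi - c * pi) \<le> (G - \<eta>) * s" using True s_lower by (intro mult_left_mono) auto
    with lower[OF True] have "(G - \<eta>) * (pi - c * pi) \<le> I" by linarith
    moreover have "0 \<le> \<eta> * (c * pi)" using \<eta> c0 by simp
    ultimately show ?thesis by (simp add: algebra_simps)
  next
    case False
    then have "pi * G \<le> pi * \<eta>" by simp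
    moreover have "0 \<le> c * (pi * G)" using c0 G by simp
    ultimately show ?thesis using I(2) by linarith
  qed
  have "0 \<le> c * T" "0 \<le> c * (pi * G)" using c0 T G by auto
  with up lo show ?thesis unfolding c_def[symmetric] by (simp add: distrib_left abs_le_iff)
qed

section \<open>Identification of the density\<close>

text \<open>\<zeta> is the root in the lower half-plane of the form, read as a quadratic in
  \<open>u$2 / u$1\<close>; equivalently, a fixed point of the Moebius action of \<open>Z\<close> on
  this quotient. The roots are conjugate, so on real vectors the form is a multiple of a squared
  modulus.\<close>

lemma complex_root_form:
  fixes Z :: "real^2^2" and u :: "real^2"
  assumes neg: "discr Z < 0"
  defines "\<zeta> \<equiv> Complex ((Z$2$2 - Z$1$1) / (2 * Z$1$2)) (- sqrt (- discr Z) / (2 * \<bar>Z$1$2\<bar>))"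
  shows "Im \<zeta> < 0"
    and "\<bar>wedge u (Z *v u)\<bar> = \<bar>Z$1$2\<bar> * (norm (of_real (u$2) - \<zeta> * of_real (u$1)))\<^sup>2"
    and "Z$1$2 \<noteq> 0"
proof -
  define A B C D where "A = Z$1$1" and "B = Z$1$2" and "C = Z$2$1" and "D = Z$2$2"
  have dis: "discr Z = (D - A)\<^sup>2 + 4 * B * C"
    by (simp add: discr_alt A_def B_def C_def D_def)
  show B0: "Z$1$2 \<noteq> 0"
    using neg dis unfolding B_def[symmetric] by auto
  then show "Im \<zeta> < 0" using neg by (simp add: \<zeta>_def)
  have BB: "B \<noteq> 0" using B0 by (simp add: B_def)
  define r s where "r = (D - A) / (2 * B)" and "s = sqrt (- discr Z) / (2 * \<bar>B\<bar>)"
  have s2: "B * (r\<^sup>2 + s\<^sup>2) = - C"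
  proof -
    have "s\<^sup>2 = - discr Z / (4 * B\<^sup>2)" using neg by (simp add: s_def power_divide power_mult_distrib)
    moreover have "r\<^sup>2 = (D - A)\<^sup>2 / (4 * B\<^sup>2)"
      unfolding r_def power_divide power_mult_distrib by simp
    ultimately have "r\<^sup>2 + s\<^sup>2 = ((D - A)\<^sup>2 - discr Z) / (4 * B\<^sup>2)"
      by (simp add: diff_divide_distrib)
    also have "\<dots> = - C / B" unfolding dis using BB by (simp add: power2_eq_square field_simps)
    finally show ?thesis using BB by simp
  qed
  have r: "2 * B * r = D - A" using BB by (simp add: r_def)
  have "(norm (of_real (u$2) - \<zeta> * of_real (u$1)))\<^sup>2 = (u$2 - r * u$1)\<^sup>2 + (s * u$1)\<^sup>2"
    by (simp add: cmod_power2 \<zeta>_def A_def B_def D_def r_def s_def)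
  also have "B * \<dots> = B * (u$2)\<^sup>2 - (2 * B * r) * (u$1 * u$2) + (B * (r\<^sup>2 + s\<^sup>2)) * (u$1)\<^sup>2"
    by (simp add: power2_eq_square algebra_simps)
  also have "\<dots> = B * (u$2)\<^sup>2 - (D - A) * (u$1 * u$2) + - C * (u$1)\<^sup>2"
    unfolding r s2 ..
  also have "\<dots> = - wedge u (Z *v u)"
    unfolding wedge_form A_def B_def C_def D_def by (simp add: algebra_simps)
  finally show "\<bar>wedge u (Z *v u)\<bar> = \<bar>Z$1$2\<bar> * (norm (of_real (u$2) - \<zeta> * of_real (u$1)))\<^sup>2"
    unfolding B_def by (metis abs_minus_cancel abs_mult abs_power2 power2_abs)
qed

text \<open>The shift by one in \<open>v_orth\<close> avoids the index \<open>-1\<close> that occurs in \<open>v 0\<close> when \<open>i = 0\<close>.\<close>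

locale elliptic_jacobi = jacobi a b + elliptic_products "{l..u}" Y v \<alpha> d Z M
  for a b :: "nat \<Rightarrow> real" and l u :: real and Y v \<alpha> d Z M +
  fixes m :: "nat \<Rightarrow> nat"
  assumes l_less_u: "l < u"
    and m_mono: "strict_mono m"
    and v_orth: "\<And>j x. v (Suc j) x $ 1 = orth_poly a b (m j) x"
      "\<And>j x. v (Suc j) x $ 2 = orth_poly a b (Suc (m j)) x"
    and \<alpha>_m: "\<And>j. \<alpha> (Suc j) = a (m j)"
    and not_summable: "\<not> summable (\<lambda>j. 1 / \<alpha> j)"
begin

lemma density_approximation:
  assumes x0: "x0 \<in> {l..u}" and \<eta>: "0 < \<eta>"
  shows "\<exists>\<zeta>. Im \<zeta> < 0 \<and> (\<exists>\<delta>>0. \<exists>J. \<forall>j\<ge>J. \<forall>t\<in>{l..u}. \<bar>t - x0\<bar> < \<delta> \<longrightarrow>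
    \<bar>Im (weyl_quot a b (m j) \<zeta> (of_real t)) - sqrt (- discr (Z x0)) / (2 * \<bar>amp x0\<bar>)\<bar> \<le> \<eta>)"
proof -
  have neg: "discr (Z x0) < 0" by (rule Z_elliptic[OF x0])
  define \<zeta> where "\<zeta> = Complex ((Z x0$2$2 - Z x0$1$1) / (2 * Z x0$1$2)) (- sqrt (- discr (Z x0)) / (2 * \<bar>Z x0$1$2\<bar>))"
  note root = complex_root_form[OF neg, folded \<zeta>_def]
  define \<kappa> where "\<kappa> = sqrt (- discr (Z x0)) / 2"
  have quot: "Im (weyl_quot a b (m j) \<zeta> (of_real t)) = \<kappa> / \<bar>\<alpha> (Suc j) * wedge (v (Suc j) t) (Z x0 *v v (Suc j) t)\<bar>" for j t
  proof -
    let ?N = "(norm (of_real (v (Suc j) t $ 2) - \<zeta> * of_real (v (Suc j) t $ 1)))\<^sup>2"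
    have "Im (weyl_quot a b (m j) \<zeta> (of_real t)) = - Im \<zeta> / (\<alpha> (Suc j) * ?N)"
      using Im_weyl_quot_real[OF root(1), of "m j" t] by (simp add: v_orth \<alpha>_m)
    also have "- Im \<zeta> = \<kappa> / \<bar>Z x0$1$2\<bar>" by (simp add: \<zeta>_def \<kappa>_def)
    also have "\<kappa> / \<bar>Z x0$1$2\<bar> / (\<alpha> (Suc j) * ?N) = \<kappa> / (\<alpha> (Suc j) * (\<bar>Z x0$1$2\<bar> * ?N))" by simp
    also have "\<bar>Z x0$1$2\<bar> * ?N = \<bar>wedge (v (Suc j) t) (Z x0 *v v (Suc j) t)\<bar>" by (rule root(2)[symmetric])
    finally show ?thesis using \<alpha>_pos[of "Suc j"] by (simp add: abs_mult)
  qed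
  have "isCont (\<lambda>y. \<kappa> / \<bar>y\<bar>) (amp x0)"
    using amp_nonzero[OF x0] by (intro continuous_intros) auto
  then obtain \<eta>' where \<eta>': "\<eta>' > 0" "\<And>y. \<bar>y - amp x0\<bar> < \<eta>' \<Longrightarrow> \<bar>\<kappa> / \<bar>y\<bar> - \<kappa> / \<bar>amp x0\<bar>\<bar> < \<eta>"
    using \<eta> unfolding continuous_at_eps_delta dist_real_def by blast
  obtain \<delta> J where \<delta>: "\<delta> > 0" and J: "\<forall>j\<ge>J. \<forall>t\<in>{l..u}. \<bar>t - x0\<bar> < \<delta> \<longrightarrow>
      \<bar>\<alpha> j * wedge (v j t) (Z x0 *v v j t) - amp x0\<bar> \<le> \<eta>' / 2"
    using frozen_form_limit[OF x0, of "\<eta>' / 2"] \<eta>'(1) by auto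
  have "\<bar>Im (weyl_quot a b (m j) \<zeta> (of_real t)) - sqrt (- discr (Z x0)) / (2 * \<bar>amp x0\<bar>)\<bar> \<le> \<eta>"
    if "J \<le> j" "t \<in> {l..u}" "\<bar>t - x0\<bar> < \<delta>" for j t
  proof -
    have "\<bar>\<alpha> (Suc j) * wedge (v (Suc j) t) (Z x0 *v v (Suc j) t) - amp x0\<bar> \<le> \<eta>' / 2"
      using J that by (meson le_SucI)
    then have "\<bar>\<alpha> (Suc j) * wedge (v (Suc j) t) (Z x0 *v v (Suc j) t) - amp x0\<bar> < \<eta>'"
      using \<eta>'(1) by linarith
    from \<eta>'(2)[OF this] show ?thesis unfolding quot by (simp add: \<kappa>_def)
  qed
  then show ?thesis using root(1) \<delta> by blast
qed

lemma weyl_quot_tendsto_stieltjes: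
  assumes "prob_space \<mu>" "sets \<mu> = sets borel" "orthonormal_in_L2 \<mu> (orth_poly a b)"
    and z: "0 < Im z" and \<zeta>: "Im \<zeta> < 0"
  shows "(\<lambda>j. weyl_quot a b (m j) \<zeta> z) \<longlonglongrightarrow> stieltjes \<mu> z"
proof -
  have "\<not> summable (\<lambda>j. 1 / a (m j))"
    using not_summable summable_Suc_iff[of "\<lambda>j. 1 / \<alpha> j"] by (simp add: \<alpha>_m)
  then have "\<not> summable (\<lambda>k. (norm (orth_polyc a b k z))\<^sup>2)"
    by (intro P_not_square_summable[OF z strict_mono_imp_inj_on[OF m_mono]])
  then have "(\<lambda>n. weyl_quot a b n \<zeta> z) \<longlonglongrightarrow> stieltjes \<mu> z"
    using z \<zeta> assms(1-3)
    by (intro weyl_disks_shrink[OF z] weyl_quot_in_disk stieltjes_in_weyl_disk) auto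
  then show ?thesis
    using LIMSEQ_subseq_LIMSEQ[OF _ m_mono] by (simp add: o_def)
qed

text \<open>The order of the limits matters. For fixed \<eta> and \<epsilon> the bounds hold for all
  large j, so j goes to infinity first, with the transforms evaluated at the single point
  \<open>Complex x0 \<epsilon>\<close>; then \<epsilon> and finally \<eta> tend to 0. An interior x0
  leaves room for an interval \<open>S\<close> inside \<open>K\<close>.\<close>

lemma density_interior:
  assumes \<mu>: "prob_space \<mu>" "sets \<mu> = sets borel" "orthonormal_in_L2 \<mu> (orth_poly a b)"
    and w: "continuous_positive_density_on \<mu> {l..u} w"
    and x0: "l < x0" "x0 < u"
  shows "pi * w x0 = sqrt (- discr (Z x0)) / (2 * \<bar>amp x0\<bar>)"
proof -
  have x0K: "x0 \<in> {l..u}" using x0 by simp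
  have w_cont: "continuous_on {l..u} w" and w_pos: "\<And>x. x \<in> {l..u} \<Longrightarrow> 0 < w x"
    and w_dens: "\<And>A. A \<in> sets borel \<Longrightarrow> A \<subseteq> {l..u} \<Longrightarrow> emeasure \<mu> A = (\<integral>\<^sup>+x\<in>A. ennreal (w x) \<partial>lborel)"
    using w by (auto simp: continuous_positive_density_on_def)
  interpret prob_space \<mu> by (rule \<mu>)
  define G where "G = sqrt (- discr (Z x0)) / (2 * \<bar>amp x0\<bar>)"
  have G0: "0 \<le> G" using Z_elliptic[OF x0K] by (simp add: G_def)
  have w0: "0 \<le> w x0" using w_pos[OF x0K] by simp
  have st_bound: "\<bar>Im (stieltjes \<mu> z)\<bar> \<le> 1 / Im z" if "0 < Im z" for z
    using weyl_disk_norm_le[OF that stieltjes_in_weyl_disk(1)[OF \<mu> that]] abs_Im_le_cmod order_trans by blast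
  have nn_\<mu>: "(\<integral>\<^sup>+t. ennreal (poisson z t) \<partial>\<mu>) = ennreal (Im (stieltjes \<mu> z))" if z: "0 < Im z" for z
    using stieltjes_in_weyl_disk(2,3)[OF \<mu> z] poisson_pos[OF z]
    by (subst nn_integral_eq_integral) (auto simp: less_imp_le)
  have st_nonneg: "0 \<le> Im (stieltjes \<mu> z)" if z: "0 < Im z" for z
    unfolding stieltjes_in_weyl_disk(2)[OF \<mu> z] using poisson_pos[OF z]
    by (intro Bochner_Integration.integral_nonneg) (auto simp: less_imp_le)
  \<comment> \<open>\<open>pi * \<eta>\<close> stems from \<mu>, and \<eta> from the approximations,
    whose estimate is divided by pi. The constant \<open>c\<close> may depend on \<eta> but not on
    \<epsilon>.\<close>
  have key: "\<exists>c\<ge>0. \<forall>\<epsilon>>0. \<bar>pi * w x0 - G\<bar> \<le> (pi + 1) * \<eta> + \<epsilon> * c" if \<eta>: "0 < \<eta>" for \<eta>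
  proof -
    obtain \<zeta> \<delta>1 J where \<zeta>: "Im \<zeta> < 0" and \<delta>1: "\<delta>1 > 0" and J: "\<And>j t. J \<le> j \<Longrightarrow> t \<in> {l..u} \<Longrightarrow> \<bar>t - x0\<bar> < \<delta>1 \<Longrightarrow>
      \<bar>Im (weyl_quot a b (m j) \<zeta> (of_real t)) - G\<bar> \<le> \<eta>"
      using density_approximation[OF x0K \<eta>] unfolding G_def by blast
    obtain \<delta>2 where \<delta>2: "\<delta>2 > 0" "\<And>t. t \<in> {l..u} \<Longrightarrow> \<bar>t - x0\<bar> < \<delta>2 \<Longrightarrow> \<bar>w t - w x0\<bar> < \<eta>"
      using w_cont x0K \<eta> unfolding continuous_on_iff dist_real_def by meson
    define \<delta> where "\<delta> = min (min \<delta>1 \<delta>2) (min (x0 - l) (u - x0))"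
    have \<delta>: "0 < \<delta>" using \<delta>1 \<delta>2 x0 by (simp add: \<delta>_def)
    define S where "S = {x0 - \<delta><..<x0 + \<delta>}"
    have S: "t \<in> {l..u} \<and> \<bar>t - x0\<bar> < \<delta>1 \<and> \<bar>t - x0\<bar> < \<delta>2" if "t \<in> S" for t
      using that by (auto simp: S_def \<delta>_def abs_less_iff)
    have SK: "S \<subseteq> {l..u}" using S by blast
    have S_borel [measurable]: "S \<in> sets borel" by (simp add: S_def)
    define c where "c = (1 + 1 / \<delta>\<^sup>2) * (1 + pi * w x0) + (1 + 1 / \<delta>\<^sup>2) * (1 + G)"
    have "\<bar>pi * w x0 - G\<bar> \<le> (pi + 1) * \<eta> + \<epsilon> * c" if \<epsilon>: "0 < \<epsilon>" for \<epsilon>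
    proof -
      define z where "z = Complex x0 \<epsilon>"
      have z: "0 < Im z" using \<epsilon> by (simp add: z_def)
      have 1: "\<bar>Im (stieltjes \<mu> z) - pi * w x0\<bar> \<le> pi * \<eta> + \<epsilon> * (1 + 1 / \<delta>\<^sup>2) * (1 + pi * w x0)"
      proof (rule poisson_local_estimate[OF \<mu>(2) \<delta> \<epsilon> w0 less_imp_le[OF \<eta>] S_def])
        have "(\<lambda>t. indicator S t *\<^sub>R w t) \<in> borel_measurable borel"
          by (rule borel_measurable_continuous_on_indicator[OF S_borel continuous_on_subset[OF w_cont SK]])
        then have "(\<lambda>t. ennreal (indicator S t *\<^sub>R w t)) \<in> borel_measurable borel" by measurable
        also have "(\<lambda>t. ennreal (indicator S t *\<^sub>R w t)) = (\<lambda>t. ennreal (w t) * indicator S t)"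
          by (auto simp: fun_eq_iff indicator_def)
        finally show "(\<lambda>t. ennreal (w t) * indicator S t) \<in> borel_measurable borel" .
        show "emeasure \<mu> A = (\<integral>\<^sup>+t\<in>A. ennreal (w t) \<partial>lborel)" if "A \<in> sets borel" "A \<subseteq> S" for A
          using w_dens that SK by blast
        show "\<bar>w t - w x0\<bar> \<le> \<eta>" if "t \<in> S" for t using \<delta>2(2) S[OF that] by (simp add: less_imp_le)
        show "(\<integral>\<^sup>+t. ennreal (poisson (Complex x0 1) t) \<partial>\<mu>) \<le> ennreal 1"
          using nn_\<mu>[of "Complex x0 1"] st_bound[of "Complex x0 1"] by (simp add: ennreal_leI del: ennreal_1)
        show "(\<integral>\<^sup>+t. ennreal (poisson (Complex x0 \<epsilon>) t) \<partial>\<mu>) = ennreal (Im (stieltjes \<mu> z))"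
          using nn_\<mu>[OF z] by (simp add: z_def)
        show "0 \<le> Im (stieltjes \<mu> z)" by (rule st_nonneg[OF z])
      qed simp
      have 2: "\<bar>pi * Im (weyl_quot a b (m j) \<zeta> z) - pi * G\<bar> \<le> pi * \<eta> + \<epsilon> * (1 + 1 / \<delta>\<^sup>2) * (pi + pi * G)" if j: "J \<le> j" for j
      proof -
        let ?F = "weyl_quot a b (m j) \<zeta>"
        obtain B where B: "\<And>w. 0 \<le> Im w \<Longrightarrow> norm (?F w) \<le> B"
          using weyl_quot_bounded[OF \<zeta>] by blast
        note hol = holomorphic_weyl_quot[OF \<zeta>, of "m j"]
        have nonneg: "0 \<le> Im (?F (of_real t))" for t
          unfolding Im_weyl_quot_real[OF \<zeta>] using \<zeta> a_pos[of "m j"] by (intro divide_nonneg_nonneg) auto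
        have F_cont: "continuous_on UNIV (\<lambda>t. ?F (of_real t))"
          using continuous_on_compose2[OF holomorphic_on_imp_continuous_on[OF hol], of UNIV of_real]
          by (auto simp: image_subset_iff intro: continuous_intros)
        then have F_meas [measurable]: "(\<lambda>t. Im (?F (of_real t))) \<in> borel_measurable borel"
          by (intro borel_measurable_continuous_onI continuous_on_Im)
        \<comment> \<open>This is pi times the approximating measure of the overview; accordingly
          \<open>T\<close> is pi here and 1 for \<mu>.\<close>
        define L where "L = density lborel (\<lambda>t. ennreal (Im (?F (of_real t))))"
        have F_upper: "0 \<le> Im (?F w)" "Im w * norm (?F w) \<le> 1" if "0 < Im w" for w
        proof -
          have mem: "?F w \<in> weyl_disk a b (m j) w" using that \<zeta> by (intro weyl_quot_in_disk) auto
          show "Im w * norm (?F w) \<le> 1" using weyl_disk_norm_le[OF that mem] that by (simp add: field_simps)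
          have "0 \<le> Im w * (\<Sum>k\<le>m j. (norm (?F w * orth_polyc a b k w + second_polyc a b k w))\<^sup>2)"
            using that by (intro mult_nonneg_nonneg sum_nonneg) auto
          also have "\<dots> \<le> Im (?F w)" using mem by (simp add: weyl_disk_def)
          finally show "0 \<le> Im (?F w)" .
        qed
        have nn_L: "(\<integral>\<^sup>+t. ennreal (poisson w t) \<partial>L) = ennreal (pi * Im (?F w))" if w: "0 < Im w" for w
        proof -
          have [measurable]: "poisson w \<in> borel_measurable borel"
            unfolding poisson_def[abs_def] by measurable
          have "(\<integral>\<^sup>+t. ennreal (poisson w t) \<partial>L) = (\<integral>\<^sup>+t. ennreal (poisson w t * Im (?F (of_real t))) \<partial>lborel)"
            unfolding L_def using poisson_pos[OF w] nonneg
            by (subst nn_integral_density) (auto intro!: nn_integral_cong simp: ennreal_mult less_imp_le mult.commute)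
          also have "\<dots> = ennreal (pi * Im (?F w))" by (rule nn_integral_poisson[OF hol B w nonneg])
          finally show ?thesis .
        qed
        show ?thesis
        proof (rule poisson_local_estimate[OF _ \<delta> \<epsilon> G0 less_imp_le[OF \<eta>] S_def])
          show "sets L = sets borel" by (simp add: L_def)
          show "(\<lambda>t. ennreal (Im (?F (of_real t))) * indicator S t) \<in> borel_measurable borel" by measurable
          show "emeasure L A = (\<integral>\<^sup>+t\<in>A. ennreal (Im (?F (of_real t))) \<partial>lborel)" if "A \<in> sets borel" for A
            unfolding L_def using that by (intro emeasure_density) auto
          show "\<bar>Im (?F (of_real t)) - G\<bar> \<le> \<eta>" if "t \<in> S" for t using J[OF j] S[OF that] by blast
          have "Im (?F (Complex x0 1)) \<le> 1"
            using F_upper(2)[of "Complex x0 1"] abs_Im_le_cmod[of "?F (Complex x0 1)"] by simp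
          then show "(\<integral>\<^sup>+t. ennreal (poisson (Complex x0 1) t) \<partial>L) \<le> ennreal pi"
            using nn_L[of "Complex x0 1"] by (simp add: ennreal_leI)
          show "(\<integral>\<^sup>+t. ennreal (poisson (Complex x0 \<epsilon>) t) \<partial>L) = ennreal (pi * Im (?F z))"
            using nn_L[OF z] by (simp add: z_def)
          show "0 \<le> pi * Im (?F z)" using F_upper(1)[OF z] by simp
        qed simp
      qed
      have "(\<lambda>j. \<bar>pi * Im (weyl_quot a b (m j) \<zeta> z) - pi * G\<bar>) \<longlonglongrightarrow> \<bar>pi * Im (stieltjes \<mu> z) - pi * G\<bar>"
        by (intro tendsto_intros weyl_quot_tendsto_stieltjes \<mu> z \<zeta>)
      then have "\<bar>pi * Im (stieltjes \<mu> z) - pi * G\<bar> \<le> pi * \<eta> + \<epsilon> * (1 + 1 / \<delta>\<^sup>2) * (pi + pi * G)"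
        by (rule LIMSEQ_le_const2) (use 2 in blast)
      moreover have "\<bar>pi * Im (stieltjes \<mu> z) - pi * G\<bar> = pi * \<bar>Im (stieltjes \<mu> z) - G\<bar>"
        unfolding right_diff_distrib[symmetric] abs_mult by simp
      ultimately have "pi * \<bar>Im (stieltjes \<mu> z) - G\<bar> \<le> pi * (\<eta> + \<epsilon> * (1 + 1 / \<delta>\<^sup>2) * (1 + G))"
        by (simp add: algebra_simps)
      then have 3: "\<bar>Im (stieltjes \<mu> z) - G\<bar> \<le> \<eta> + \<epsilon> * (1 + 1 / \<delta>\<^sup>2) * (1 + G)" by simp
      have "\<epsilon> * (1 + 1 / \<delta>\<^sup>2) * (1 + pi * w x0) + \<epsilon> * (1 + 1 / \<delta>\<^sup>2) * (1 + G) = \<epsilon> * c"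
        by (simp add: c_def algebra_simps)
      moreover have "\<bar>pi * w x0 - G\<bar> \<le> \<bar>Im (stieltjes \<mu> z) - pi * w x0\<bar> + \<bar>Im (stieltjes \<mu> z) - G\<bar>" by linarith
      ultimately show ?thesis using 1 3 by (simp add: distrib_right)
    qed
    moreover have "0 \<le> c" using w0 G0 by (simp add: c_def)
    ultimately show ?thesis by blast
  qed
  have "\<bar>pi * w x0 - G\<bar> \<le> 0 + e" if e: "0 < e" for e
  proof -
    define \<eta> where "\<eta> = e / (2 * (pi + 1))"
    have \<eta>: "0 < \<eta>" using e by (simp add: \<eta>_def add_pos_pos)
    obtain c where c: "c \<ge> 0" "\<And>\<epsilon>. \<epsilon> > 0 \<Longrightarrow> \<bar>pi * w x0 - G\<bar> \<le> (pi + 1) * \<eta> + \<epsilon> * c"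
      using key[OF \<eta>] by blast
    have "pi + 1 > 0" by (simp add: add_pos_pos)
    then have "(pi + 1) * \<eta> = e / 2" by (simp add: \<eta>_def field_simps)
    moreover have "e / (2 * (c + 1)) * c \<le> e / 2"
      using c(1) e by (simp add: field_simps)
    moreover have "\<bar>pi * w x0 - G\<bar> \<le> (pi + 1) * \<eta> + e / (2 * (c + 1)) * c"
      using c(1) e by (intro c(2)) simp
    ultimately show ?thesis by linarith
  qed
  then have "\<bar>pi * w x0 - G\<bar> \<le> 0" by (rule field_le_epsilon)
  then show ?thesis by (simp add: G_def)
qed

text \<open>At the end points no interval \<open>S\<close> around x fits into \<open>K\<close>;
  there the identity follows by continuity of both sides.\<close>

theorem density_formula:
  assumes \<mu>: "prob_space \<mu>" "sets \<mu> = sets borel" "orthonormal_in_L2 \<mu> (orth_poly a b)"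
    and w: "continuous_positive_density_on \<mu> {l..u} w"
    and x: "x \<in> {l..u}"
  shows "pi * w x = sqrt (- discr (Z x)) / (2 * \<bar>amp x\<bar>)"
proof -
  have cl: "closure {l<..<u} = {l..u}" using l_less_u by simp
  have "continuous_on (closure {l<..<u}) (\<lambda>x. pi * w x - sqrt (- discr (Z x)) / (2 * \<bar>amp x\<bar>))"
    unfolding cl using w amp_nonzero
    by (intro continuous_intros continuous_on_discr cont_Z cont_amp)
       (auto simp: continuous_positive_density_on_def)
  then have "pi * w x - sqrt (- discr (Z x)) / (2 * \<bar>amp x\<bar>) = 0"
    by (rule continuous_constant_on_closure[where f = "\<lambda>x. pi * w x - sqrt (- discr (Z x)) / (2 * \<bar>amp x\<bar>)"])
       (use density_interior[OF \<mu> w] x cl in auto)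
  then show ?thesis by simp
qed

end

section \<open>The transfer matrices\<close>

lemma continuous_on_orth_poly: "continuous_on S (orth_poly a b n)"
proof (induction n rule: induct_nat_012)
  case 0 then show ?case by (simp add: orth_poly.simps(1)[abs_def])
next
  case 1
  have "orth_poly a b (Suc 0) = (\<lambda>x. (x - b 0) / a 0)" by (simp add: fun_eq_iff)
  then show ?case by (auto simp: divide_inverse intro!: continuous_intros)
next
  case (ge2 n)
  have "orth_poly a b (Suc (Suc n)) =
    (\<lambda>x. ((x - b (Suc n)) * orth_poly a b (Suc n) x - a n * orth_poly a b n x) / a (Suc n))"
    by (simp add: fun_eq_iff)
  then show ?case using ge2 by (auto simp: divide_inverse intro!: continuous_intros)
qed

text \<open>The entry 0 for p_(-1) makes the recurrence hold at n = 0 for every value of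
  \<open>am\<close>, which is multiplied by 0 there.\<close>

definition orth_vec :: "(nat \<Rightarrow> real) \<Rightarrow> (nat \<Rightarrow> real) \<Rightarrow> nat \<Rightarrow> real \<Rightarrow> real^2" where
  "orth_vec a b n x = vector [if n = 0 then 0 else orth_poly a b (n - 1) x, orth_poly a b n x]"

lemma orth_vec_nth [simp]:
  "orth_vec a b n x $ 1 = (if n = 0 then 0 else orth_poly a b (n - 1) x)"
  "orth_vec a b n x $ 2 = orth_poly a b n x"
  by (simp_all add: orth_vec_def)

lemma continuous_on_orth_vec: "continuous_on S (orth_vec a b n)"
proof -
  have "orth_vec a b n = (\<lambda>x. (if n = 0 then 0 else orth_poly a b (n - 1) x) *\<^sub>R axis 1 1 + orth_poly a b n x *\<^sub>R axis 2 1)"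
    by (auto simp: fun_eq_iff vec_eq_iff forall_2 axis_def)
  moreover have "continuous_on S (\<lambda>x. if n = 0 then 0 else orth_poly a b (n - 1) x)"
    by (cases "n = 0") (auto intro: continuous_on_orth_poly)
  ultimately show ?thesis by (simp add: continuous_intros continuous_on_orth_poly)
qed

lemma transfer1_orth_vec:
  "transfer1 am a b n x *v orth_vec a b n x = orth_vec a b (Suc n) x"
proof (cases n)
  case 0
  then show ?thesis
    by (simp add: vec_eq_iff forall_2 mat2_vec_nth transfer1_def)
next
  case (Suc m)
  then show ?thesis
    by (simp add: vec_eq_iff forall_2 mat2_vec_nth transfer1_def pre_def diff_divide_distrib left_diff_distrib)
qed

lemma transfer_orth_vec:
  "transfer am a b k n x *v orth_vec a b n x = orth_vec a b (n + k) x"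
  by (induction k) (simp_all add: matrix_vector_mul_assoc[symmetric] transfer1_orth_vec)

lemma det_transfer:
  assumes "\<And>n. 0 < a n" "0 < am"
  shows "det (transfer am a b k n x) = pre am a n / pre am a (n + k)"
proof (induction k)
  case 0
  have "0 < pre am a n" using assms by (simp add: pre_def)
  then show ?case by simp
next
  case (Suc k)
  have "0 < pre am a (n + k)" using assms by (simp add: pre_def)
  moreover have "det (transfer1 am a b (n + k) x) = pre am a (n + k) / pre am a (n + Suc k)"
    by (simp add: transfer1_def det_2 pre_def)
  ultimately show ?case using Suc by (simp add: det_mul)
qed

lemma orth_vec_nonzero:
  assumes a: "\<And>n. 0 < a n"
  shows "orth_vec a b n x \<noteq> 0"
proof (induction n)
  case 0 then show ?case by (simp add: vec_eq_iff forall_2)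
next
  case (Suc n)
  show ?case
  proof
    assume "orth_vec a b (Suc n) x = 0"
    then have z: "orth_poly a b n x = 0" "orth_poly a b (Suc n) x = 0"
      by (simp_all add: vec_eq_iff forall_2)
    show False
    proof (cases n)
      case 0 with z show False by simp
    next
      case (Suc k)
      then have "orth_poly a b k x = 0" using z a[of k] a[of "Suc k"] by simp
      then have "orth_vec a b n x = 0" using z Suc by (simp add: vec_eq_iff forall_2)
      with Suc.IH show False by simp
    qed
  qed
qed

text \<open>The bounds on \<open>F\<close> and \<open>G\<close> make the supremum a genuine one;
  over the reals \<open>SUP\<close> says nothing about an unbounded set.\<close>

lemma sup_dist_upper:
  assumes bound: "\<And>x. x \<in> K \<Longrightarrow> spec_norm (F x) \<le> C" "\<And>x. x \<in> K \<Longrightarrow> spec_norm (G x) \<le> C"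
    and x: "x \<in> K"
  shows "spec_norm (F x - G x) \<le> sup_dist K F G"
  unfolding sup_dist_def
proof (rule cSUP_upper[OF x])
  have "spec_norm (F y - G y) \<le> C + C" if "y \<in> K" for y
    using spec_norm_triangle[of "F y" "- G y"] bound[OF that] by (simp add: spec_norm_minus)
  then show "bdd_above ((\<lambda>x. spec_norm (F x - G x)) ` K)" by (intro bdd_aboveI2) auto
qed

text \<open>Absorbs the term \<open>1 / \<alpha> (Suc n)\<close> of
  \<open>kernel_asymptotics\<close> into the first part of \<open>error_sum\<close> and the constant
  \<open>1 / \<alpha> 0\<close>.\<close>

lemma inverse_le_total_variation:
  fixes f :: "nat \<Rightarrow> real"
  shows "f (Suc n) \<le> f 0 + (\<Sum>k=0..n. \<bar>f (Suc k) - f k\<bar>)"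
proof (induction n)
  case 0
  show ?case by simp
next
  case (Suc n)
  have "f (Suc (Suc n)) \<le> f (Suc n) + \<bar>f (Suc (Suc n)) - f (Suc n)\<bar>" by linarith
  with Suc show ?case by simp
qed

text \<open>The last implication covers the case in which \<open>error_sum\<close> vanishes: equal
  matrices have equal determinants \<open>\<alpha> j / \<alpha> (Suc j)\<close>, whose limit is 1,
  so \<alpha> is constant. Otherwise the term k = 0 of \<open>error_sum\<close> is a fixed positive
  number and absorbs the additive constant.\<close>

theorem theorem5p4:
  fixes a b :: "nat \<Rightarrow> real" and am l u :: real and N i :: nat
    and K :: "real set" and X :: "nat \<Rightarrow> real \<Rightarrow> real^2^2" and X_lim :: "real \<Rightarrow> real^2^2"
    and \<mu> :: "real measure" and \<mu>' :: "real \<Rightarrow> real"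
  defines "K \<equiv> {l..u}"
    and "X \<equiv> (\<lambda>j. transfer am a b N (j * N + i))"
    and "X_lim \<equiv> (\<lambda>x. lim (\<lambda>j. X j x))"
  assumes "\<And>n. a n > 0" and "am > 0"
    and "N > 0" and "i < N"
    and "l < u" and "K \<subseteq> Lambda_set X"
    and "(\<lambda>j. pre am a ((j + 1) * N + i) / pre am a (j * N + i)) \<longlonglongrightarrow> 1"
    and "class_D1 K X"
    and "filterlim (\<lambda>n. \<Sum>j=1..n. 1 / pre am a (j * N + i)) at_top sequentially"
    and "prob_space \<mu>" and "sets \<mu> = sets borel"
    and "orthonormal_in_L2 \<mu> (orth_poly a b)"
    and "continuous_positive_density_on \<mu> K \<mu>'"
  shows "\<exists>E c. c > 0 \<and>
    (\<forall>n. \<forall>x\<in>K. cd_kernel a b N i n x x =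
        \<bar>X_lim x $ 2 $ 1\<bar> / (pi * \<mu>' x * sqrt (- discr (X_lim x))) * rho_pred am a N i (n + 1)
        + E n x) \<and>
    ((\<exists>j. \<exists>x\<in>K. X j x \<noteq> X 0 x) \<longrightarrow>
        (\<forall>n. \<forall>x\<in>K. \<bar>E n x\<bar> \<le> c * error_sum am a N i K X n)) \<and>
    ((\<forall>j. \<forall>x\<in>K. X j x = X 0 x) \<longrightarrow> (\<forall>n. \<forall>x\<in>K. \<bar>E n x\<bar> \<le> c))"
proof -
  note a_pos = assms(4) and am_pos = assms(5) and N_pos = assms(6) and l_less_u = assms(8)
  define \<alpha> where "\<alpha> j = pre am a (j * N + i)" for j
  define v where "v j = orth_vec a b (j * N + i)" for j
  define d where "d j = sup_dist K (X (j + 1)) (X j)" for j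
  have \<alpha>_pos: "0 < \<alpha> j" for j using a_pos am_pos by (simp add: \<alpha>_def pre_def)
  have cont_X: "continuous_on K (X j)" for j using assms(11) by (simp add: class_D1_def)
  obtain C where C: "\<And>j x. x \<in> K \<Longrightarrow> spec_norm (X j x) \<le> C"
    using assms(11) unfolding class_D1_def by blast
  define M where "M = max 1 C"
  have l_in: "l \<in> K" using l_less_u by (simp add: K_def)
  have d_summable: "summable d" using assms(11) by (simp add: class_D1_def d_def[abs_def])
  have X_diff: "spec_norm (X (Suc j) x - X j x) \<le> d j" if "x \<in> K" for j x
    unfolding d_def Suc_eq_plus1 by (rule sup_dist_upper[OF C C that])
  have d_nonneg: "0 \<le> d j" for j
    using X_diff[OF l_in, of j] spec_norm_nonneg order_trans by blast
  have X_lim: "(\<lambda>j. X j x) \<longlonglongrightarrow> X_lim x" if x: "x \<in> K" for x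
  proof -
    have "convergent (\<lambda>j. X j x)"
    proof (rule summable_increments_limit[of 0 "\<lambda>j. X j x" "\<lambda>j. 4 * d j"])
      show "norm (X (Suc j) x - X j x) \<le> 4 * d j" for j
        using norm_le_spec_norm_mult[of "X (Suc j) x - X j x"] X_diff[OF x, of j] by linarith
      show "summable (\<lambda>j. 4 * d j)" by (intro summable_mult d_summable)
    qed (rule convergentI)
    then show ?thesis unfolding X_lim_def by (simp add: convergent_LIMSEQ_iff)
  qed
  have X_lim_elliptic: "discr (X_lim x) < 0" if x: "x \<in> K" for x
  proof -
    obtain L where L: "L < 0" "(\<lambda>j. discr (X j x)) \<longlonglongrightarrow> L"
      using assms(9) x by (auto simp: Lambda_set_def)
    have "(\<lambda>j. discr (X j x)) \<longlonglongrightarrow> discr (X_lim x)"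
      unfolding discr_alt by (intro tendsto_intros X_lim x)
    with L show ?thesis using LIMSEQ_unique by blast
  qed
  have \<alpha>_ratio: "(\<lambda>j. \<alpha> j / \<alpha> (Suc j)) \<longlonglongrightarrow> 1"
    using tendsto_inverse[OF assms(10)] by (simp add: \<alpha>_def)
  have not_summable: "\<not> summable (\<lambda>j. 1 / \<alpha> j)"
  proof
    assume s: "summable (\<lambda>j. 1 / \<alpha> j)"
    have le: "(\<Sum>j=1..n. 1 / \<alpha> j) \<le> suminf (\<lambda>j. 1 / \<alpha> j)" for n
      using \<alpha>_pos by (intro sum_le_suminf s) (auto simp: less_imp_le)
    have "eventually (\<lambda>n. suminf (\<lambda>j. 1 / \<alpha> j) + 1 \<le> (\<Sum>j=1..n. 1 / \<alpha> j)) sequentially"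
      using assms(12) unfolding filterlim_at_top \<alpha>_def by blast
    then obtain n where "suminf (\<lambda>j. 1 / \<alpha> j) + 1 \<le> (\<Sum>j=1..n. 1 / \<alpha> j)"
      unfolding eventually_sequentially by blast
    with le[of n] show False by linarith
  qed
  \<comment> \<open>Since \<open>Suc j * N\<close> is positive, the truncated subtraction is exact,
    also for i = 0.\<close>
  define m where "m j = Suc j * N + i - 1" for j
  have m_Suc: "Suc j * N + i = Suc (m j)" for j using N_pos by (simp add: m_def)
  have "m j < m (Suc j)" for j
  proof -
    have "Suc (m j) < Suc (m (Suc j))" unfolding m_Suc[symmetric] using N_pos by simp
    then show ?thesis by simp
  qed
  then have m_mono: "strict_mono m" by (simp add: strict_mono_Suc_iff)
  interpret elliptic_jacobi a b l u X v \<alpha> d X_lim M m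
  proof
    show "0 < a n" for n by (rule a_pos)
    show "compact {l..u}" by simp
    show "continuous_on {l..u} (X j)" for j using cont_X by (simp add: K_def)
    show "continuous_on {l..u} (v j)" for j unfolding v_def by (rule continuous_on_orth_vec)
    show "det (X j x) = \<alpha> j / \<alpha> (Suc j)" for j x
      unfolding X_def \<alpha>_def det_transfer[OF a_pos am_pos] by (simp add: add_ac)
    show "v (Suc j) x = X j x *v v j x" for j x
      unfolding X_def v_def transfer_orth_vec by (simp add: add_ac)
    show "v j x \<noteq> 0" for j x unfolding v_def by (rule orth_vec_nonzero[OF a_pos])
    show "spec_norm (X (Suc j) x - X j x) \<le> d j" if "x \<in> {l..u}" for j x
      using X_diff that by (simp add: K_def)
    show "spec_norm (X j x) \<le> M" if "x \<in> {l..u}" for j x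
      using C[of x j] that by (simp add: K_def M_def le_max_iff_disj)
    show "(\<lambda>j. X j x) \<longlonglongrightarrow> X_lim x" if "x \<in> {l..u}" for x using X_lim that by (simp add: K_def)
    show "discr (X_lim x) < 0" if "x \<in> {l..u}" for x using X_lim_elliptic that by (simp add: K_def)
    show "v (Suc j) x $ 1 = orth_poly a b (m j) x" "v (Suc j) x $ 2 = orth_poly a b (Suc (m j)) x" for j x
      unfolding v_def m_Suc by simp_all
    show "\<alpha> (Suc j) = a (m j)" for j unfolding \<alpha>_def m_Suc by (simp add: pre_def)
  qed (use \<alpha>_pos \<alpha>_ratio d_nonneg d_summable l_less_u m_mono not_summable in \<open>auto simp: M_def\<close>)
  define w where "w x = \<bar>X_lim x $ 2 $ 1\<bar> / (pi * \<mu>' x * sqrt (- discr (X_lim x)))" for x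
  have w_eq: "w x = 2 * X_lim x $ 2 $ 1 * amp x / (- discr (X_lim x))" if x: "x \<in> K" for x
  proof -
    have x': "x \<in> {l..u}" using x by (simp add: K_def)
    define D where "D = - discr (X_lim x)"
    have D: "0 < D" using X_lim_elliptic[OF x] by (simp add: D_def)
    have "w x = \<bar>X_lim x $ 2 $ 1\<bar> / (sqrt D / (2 * \<bar>amp x\<bar>) * sqrt D)"
      unfolding w_def D_def density_formula[OF assms(13-15) assms(16)[unfolded K_def] x'] ..
    also have "\<dots> = \<bar>X_lim x $ 2 $ 1\<bar> / ((sqrt D * sqrt D) / (2 * \<bar>amp x\<bar>))" by simp
    also have "\<dots> = 2 * \<bar>X_lim x $ 2 $ 1 * amp x\<bar> / D"
      using D amp_nonzero[OF x'] by (simp add: abs_mult)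
    also have "\<bar>X_lim x $ 2 $ 1 * amp x\<bar> = X_lim x $ 2 $ 1 * amp x" using amp_sign[OF x'] by simp
    finally show ?thesis by (simp add: D_def)
  qed
  define E where "E n x = cd_kernel a b N i n x x - w x * rho_pred am a N i (n + 1)" for n x
  obtain C1 where C1: "C1 \<ge> 0"
    "\<And>n x. x \<in> {l..u} \<Longrightarrow> \<bar>(\<Sum>j=0..n. (v j x $ 2)\<^sup>2) - 2 * X_lim x $ 2 $ 1 * amp x / (- discr (X_lim x)) * (\<Sum>j=0..Suc n. 1 / \<alpha> j)\<bar>
    \<le> C1 * (1 + 1 / \<alpha> (Suc n) + (\<Sum>k=0..n. tail k / \<alpha> (Suc k)))"
    using kernel_asymptotics by blast
  have err: "error_sum am a N i K X n = (\<Sum>k=0..n. \<bar>1 / \<alpha> (Suc k) - 1 / \<alpha> k\<bar>) + (\<Sum>k=0..n. tail k / \<alpha> (Suc k))" for n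
    unfolding error_sum_def tail_def d_def \<alpha>_def by (simp add: sum.distrib add_ac)
  define C2 where "C2 = C1 * (1 + 1 / \<alpha> 0)"
  have C2: "0 \<le> C2" using C1 \<alpha>_pos[of 0] by (simp add: C2_def)
  have E_bound: "\<bar>E n x\<bar> \<le> C2 + C1 * error_sum am a N i K X n" if x: "x \<in> K" for n x
  proof -
    have "\<bar>E n x\<bar> = \<bar>(\<Sum>j=0..n. (v j x $ 2)\<^sup>2) - 2 * X_lim x $ 2 $ 1 * amp x / (- discr (X_lim x)) * (\<Sum>j=0..Suc n. 1 / \<alpha> j)\<bar>"
      unfolding E_def w_eq[OF x] cd_kernel_def rho_pred_def v_def \<alpha>_def by (simp add: power2_eq_square)
    also have "\<dots> \<le> C1 * (1 + 1 / \<alpha> (Suc n) + (\<Sum>k=0..n. tail k / \<alpha> (Suc k)))"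
      using C1(2) x by (simp only: K_def)
    also have "\<dots> \<le> C1 * ((1 + 1 / \<alpha> 0) + error_sum am a N i K X n)"
      unfolding err using inverse_le_total_variation[of "\<lambda>k. 1 / \<alpha> k" n] by (intro mult_left_mono C1(1)) linarith
    finally show ?thesis by (simp add: C2_def distrib_left)
  qed
  have terms_nonneg: "0 \<le> tail k / \<alpha> (Suc k)" for k using tail_nonneg \<alpha>_pos by (simp add: less_imp_le)
  \<comment> \<open>The part of the term k = 0 that is positive as soon as two of the matrices
    differ somewhere on \<open>K\<close>.\<close>
  define e0 where "e0 = tail 0 / \<alpha> (Suc 0)"
  have e0_le: "e0 \<le> error_sum am a N i K X n" for n
  proof -
    have "e0 \<le> (\<Sum>k=0..n. tail k / \<alpha> (Suc k))"
      unfolding e0_def by (rule member_le_sum) (use terms_nonneg in auto)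
    moreover have "0 \<le> (\<Sum>k=0..n. \<bar>1 / \<alpha> (Suc k) - 1 / \<alpha> k\<bar>)" by (rule sum_nonneg) simp
    ultimately show ?thesis unfolding err by linarith
  qed
  \<comment> \<open>One constant serves both cases: if all matrices agree, \<open>e0\<close> and
    hence \<open>C2 / e0\<close> is 0, and the summand \<open>C2\<close> gives the bound.\<close>
  define c where "c = C2 / e0 + C1 + C2 + 1"
  have e0_nonneg: "0 \<le> e0" unfolding e0_def by (rule terms_nonneg)
  have c_pos: "0 < c" using C1(1) C2 e0_nonneg by (simp add: c_def add_nonneg_pos)
  have nonconst: "\<bar>E n x\<bar> \<le> c * error_sum am a N i K X n"
    if ex: "\<exists>j. \<exists>x\<in>K. X j x \<noteq> X 0 x" and x: "x \<in> K" for n x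
  proof -
    have "tail 0 \<noteq> 0"
    proof
      assume "tail 0 = 0"
      then have d0: "d j = 0" for j
        using suminf_eq_zero_iff[OF d_summable] d_nonneg by (simp add: tail_def)
      have "X j y = X 0 y" if "y \<in> K" for j y
      proof (induction j)
        case (Suc j)
        have "spec_norm (X (Suc j) y - X j y) = 0"
          using X_diff[OF that, of j] spec_norm_nonneg[of "X (Suc j) y - X j y"] d0[of j] by simp
        then show ?case using Suc by (simp add: spec_norm_zero_iff)
      qed simp
      with ex show False by blast
    qed
    then have e0: "0 < e0" using tail_nonneg[of 0] \<alpha>_pos[of "Suc 0"] by (simp add: e0_def less_le)
    have "C2 = C2 / e0 * e0" using e0 by simp
    also have "\<dots> \<le> C2 / e0 * error_sum am a N i K X n"
      using C2 e0 by (intro mult_left_mono e0_le) auto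
    finally have "\<bar>E n x\<bar> \<le> (C2 / e0 + C1) * error_sum am a N i K X n"
      using E_bound[OF x, of n] by (simp add: distrib_right)
    also have "\<dots> \<le> c * error_sum am a N i K X n"
      using C2 e0_le[of n] e0 by (intro mult_right_mono) (auto simp: c_def)
    finally show ?thesis .
  qed
  have const: "\<bar>E n x\<bar> \<le> c" if eq: "\<forall>j. \<forall>x\<in>K. X j x = X 0 x" and x: "x \<in> K" for n x
  proof -
    have d0: "d j = 0" for j
    proof -
      have "d j = (SUP x\<in>K. 0)"
        unfolding d_def sup_dist_def
        by (rule SUP_cong[OF refl]) (metis eq diff_self spec_norm_zero_iff)
      moreover have "K \<noteq> {}" using l_in by blast
      ultimately show ?thesis by simp
    qed
    have tail0: "tail k = 0" for k by (simp add: tail_def d0)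
    have ratio: "\<alpha> j / \<alpha> (Suc j) = det (X 0 l)" for j
    proof -
      have "X j l = X 0 l" using eq l_in by blast
      moreover have "det (X j l) = \<alpha> j / \<alpha> (Suc j)"
        using l_in unfolding K_def by (rule det_Y)
      ultimately show ?thesis by metis
    qed
    have "det (X 0 l) = 1" using \<alpha>_ratio unfolding ratio LIMSEQ_const_iff .
    then have "\<alpha> (Suc j) = \<alpha> j" for j
      using ratio[of j] \<alpha>_pos[of "Suc j"] by simp
    then have "error_sum am a N i K X n = 0" unfolding err by (simp add: tail0)
    with E_bound[OF x, of n] have "\<bar>E n x\<bar> \<le> C2" by simp
    moreover have "0 \<le> C2 / e0" using C2 e0_nonneg by simp
    ultimately show ?thesis using C1(1) unfolding c_def by linarith
  qed
  show ?thesis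
  proof (rule exI[of _ E], rule exI[of _ c], intro conjI impI allI ballI)
    fix n x assume "x \<in> K"
    show "cd_kernel a b N i n x x =
        \<bar>X_lim x $ 2 $ 1\<bar> / (pi * \<mu>' x * sqrt (- discr (X_lim x))) * rho_pred am a N i (n + 1) + E n x"
      unfolding w_def[symmetric] E_def by simp
  qed (fact c_pos nonconst const)+
qed

end
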